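(* Fix an o-minimal structure over $\mathbb{R}$. Let $(X,p,B)$ be a fiber bundle with typical fiber $F$, where $p:X\to B$ is definable and $X$, $B$ and $F$ are finite simplicial complexes. Let $B'\subset B$ be definable such that, if we denote $A=p^{-1}(B')$, there are homeomorphisms $\overline{A}\overset{g}{\approx}\overline{B'}\times F$ and $A\overset{g}{\approx}B'\times F$ given by $g$. Let $h:X\to\mathbb{Z}$ be defined as $h=\mathds{1}_A$, and let $l:X\to X$ be a map such that $l_{|\overline{A}}\equiv l_1\times l_2$ (under the identification $g$) with $l_1:\overline{B'}\to\overline{B'}$ and $l_2:F\to F$. Suppose also that $l_1$ has no fixed points in $\overline{B'}\setminus\mathring{B'}$ (and, hence, $l$ has no fixed points in $\overline{A}\setminus\mathring{A}$). Then $$\int_X h\; d\,i_c(l)=\int_B\left(\int_{p^{-1}(b)}h\;d\,i_c(\mathrm{id}\times l_2)\right)d\,i_c(l_1).$$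
   Context: Simplicial complexes are finite and identified with their geometric realizations. Maps $l$, $l_1$, $l_2$ are continuous and are not required to be homeomorphisms. $\mathds{1}_A$ is the characteristic function of $A$. Bars and rings denote closures and interiors, taken in $X$ for $A$ and in $B$ for $B'$. An o-minimal structure over $\mathbb{R}$ is a collection $\{\mathscr{A}_n\}_{n\in\mathbb{N}}$, where $\mathscr{A}_n$ is an algebra of subsets of $\mathbb{R}^n$, closed under cartesian products and canonical projections, with $\{(x,y): x<y\}\in\mathscr{A}_2$, with $\mathscr{A}_1$ consisting of all finite unions of points and open intervals, and with every $\mathscr{A}_n$ containing all algebraic subsets of $\mathbb{R}^n$. A set in $\mathbb{R}^n$ is definable if it belongs to $\mathscr{A}_n$; a map is definable if its graph is. Fixed point index: for a finite simplicial complex $X$, a continuous map $f:X\to X$ and an open set $U\subset X$ such that $f$ has no fixed points in $\overline{U}\setminus U$, $i(X,f,U)\in\mathbb{Z}$ denotes the classical fixed point index. It depends only on the restriction of $f$ to $\overline{U}$, and classically it is defined for a continuous map $f:\overline{U}\to X$ without fixed points in $\overline{U}\setminus U$. Combinatorial fixed point index: for a subspace $A\subset X$ such that $f$ has no fixed points in $\overline{A}\setminus\mathring{A}$, $i_c(X,f,A):=i(X,f,\mathring{A})$. Integral: if $h=\sum_{j=1}^n d_j\mathds{1}_{U_j}:X\to\mathbb{Z}$ with $d_j\in\mathbb{Z}$ and $f$ has no fixed points in $\overline{U_j}\setminus\mathring{U_j}$ for every $j$, then $\int_X h\;d\,i_c(f):=\sum_{j=1}^n d_j\, i_c(X,f,U_j)$,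 which is independent of the expression chosen for $h$. In the iterated integral, $\mathrm{id}\times l_2$ is the self-map of the fiber $p^{-1}(b)$ given by $l_2$ when $p^{-1}(b)$ is identified with $\{b\}\times F$, and the inner integral is of the restriction of $h$ to $p^{-1}(b)$. The outer integral is the integral just defined, with $B$ and $l_1$ in place of $X$ and $f$, i.e. it uses $i_c(B,l_1,\cdot)$. *)

theory Defs
  imports "HOL-Analysis.Analysis"
begin

section \<open>O-minimal structures over the reals\<close>

text \<open>
  Since an o-minimal structure involves all the spaces \<open>\<real>\<^sup>n\<close> at once, \<open>\<real>\<^sup>n\<close> is represented
  here by the real lists of length \<open>n\<close>, so that the cartesian product of sets is concatenation.
\<close>

definition Rn :: "nat \<Rightarrow> real list set" where
  "Rn n = {xs. length xs = n}"

inductive poly_fun :: "nat \<Rightarrow> (real list \<Rightarrow> real) \<Rightarrow> bool" for n where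
  const: "poly_fun n (\<lambda>xs. c)"
| coord: "i < n \<Longrightarrow> poly_fun n (\<lambda>xs. xs ! i)"
| add: "poly_fun n P \<Longrightarrow> poly_fun n Q \<Longrightarrow> poly_fun n (\<lambda>xs. P xs + Q xs)"
| mult: "poly_fun n P \<Longrightarrow> poly_fun n Q \<Longrightarrow> poly_fun n (\<lambda>xs. P xs * Q xs)"

definition algebraic_set :: "nat \<Rightarrow> real list set \<Rightarrow> bool" where
  "algebraic_set n S \<longleftrightarrow>
     (\<exists>\<P>. finite \<P> \<and> (\<forall>P\<in>\<P>. poly_fun n P) \<and> S = {xs \<in> Rn n. \<forall>P\<in>\<P>. P xs = 0})"

text \<open>
  In the condition on \<open>\<A> 1\<close> the open intervals may be unbounded, as they must be for
  \<open>\<A> 1\<close> to be an algebra of subsets of the line.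
\<close>

definition o_minimal :: "(nat \<Rightarrow> real list set set) \<Rightarrow> bool" where
  "o_minimal \<A> \<longleftrightarrow>
     (\<forall>n. algebra (Rn n) (\<A> n)) \<and>
     (\<forall>m n S T. S \<in> \<A> m \<longrightarrow> T \<in> \<A> n \<longrightarrow> {xs @ ys | xs ys. xs \<in> S \<and> ys \<in> T} \<in> \<A> (m + n)) \<and>
     (\<forall>m n S. S \<in> \<A> (m + n) \<longrightarrow> take m ` S \<in> \<A> m \<and> drop m ` S \<in> \<A> n) \<and>
     {[x, y] | x y. x < y} \<in> \<A> 2 \<and>
     \<A> 1 = {(\<lambda>x. [x]) ` (P \<union> \<Union>\<J>) | P \<J>.
               finite P \<and> finite \<J> \<and> (\<forall>J\<in>\<J>. open J \<and> is_interval J)} \<and>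
     (\<forall>n S. algebraic_set n S \<longrightarrow> S \<in> \<A> n)"

text \<open>
  Subsets of a Euclidean space are read as sets of coordinate lists with respect to an enumeration
  of the standard basis. Which one is immaterial: an o-minimal structure is stable under
  permutations of the coordinates.
\<close>

definition definable :: "(nat \<Rightarrow> real list set set) \<Rightarrow> 'a::euclidean_space set \<Rightarrow> bool" where
  "definable \<A> S \<longleftrightarrow>
     (\<exists>bs. distinct bs \<and> set bs = (Basis :: 'a set) \<and>
           (\<lambda>x. map (\<lambda>b. x \<bullet> b) bs) ` S \<in> \<A> DIM('a))"

definition definable_map ::
  "(nat \<Rightarrow> real list set set) \<Rightarrow> 'a::euclidean_space set \<Rightarrow> ('a \<Rightarrow> 'b::euclidean_space) \<Rightarrow> bool" where
  "definable_map \<A> X f \<longleftrightarrow> definable \<A> ((\<lambda>x. (x, f x)) ` X)"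


section \<open>Fiber bundles\<close>

definition fiber_bundle ::
  "'a::topological_space set \<Rightarrow> ('a \<Rightarrow> 'b::topological_space) \<Rightarrow> 'b set \<Rightarrow> 'c::topological_space set
    \<Rightarrow> bool" where
  "fiber_bundle X p B F \<longleftrightarrow>
     continuous_on X p \<and> p ` X \<subseteq> B \<and>
     (\<forall>b\<in>B. \<exists>U \<phi> \<psi>. b \<in> U \<and> openin (top_of_set B) U \<and>
        homeomorphism (X \<inter> p -` U) (U \<times> F) \<phi> \<psi> \<and>
        (\<forall>x \<in> X \<inter> p -` U. fst (\<phi> x) = p x))"


section \<open>The Brouwer degree and the fixed point index\<close>

text \<open>
  The degree at \<open>0\<close> of a map \<open>F\<close> that is continuous on the closure of the bounded open set \<open>V\<close>
  and has no zero on its frontier: the signed number of zeros of every sufficiently close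
  \<open>C\<^sup>1\<close> map for which \<open>0\<close> is a regular value. Here \<open>J\<close> is the Jacobian matrix of \<open>G\<close>.
\<close>

definition brouwer_degree :: "(real ^ 'n) set \<Rightarrow> (real ^ 'n \<Rightarrow> real ^ 'n) \<Rightarrow> int" where
  "brouwer_degree V F = (THE d. \<exists>\<epsilon>>0. \<forall>G J.
     (\<forall>x. (G has_derivative (\<lambda>v. J x *v v)) (at x)) \<and> continuous_on UNIV J \<and>
     (\<forall>x\<in>closure V. norm (G x - F x) < \<epsilon>) \<and>
     (\<forall>x\<in>V. G x = 0 \<longrightarrow> det (J x) \<noteq> 0)
     \<longrightarrow> real_of_int d = (\<Sum>x | x \<in> V \<and> G x = 0. sgn (det (J x))))"

text \<open>
  The classical index \<open>i(X, f, U)\<close>, for a compact Euclidean neighbourhood retract \<open>X\<close>, a set \<open>U\<close>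
  that is open in \<open>X\<close> and a continuous map \<open>f\<close> from the closure of \<open>U\<close> in \<open>X\<close> to \<open>X\<close> with no fixed
  point on the frontier of \<open>U\<close>: the degree of \<open>id - f \<circ> r\<close> near the fixed points in \<open>U\<close>, where \<open>r\<close>
  is a retraction of a neighbourhood \<open>W\<close> onto \<open>X\<close>. It does not depend on \<open>W\<close>, \<open>r\<close>, \<open>V\<close>.
  Neighbourhood retracts include the finite simplicial complexes and all subsets of
  \<open>\<real>\<^sup>n\<close> homeomorphic to one, such as the fibers of a bundle whose typical fiber is one.
\<close>

definition fixed_point_index ::
  "(real ^ 'n) set \<Rightarrow> (real ^ 'n \<Rightarrow> real ^ 'n) \<Rightarrow> (real ^ 'n) set \<Rightarrow> int" where
  "fixed_point_index X f U = (THE d. \<forall>W r V.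
     open W \<and> retraction W X r \<and>
     open V \<and> bounded V \<and> {x\<in>U. f x = x} \<subseteq> V \<and> closure V \<subseteq> W \<inter> r -` U
     \<longrightarrow> d = brouwer_degree V (\<lambda>x. x - f (r x)))"

definition combinatorial_index ::
  "(real ^ 'n) set \<Rightarrow> (real ^ 'n \<Rightarrow> real ^ 'n) \<Rightarrow> (real ^ 'n) set \<Rightarrow> int" where
  "combinatorial_index X f A = fixed_point_index X f (top_of_set X interior_of A)"

text \<open>
  The sets that may occur in an expression of an integrand. The map \<open>f\<close> need only be defined on the
  closure of the set (outside the domain of a partially defined map, \<open>f\<close> has arbitrary values);
  for a continuous \<open>f : X \<rightarrow> X\<close> the two conditions on the closure hold automatically.
\<close>

definition index_admissible ::
  "(real ^ 'n) set \<Rightarrow> (real ^ 'n \<Rightarrow> real ^ 'n) \<Rightarrow> (real ^ 'n) set \<Rightarrow> bool" where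
  "index_admissible X f U \<longleftrightarrow>
     U \<subseteq> X \<and>
     continuous_on (top_of_set X closure_of U) f \<and> f ` (top_of_set X closure_of U) \<subseteq> X \<and>
     (\<forall>x \<in> (top_of_set X closure_of U) - (top_of_set X interior_of U). f x \<noteq> x)"

definition index_integral ::
  "(real ^ 'n) set \<Rightarrow> (real ^ 'n \<Rightarrow> real ^ 'n) \<Rightarrow> (real ^ 'n \<Rightarrow> int) \<Rightarrow> int" where
  "index_integral X f h = (THE v. \<exists>n (d :: nat \<Rightarrow> int) U.
     (\<forall>j<n. index_admissible X f (U j)) \<and>
     (\<forall>x\<in>X. h x = (\<Sum>j<n. d j * indicator (U j) x)) \<and>
     v = (\<Sum>j<n. d j * combinatorial_index X f (U j)))"

end

(*
  The integral of a multiple of an indicator is the same multiple of an index, so the theorem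
  reduces to i(X, l, int A) = i(B, l1, int B') i(F, l2, F), together with the invariance of the
  index under homeomorphisms, which evaluates the inner integral, and the independence of the
  integral of the chosen expression.

  All of this rests on the Brouwer degree. That the signed count of regular zeros is stable under
  small perturbations is shown analytically: it is the integral of the Jacobian determinant of a
  truncation of the map, and the integral of det DK vanishes for compactly supported K, because
  x + tK(x) is a bijection of a large ball. The two key properties of the degree,
  multiplicativity and deg(id - b o a) = deg(id - a o b), are read off from regular approximations,
  the latter from det(1 - BA) = det(1 - AB). Taking a and b to be composites of the
  trivialization with neighbourhood retractions, the second property transports the index from the
  bundle to the product; it also shows that the index does not depend on the retraction.
*)

theory Submission
  imports Defs
begin

section \<open>Determinants\<close>

text \<open>The trivialization and the retractions are merely continuous, so the index cannot be
  carried to the product by a change of coordinates. Commutation can do this: it compares maps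
  between spaces of different dimension, and smoothness enters only after \<open>a\<close> and
  \<open>b\<close> have been replaced by polynomials. One regular value then serves both composites,
  because the determinant identity transfers nondegeneracy together with the sign.

  The approximations in the definition of the degree are only of class C^1. The usual reason why the
  integral of a Jacobian determinant vanishes, namely that it is the divergence of a cofactor field,
  takes second derivatives; the bijection of a ball uses first derivatives only. Integrals also
  replace a homotopy between two approximations, whose intermediate maps could have degenerate
  zeros: a narrow density \<open>bump a\<close> turns a count into an integral, and the integrals
  are compared without looking at zeros at all.\<close>

lemma det_reindex:
  fixes A :: "real ^ 'a ^ 'a" and e :: "'b :: finite \<Rightarrow> 'a"
  assumes "bij e"
  shows "det (\<chi> i j. A $ e i $ e j) = det A"
proof -
  have inje: "inj e" and surje: "surj e"
    using assms by (auto simp: bij_def)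
  have bij: "bij_betw (map_permutation UNIV e) {p. p permutes UNIV} {p. p permutes UNIV}"
  proof -
    have "map_permutation UNIV e = (\<lambda>\<pi> x. e (\<pi> (inv e x)))"
      by (simp add: fun_eq_iff map_permutation_def restrict_id_def surje)
    then show ?thesis
      using bij_betw_permutations[OF assms] by simp
  qed
  have "det A = (\<Sum>p | p permutes UNIV. of_int (sign p) * (\<Prod>i\<in>UNIV. A $ i $ p i))"
    by (simp add: det_def)
  also have "\<dots> = (\<Sum>p | p permutes UNIV. of_int (sign (map_permutation UNIV e p)) *
      (\<Prod>i\<in>UNIV. A $ i $ map_permutation UNIV e p i))"
    by (rule sum.reindex_bij_betw[OF bij, symmetric])
  also have "\<dots> = (\<Sum>p | p permutes UNIV. of_int (sign p) * (\<Prod>i\<in>UNIV. A $ e i $ e (p i)))"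
  proof (rule sum.cong[OF refl])
    fix p :: "'b \<Rightarrow> 'b" assume "p \<in> {p. p permutes UNIV}"
    then have p: "p permutes UNIV" by simp
    have "(\<Prod>i\<in>UNIV. A $ i $ map_permutation UNIV e p i) =
        (\<Prod>i\<in>UNIV. A $ e i $ map_permutation UNIV e p (e i))"
      by (rule prod.reindex_bij_betw[OF assms, symmetric])
    also have "\<dots> = (\<Prod>i\<in>UNIV. A $ e i $ e (p i))"
      by (simp add: map_permutation_apply[OF inje])
    finally show "of_int (sign (map_permutation UNIV e p)) * (\<Prod>i\<in>UNIV. A $ i $ map_permutation UNIV e p i)
        = of_int (sign p) * (\<Prod>i\<in>UNIV. A $ e i $ e (p i))"
      by (simp add: sign_map_permutation[OF inje p])
  qed
  finally show ?thesis by (simp add: det_def)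
qed

section \<open>Block matrices and the identity det (1 - BA) = det (1 - AB)\<close>

lemma permutes_UNIV_iff: "p permutes UNIV \<longleftrightarrow> bij p"
  by (auto intro: permutes_bij bij_imp_permutes)

text \<open>Split \<open>map_sum p q\<close> as \<open>map_sum p id \<circ> map_sum id q\<close>.
  The factors are the transports of \<open>p\<close> and \<open>q\<close> along \<open>Inl\<close>
  and \<open>Inr\<close>, extended by the identity, and transport keeps the sign.\<close>

lemma sign_map_sum:
  fixes p :: "'a :: finite \<Rightarrow> 'a" and q :: "'b :: finite \<Rightarrow> 'b"
  assumes p: "p permutes UNIV" and q: "q permutes UNIV"
  shows "sign (map_sum p q) = sign p * sign q"
proof -
  have L: "map_permutation UNIV Inl p = (map_sum p id :: 'a + 'b \<Rightarrow> _)"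
  proof
    fix x :: "'a + 'b"
    show "map_permutation UNIV Inl p x = map_sum p id x"
      by (cases x) (auto simp: map_permutation_apply map_permutation_def restrict_id_def)
  qed
  have R: "map_permutation UNIV Inr q = (map_sum id q :: 'a + 'b \<Rightarrow> _)"
  proof
    fix x :: "'a + 'b"
    show "map_permutation UNIV Inr q x = map_sum id q x"
      by (cases x) (auto simp: map_permutation_apply map_permutation_def restrict_id_def)
  qed
  have perL: "map_permutation UNIV Inl p permutes (range Inl :: ('a + 'b) set)"
    by (rule map_permutation_permutes[OF _ p]) (auto simp: bij_betw_def)
  have perR: "map_permutation UNIV Inr q permutes (range Inr :: ('a + 'b) set)"
    by (rule map_permutation_permutes[OF _ q]) (auto simp: bij_betw_def)
  have "permutation (map_sum p id :: 'a + 'b \<Rightarrow> _)" "permutation (map_sum id q :: 'a + 'b \<Rightarrow> _)"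
    using perL perR L R by (metis finite permutes_imp_permutation)+
  then have "sign (map_sum p id \<circ> map_sum id q :: 'a + 'b \<Rightarrow> _) =
      sign (map_sum p id :: 'a + 'b \<Rightarrow> _) * sign (map_sum id q :: 'a + 'b \<Rightarrow> _)"
    by (rule sign_compose)
  moreover have "sign (map_sum p id :: 'a + 'b \<Rightarrow> _) = sign p"
    unfolding L[symmetric] by (rule sign_map_permutation) (use p in auto)
  moreover have "sign (map_sum id q :: 'a + 'b \<Rightarrow> _) = sign q"
    unfolding R[symmetric] by (rule sign_map_permutation) (use q in auto)
  ultimately show ?thesis
    by (simp add: map_sum.comp)
qed

definition block_matrix ::
  "real ^ 'a ^ 'a \<Rightarrow> real ^ 'b ^ 'a \<Rightarrow> real ^ 'a ^ 'b \<Rightarrow> real ^ 'b ^ 'b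
    \<Rightarrow> real ^ ('a + 'b) ^ ('a + 'b)" where
  "block_matrix A B C D = (\<chi> i j. case i of
     Inl i \<Rightarrow> (case j of Inl j \<Rightarrow> A $ i $ j | Inr j \<Rightarrow> B $ i $ j)
   | Inr i \<Rightarrow> (case j of Inl j \<Rightarrow> C $ i $ j | Inr j \<Rightarrow> D $ i $ j))"

lemma block_matrix_simps [simp]:
  "block_matrix A B C D $ Inl i $ Inl j = A $ i $ j"
  "block_matrix A B C D $ Inl i $ Inr j' = B $ i $ j'"
  "block_matrix A B C D $ Inr i' $ Inl j = C $ i' $ j"
  "block_matrix A B C D $ Inr i' $ Inr j' = D $ i' $ j'"
  by (simp_all add: block_matrix_def)

lemma sum_UNIV_sum:
  fixes f :: "'a :: finite + 'b :: finite \<Rightarrow> 'c :: comm_monoid_add"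
  shows "sum f UNIV = (\<Sum>i\<in>UNIV. f (Inl i)) + (\<Sum>i\<in>UNIV. f (Inr i))"
  using sum.Plus[of UNIV UNIV f] by (simp add: comp_def)

lemma prod_UNIV_sum:
  fixes f :: "'a :: finite + 'b :: finite \<Rightarrow> 'c :: comm_monoid_mult"
  shows "prod f UNIV = (\<Prod>i\<in>UNIV. f (Inl i)) * (\<Prod>i\<in>UNIV. f (Inr i))"
  using prod.Plus[of UNIV UNIV f] by (simp add: comp_def)

lemma bij_map_sum:
  assumes "bij p" "bij q"
  shows "bij (map_sum p q)"
proof (rule o_bij)
  show "map_sum (inv p) (inv q) \<circ> map_sum p q = id" "map_sum p q \<circ> map_sum (inv p) (inv q) = id"
    using assms by (simp_all add: map_sum.comp bij_is_inj bij_is_surj[THEN surj_iff[THEN iffD1]] map_sum.id)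
qed

text \<open>In the Leibniz sum only the permutations that preserve both summands of the index type
  survive, and these are the pairs \<open>map_sum p q\<close>.\<close>

lemma det_block_upper:
  fixes A :: "real ^ 'a ^ 'a" and B :: "real ^ 'b ^ 'a" and D :: "real ^ 'b ^ 'b"
  shows "det (block_matrix A B 0 D) = det A * det D"
proof -
  let ?M = "block_matrix A B 0 D"
  let ?P = "{p :: 'a + 'b \<Rightarrow> _. p permutes UNIV}"
  let ?Q = "(\<lambda>(p, q). map_sum p q) `
    ({p :: 'a \<Rightarrow> 'a. p permutes UNIV} \<times> {q :: 'b \<Rightarrow> 'b. q permutes UNIV})"
  let ?t = "\<lambda>p. of_int (sign p) * (\<Prod>i\<in>UNIV. ?M $ i $ p i) :: real"
  have sub: "?Q \<subseteq> ?P"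
    by (auto simp: permutes_UNIV_iff bij_map_sum)
  have zero: "?t p = 0" if p: "p \<in> ?P" "p \<notin> ?Q" for p
  proof (rule ccontr)
    assume "?t p \<noteq> 0"
    then have nz: "?M $ i $ p i \<noteq> 0" for i by (auto simp: prod_zero_iff)
    have bp: "bij p" using p by (auto simp: permutes_UNIV_iff)
    \<comment> \<open>The zero block confines \<open>p\<close> on the \<open>Inr\<close> indices.
      There it is injective, hence onto by finiteness, so no \<open>Inl\<close> index can be sent to
      an \<open>Inr\<close> index.\<close>
    have "\<exists>j. p (Inr i) = Inr j" for i
      using nz[of "Inr i"] by (cases "p (Inr i)") auto
    then obtain q where q: "p (Inr i) = Inr (q i)" for i by metis
    have injq: "inj q"
      using bp q by (metis bij_is_inj injD inj_onI sum.inject(2))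
    then have bq: "bij q" by (simp add: finite_UNIV_inj_surj bij_def)
    have "\<exists>j. p (Inl i) = Inl j" for i
    proof (cases "p (Inl i)")
      case (Inr j)
      then obtain k where "j = q k" using bq by (metis bij_pointE)
      then have "p (Inl i) = p (Inr k)" using Inr q by simp
      then show ?thesis using bp by (metis bij_is_inj injD sum.distinct(1))
    qed auto
    then obtain r where r: "p (Inl i) = Inl (r i)" for i by metis
    have injr: "inj r"
      using bp r by (metis bij_is_inj injD inj_onI sum.inject(1))
    then have "bij r" by (simp add: finite_UNIV_inj_surj bij_def)
    moreover have "p = map_sum r q"
    proof
      fix x show "p x = map_sum r q x" using q r by (cases x) auto
    qed
    ultimately show False using p(2) bq by (auto simp: permutes_UNIV_iff)
  qed
  have "det ?M = sum ?t ?P" by (simp add: det_def)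
  also have "\<dots> = sum ?t ?Q"
    by (rule sum.mono_neutral_right) (use sub zero in \<open>auto simp: finite_permutations\<close>)
  also have "\<dots> = (\<Sum>(p, q) \<in> {p :: 'a \<Rightarrow> 'a. p permutes UNIV} \<times> {q :: 'b \<Rightarrow> 'b. q permutes UNIV}.
      ?t (map_sum p q))"
    by (subst sum.reindex) (auto simp: inj_on_def fun_eq_iff case_prod_unfold
        dest!: arg_cong[where f = "\<lambda>h. h _"], (metis map_sum.simps sum.inject)+)
  also have "\<dots> = (\<Sum>p | p permutes UNIV. \<Sum>q | q permutes UNIV. ?t (map_sum p q))"
    by (simp add: sum.cartesian_product)
  also have "\<dots> = (\<Sum>p | p permutes UNIV. \<Sum>q | q permutes UNIV.
     (of_int (sign p) * (\<Prod>i\<in>UNIV. A $ i $ p i)) * (of_int (sign q) * (\<Prod>i\<in>UNIV. D $ i $ q i)))"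
    by (intro sum.cong refl) (simp add: sign_map_sum prod_UNIV_sum)
  also have "\<dots> = det A * det D"
    by (simp add: det_def sum_product)
  finally show ?thesis .
qed

lemma block_matrix_mult:
  "block_matrix A B C D ** block_matrix A' B' C' D' =
   block_matrix (A ** A' + B ** C') (A ** B' + B ** D') (C ** A' + D ** C') (C ** B' + D ** D')"
proof -
  have "(block_matrix A B C D ** block_matrix A' B' C' D') $ i $ j =
   block_matrix (A ** A' + B ** C') (A ** B' + B ** D') (C ** A' + D ** C') (C ** B' + D ** D') $ i $ j"
    for i j
    by (cases i; cases j) (simp_all add: matrix_matrix_mult_def sum_UNIV_sum)
  then show ?thesis by (simp add: vec_eq_iff)
qed

lemma transpose_block_matrix:
  "transpose (block_matrix A B C D) = block_matrix (transpose A) (transpose C) (transpose B) (transpose D)"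
proof -
  have "transpose (block_matrix A B C D) $ i $ j =
    block_matrix (transpose A) (transpose C) (transpose B) (transpose D) $ i $ j" for i j
    by (cases i; cases j) (simp_all add: transpose_def)
  then show ?thesis by (simp add: vec_eq_iff)
qed

lemma det_block_lower:
  fixes A :: "real ^ 'a ^ 'a" and C :: "real ^ 'a ^ 'b" and D :: "real ^ 'b ^ 'b"
  shows "det (block_matrix A 0 C D) = det A * det D"
proof -
  have 0: "transpose (0 :: real ^ 'b ^ 'a) = 0" by (simp add: transpose_def vec_eq_iff)
  show ?thesis
    using det_block_upper[of "transpose A" "transpose C" "transpose D"]
      det_transpose[of "block_matrix A 0 C D"]
    by (simp add: transpose_block_matrix 0)
qed

text \<open>Factor the block matrix with rows \<open>(1, B)\<close> and \<open>(A, 1)\<close> into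
  triangular ones in two ways. The index types may differ in size, as they must for maps between
  different spaces.\<close>

lemma Sylvester_det:
  fixes A :: "real ^ 'a ^ 'b" and B :: "real ^ 'b ^ 'a"
  shows "det (mat 1 - B ** A) = det (mat 1 - A ** B)"
proof -
  have 1: "block_matrix (mat 1) B A (mat 1) =
      block_matrix (mat 1) 0 A (mat 1) ** block_matrix (mat 1) B 0 (mat 1 - A ** B)"
    by (simp add: block_matrix_mult)
  have 2: "block_matrix (mat 1) B A (mat 1) =
      block_matrix (mat 1 - B ** A) B 0 (mat 1) ** block_matrix (mat 1) 0 A (mat 1)"
    by (simp add: block_matrix_mult)
  have "det (block_matrix (mat 1) B A (mat 1)) = det (mat 1 - A ** B)"
    unfolding 1 by (simp add: det_mul det_block_upper det_block_lower)
  moreover have "det (block_matrix (mat 1) B A (mat 1)) = det (mat 1 - B ** A)"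
    unfolding 2 by (simp add: det_mul det_block_upper det_block_lower)
  ultimately show ?thesis by simp
qed

section \<open>Continuously differentiable functions\<close>

text \<open>The Jacobian is an explicit argument because \<open>brouwer_degree\<close> quantifies
  over pairs \<open>G\<close>, \<open>J\<close>. Being global fits polynomials and cut-off functions
  extended by 0.\<close>

definition c1_map :: "(real ^ 'n \<Rightarrow> real ^ 'm) \<Rightarrow> (real ^ 'n \<Rightarrow> real ^ 'n ^ 'm) \<Rightarrow> bool" where
  "c1_map G J \<longleftrightarrow> (\<forall>x. (G has_derivative (\<lambda>v. J x *v v)) (at x)) \<and> continuous_on UNIV J"

definition c1_fun :: "(real ^ 'n \<Rightarrow> real) \<Rightarrow> (real ^ 'n \<Rightarrow> real ^ 'n) \<Rightarrow> bool" where
  "c1_fun u du \<longleftrightarrow> (\<forall>x. (u has_derivative (\<lambda>v. du x \<bullet> v)) (at x)) \<and> continuous_on UNIV du"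

lemma matrix_vector_mul_nth: "(A *v v) $ i = A $ i \<bullet> (v :: real ^ 'n)"
  by (simp add: matrix_vector_mult_def inner_vec_def)

text \<open>Rows of the Jacobian are gradients of components: the later constructions change one
  component, hence one row, at a time.\<close>

lemma c1_map_iff: "c1_map G J \<longleftrightarrow> (\<forall>i. c1_fun (\<lambda>x. G x $ i) (\<lambda>x. J x $ i))"
proof -
  have "(G has_derivative (\<lambda>v. J x *v v)) (at x) \<longleftrightarrow>
    (\<forall>i. ((\<lambda>x. G x $ i) has_derivative (\<lambda>v. J x $ i \<bullet> v)) (at x))" for x
    by (subst has_derivative_componentwise_within)
       (auto simp: Basis_vec_def inner_axis matrix_vector_mul_nth)
  moreover have "continuous_on UNIV J \<longleftrightarrow> (\<forall>i. continuous_on UNIV (\<lambda>x. J x $ i))"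
    using continuous_on_vec_lambda[of UNIV "\<lambda>i x. J x $ i"] by (auto intro!: continuous_intros)
  ultimately show ?thesis by (auto simp: c1_map_def c1_fun_def)
qed

lemma c1_funD:
  assumes "c1_fun u du"
  shows "(u has_derivative (\<lambda>v. du x \<bullet> v)) (at x)" "continuous_on S du" "continuous_on S u"
  using assms has_derivative_continuous_on[of S u "\<lambda>x v. du x \<bullet> v"]
  by (auto simp: c1_fun_def intro: continuous_on_subset has_derivative_at_withinI)

lemma c1_mapD:
  assumes "c1_map G J"
  shows "(G has_derivative (\<lambda>v. J x *v v)) (at x)" "continuous_on S J" "continuous_on S G"
  using assms has_derivative_continuous_on[of S G "\<lambda>x v. J x *v v"]
  by (auto simp: c1_map_def intro: continuous_on_subset has_derivative_at_withinI)

lemma c1_fun_diff: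
  assumes "c1_fun u du" "c1_fun v dv"
  shows "c1_fun (\<lambda>x. u x - v x) (\<lambda>x. du x - dv x)"
  using assms by (auto simp: c1_fun_def inner_diff_left intro!: derivative_intros continuous_intros)

lemma c1_fun_add:
  assumes "c1_fun u du" "c1_fun v dv"
  shows "c1_fun (\<lambda>x. u x + v x) (\<lambda>x. du x + dv x)"
  using assms by (auto simp: c1_fun_def inner_add_left intro!: derivative_intros continuous_intros)

lemma c1_fun_mult:
  assumes "c1_fun u du" "c1_fun v dv"
  shows "c1_fun (\<lambda>x. u x * v x) (\<lambda>x. u x *\<^sub>R dv x + v x *\<^sub>R du x)"
  unfolding c1_fun_def
proof (intro conjI allI)
  fix x
  have "((\<lambda>x. u x * v x) has_derivative (\<lambda>h. u x * (dv x \<bullet> h) + (du x \<bullet> h) * v x)) (at x)"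
    by (intro has_derivative_mult c1_funD[OF assms(1)] c1_funD[OF assms(2)])
  then show "((\<lambda>x. u x * v x) has_derivative (\<lambda>h. (u x *\<^sub>R dv x + v x *\<^sub>R du x) \<bullet> h)) (at x)"
    by (simp add: inner_add_left mult.commute)
qed (intro continuous_intros c1_funD[OF assms(1)] c1_funD[OF assms(2)])

lemma c1_fun_const: "c1_fun (\<lambda>x. c) (\<lambda>x. 0)"
  by (simp add: c1_fun_def)

lemma c1_fun_inner: "c1_fun (\<lambda>x. c \<bullet> x) (\<lambda>x. c)"
  by (auto simp: c1_fun_def intro!: derivative_eq_intros)

lemma c1_fun_compose:
  assumes "c1_fun u du" "\<And>t. (s has_real_derivative s' t) (at t)" "continuous_on UNIV s'"
  shows "c1_fun (\<lambda>x. s (u x)) (\<lambda>x. s' (u x) *\<^sub>R du x)"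
  unfolding c1_fun_def
proof (intro conjI allI)
  fix x
  have "((\<lambda>x. s (u x)) has_derivative (\<lambda>h. s' (u x) * (du x \<bullet> h))) (at x)"
    using has_derivative_compose[OF c1_funD(1)[OF assms(1), of x], of s "\<lambda>h. s' (u x) * h"]
      assms(2)[of "u x"] by (simp add: has_field_derivative_def)
  then show "((\<lambda>x. s (u x)) has_derivative (\<lambda>h. (s' (u x) *\<^sub>R du x) \<bullet> h)) (at x)"
    by simp
  have "continuous_on UNIV (\<lambda>x. s' (u x))"
    using continuous_on_compose2[OF assms(3) c1_funD(3)[OF assms(1)]] by auto
  then show "continuous_on UNIV (\<lambda>x. s' (u x) *\<^sub>R du x)"
    by (intro continuous_intros c1_funD[OF assms(1)])
qed

lemma c1_fun_nth: "c1_map G J \<Longrightarrow> c1_fun (\<lambda>x. G x $ i) (\<lambda>x. J x $ i)"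
  by (simp add: c1_map_iff)

lemma c1_fun_norm_sq:
  assumes "c1_map G J"
  shows "c1_fun (\<lambda>x. G x \<bullet> G x) (\<lambda>x. 2 *\<^sub>R (transpose (J x) *v G x))"
  unfolding c1_fun_def
proof (intro conjI allI)
  fix x
  have "((\<lambda>x. G x \<bullet> G x) has_derivative (\<lambda>h. G x \<bullet> (J x *v h) + (J x *v h) \<bullet> G x)) (at x)"
    by (intro has_derivative_inner c1_mapD[OF assms])
  then show "((\<lambda>x. G x \<bullet> G x) has_derivative (\<lambda>h. (2 *\<^sub>R (transpose (J x) *v G x)) \<bullet> h)) (at x)"
    using dot_lmul_matrix[of "G x" "J x"] by (simp add: inner_commute[of "J x *v _"])
next
  have "continuous_on UNIV (\<lambda>x. (\<chi> i. 2 * (\<Sum>j\<in>UNIV. J x $ j $ i * G x $ j)))"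
    by (intro continuous_intros c1_mapD[OF assms] continuous_on_vec_lambda)
  then show "continuous_on UNIV (\<lambda>x. 2 *\<^sub>R (transpose (J x) *v G x))"
    by (simp add: matrix_vector_mult_def transpose_def scaleR_vec_def)
qed

lemma c1_map_id: "c1_map (\<lambda>x. x) (\<lambda>x. mat 1)"
  by (simp add: c1_map_def)

lemma c1_fun_zero_grad:
  assumes "c1_fun u du" "open S" "x \<in> S" "\<And>y. y \<in> S \<Longrightarrow> u y = 0"
  shows "du x = 0"
proof -
  have "(u has_derivative (\<lambda>v. 0)) (at x)"
    by (rule has_derivative_transform_within_open[of "\<lambda>x. 0" _ _ _ S]) (use assms in auto)
  then have "(\<lambda>v. du x \<bullet> v) = (\<lambda>v. 0)"
    using c1_funD(1)[OF assms(1)] has_derivative_unique by blast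
  then show ?thesis by (metis inner_eq_zero_iff)
qed

lemma continuous_on_det [continuous_intros]:
  fixes J :: "'a::topological_space \<Rightarrow> real ^ 'n ^ 'n"
  assumes "continuous_on S J"
  shows "continuous_on S (\<lambda>x. det (J x))"
  unfolding det_def by (intro continuous_intros assms)

text \<open>A \<open>C\<^sup>1\<close> step from 0 to 1 on the unit interval: twice a second difference of \<open>(max 0 t)\<^sup>2\<close>.\<close>

definition step_fun :: "real \<Rightarrow> real" where
  "step_fun t = 2 * ((max 0 t)\<^sup>2 - 2 * (max 0 (t - 1/2))\<^sup>2 + (max 0 (t - 1))\<^sup>2)"

definition step_deriv :: "real \<Rightarrow> real" where
  "step_deriv t = 4 * (max 0 t - 2 * max 0 (t - 1/2) + max 0 (t - 1))"

lemma ramp_sq_deriv: "((\<lambda>t. (max 0 t)\<^sup>2) has_real_derivative 2 * max 0 t) (at (t :: real))"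
proof (cases "t = 0")
  case True
  have "((\<lambda>h. (max 0 h)\<^sup>2 / h) \<longlongrightarrow> 0) (at (0::real))"
  proof (rule Lim_null_comparison[OF always_eventually])
    show "\<forall>h::real. norm ((max 0 h)\<^sup>2 / h) \<le> \<bar>h\<bar>"
      by (auto simp: max_def power2_eq_square abs_mult)
    show "((\<lambda>h::real. \<bar>h\<bar>) \<longlongrightarrow> 0) (at 0)"
      by (intro tendsto_rabs_zero tendsto_ident_at)
  qed
  then show ?thesis using True by (simp add: DERIV_def)
next
  case False
  then consider "t > 0" | "t < 0" by linarith
  then show ?thesis
  proof cases
    case 1
    have "((\<lambda>t. t\<^sup>2) has_real_derivative 2 * max 0 t) (at t)"
      using 1 by (auto intro!: derivative_eq_intros)
    then show ?thesis
      by (rule has_field_derivative_transform_within_open[where S = "{0<..}"]) (use 1 in auto)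
  next
    case 2
    have "((\<lambda>t. 0) has_real_derivative 2 * max 0 t) (at t)"
      using 2 by (auto intro!: derivative_eq_intros)
    then show ?thesis
      by (rule has_field_derivative_transform_within_open[where S = "{..<0}"]) (use 2 in auto)
  qed
qed

lemma step_fun_deriv: "(step_fun has_real_derivative step_deriv t) (at t)"
proof -
  have "((\<lambda>t. (max 0 (t - c))\<^sup>2) has_real_derivative 2 * max 0 (t - c)) (at t)" for c
    using DERIV_chain2[OF ramp_sq_deriv DERIV_diff[OF DERIV_ident DERIV_const], of c t] by simp
  note ramp = this
  have "((\<lambda>t. 2 * ((max 0 t)\<^sup>2 - 2 * (max 0 (t - 1/2))\<^sup>2 + (max 0 (t - 1))\<^sup>2)) has_real_derivative
      2 * (2 * max 0 t - 2 * (2 * max 0 (t - 1/2)) + 2 * max 0 (t - 1))) (at t)"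
    by (intro DERIV_cmult DERIV_add DERIV_diff ramp ramp_sq_deriv)
  then show ?thesis
    by (simp add: step_fun_def[abs_def] step_deriv_def algebra_simps)
qed

lemma continuous_step_deriv: "continuous_on S step_deriv"
  unfolding step_deriv_def by (intro continuous_intros)

lemma step_deriv_nonneg: "step_deriv t \<ge> 0"
  by (auto simp: step_deriv_def max_def)

lemma step_deriv_eq_0: "t \<le> 0 \<or> t \<ge> 1 \<Longrightarrow> step_deriv t = 0"
  by (auto simp: step_deriv_def max_def)

lemma step_fun_le_0: "t \<le> 0 \<Longrightarrow> step_fun t = 0"
  by (auto simp: step_fun_def max_def)

lemma step_fun_ge_1: "t \<ge> 1 \<Longrightarrow> step_fun t = 1"
  by (auto simp: step_fun_def max_def power2_eq_square field_simps)

lemma c1_fun_step: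
  assumes "c1_fun u du"
  shows "c1_fun (\<lambda>x. step_fun (u x)) (\<lambda>x. step_deriv (u x) *\<^sub>R du x)"
  by (rule c1_fun_compose[OF assms step_fun_deriv continuous_step_deriv])

lemma c1_fun_affine:
  assumes "c1_fun u du"
  shows "c1_fun (\<lambda>x. a * u x + b) (\<lambda>x. a *\<^sub>R du x)"
  using c1_fun_add[OF c1_fun_mult[OF c1_fun_const[of a] assms] c1_fun_const[of b]] by simp

section \<open>The integral of a Jacobian determinant\<close>

lemma absolutely_integrable_continuous_subset_compact:
  fixes f :: "'a::euclidean_space \<Rightarrow> real"
  assumes "continuous_on T f" "compact T" "S \<subseteq> T" "S \<in> sets lebesgue"
  shows "f absolutely_integrable_on S"
proof -
  obtain c where c: "\<And>x. x \<in> T \<Longrightarrow> norm (f x) \<le> c"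
    using compact_imp_bounded[OF compact_continuous_image[OF assms(1,2)]]
    by (metis (no_types, opaque_lifting) bounded_iff imageI)
  have "bounded S" using assms by (meson bounded_subset compact_imp_bounded)
  then have "S \<in> lmeasurable" using assms(4) bounded_set_imp_lmeasurable by blast
  then show ?thesis
    by (intro measurable_bounded_by_integrable_imp_absolutely_integrable[where g = "\<lambda>x. c"]
        continuous_imp_measurable_on_sets_lebesgue continuous_on_subset[OF assms(1)] integrable_on_const)
       (use assms c in auto)
qed

text \<open>The bound on the entries makes \<open>K\<close> a contraction. Hence
  \<open>x + K x\<close> is a bijection of the space that is the identity off the ball; it therefore
  permutes the ball, whose volume is the integral of the Jacobian determinant because the latter is
  positive.\<close>

lemma integral_det_small_perturbation:
  fixes K :: "real ^ 'n::{finite,wellorder} \<Rightarrow> real ^ 'n::_"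
  assumes c1: "c1_map K J" and supp: "\<And>x. R \<le> norm x \<Longrightarrow> K x = 0"
    and small: "\<And>x i j. \<bar>J x $ i $ j\<bar> \<le> b" "real CARD('n::_) * real CARD('n::_) * b < 1"
  shows "integral (cball 0 R) (\<lambda>x. det (mat 1 + J x)) = measure lebesgue (cball (0 :: real ^ 'n::_) R)"
proof -
  define M where "M = real CARD('n::_) * real CARD('n::_) * b"
  have b: "0 \<le> b" using small(1)[of 0 undefined undefined] by linarith
  have M: "0 \<le> M" "M < 1" using small b by (auto simp: M_def)
  have onorm_bound: "onorm ((*v) (J x)) \<le> M" for x
    unfolding M_def by (rule onorm_le_matrix_component) (rule small)
  have normJ: "norm (J x *v v) \<le> M * norm v" for x v
    using onorm_bound[of x, THEN mult_right_mono, of "norm v"]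
      onorm[OF matrix_vector_mul_bounded_linear[of "J x"], of v] by force
  have lip: "norm (K x - K y) \<le> M * norm (x - y)" for x y
    by (rule differentiable_bound[of UNIV K "\<lambda>x. (*v) (J x)"])
       (use c1_mapD(1)[OF c1] onorm_bound in auto)
  define \<Phi> where "\<Phi> x = x + K x" for x
  have inj: "inj \<Phi>"
  proof (rule injI)
    fix x y assume "\<Phi> x = \<Phi> y"
    moreover have "x - y = (\<Phi> x - \<Phi> y) + (K y - K x)" by (simp add: \<Phi>_def)
    ultimately have "x - y = K y - K x" by simp
    then have "norm (x - y) \<le> M * norm (x - y)" using lip[of y x] by (simp add: norm_minus_commute)
    then have "(1 - M) * norm (x - y) \<le> 0" by (simp add: algebra_simps)
    then show "x = y" using M by (simp add: mult_le_0_iff)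
  qed
  have surj: "\<exists>x. \<Phi> x = y" for y
  proof -
    \<comment> \<open>A preimage of \<open>y\<close> under \<open>\<Phi>\<close> is a fixed point of
      the contraction \<open>x \<mapsto> y - K x\<close>.\<close>
    have "\<exists>!x. y - K x = x"
      by (rule banach_fix_type[OF M])
         (use lip in \<open>auto simp: dist_norm norm_minus_commute\<close>)
    then show ?thesis by (metis \<Phi>_def diff_add_cancel)
  qed
  have out: "\<Phi> x = x" if "x \<notin> cball 0 R" for x using supp[of x] that by (simp add: \<Phi>_def)
  have img: "\<Phi> ` cball 0 R = cball 0 R"
  proof (intro equalityI subsetI)
    fix y assume "y \<in> \<Phi> ` cball 0 R"
    then show "y \<in> cball 0 R" using out inj by (metis image_iff injD)
  next
    fix y :: "real ^ 'n::_" assume y: "y \<in> cball 0 R"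
    obtain x where x: "\<Phi> x = y" using surj by auto
    then have "x \<in> cball 0 R" using out y by metis
    then show "y \<in> \<Phi> ` cball 0 R" using x by auto
  qed
  have der: "(\<Phi> has_derivative (\<lambda>v. (mat 1 + J x) *v v)) (at x within S)" for x S
    using has_derivative_add[OF has_derivative_ident has_derivative_at_withinI[OF c1_mapD(1)[OF c1, of x]]]
    by (simp add: \<Phi>_def[abs_def] matrix_vector_mult_add_rdistrib)
  have det_nz: "det (mat 1 + s *\<^sub>R J x) \<noteq> 0" if "0 \<le> s" "s \<le> 1" for s x
  proof -
    have "v = 0" if "(mat 1 + s *\<^sub>R J x) *v v = 0" for v
    proof -
      have "v = - (s *\<^sub>R (J x *v v))"
        using that by (simp add: matrix_vector_mult_add_rdistrib scaleR_matrix_vector_assoc add_eq_0_iff)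
      then have "norm v = s * norm (J x *v v)" using \<open>0 \<le> s\<close>
        by (metis abs_of_nonneg norm_minus_cancel norm_scaleR)
      also have "\<dots> \<le> 1 * (M * norm v)"
        by (intro mult_mono normJ) (use \<open>0 \<le> s\<close> \<open>s \<le> 1\<close> in auto)
      finally have "(1 - M) * norm v \<le> 0" by (simp add: algebra_simps)
      then show "v = 0" using M by (simp add: mult_le_0_iff)
    qed
    then show ?thesis
      by (metis invertible_det_nz matrix_left_invertible_ker matrix_left_invertible invertible_left_inverse)
  qed
  \<comment> \<open>The determinant is 1 at the identity and has no zero on the segment from there
    to \<open>mat 1 + J x\<close>.\<close>
  have det_pos: "det (mat 1 + J x) > 0" for x
  proof (rule ccontr)
    assume "\<not> det (mat 1 + J x) > 0"
    moreover have "continuous_on {0..1} (\<lambda>s. det (mat 1 + s *\<^sub>R J x))"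
      by (intro continuous_intros)
    ultimately have "\<exists>s. 0 \<le> s \<and> s \<le> 1 \<and> det (mat 1 + s *\<^sub>R J x) = 0"
      by (intro IVT2') auto
    then show False using det_nz by blast
  qed
  have "measure lebesgue (\<Phi> ` cball 0 R) =
      integral (cball 0 R) (\<lambda>x. \<bar>det (matrix (\<lambda>v. (mat 1 + J x) *v v))\<bar>)"
  proof (rule measure_differentiable_image_eq)
    have "continuous_on (cball 0 R) (\<lambda>x. \<bar>det (mat 1 + J x)\<bar>)"
      by (intro continuous_intros c1_mapD[OF c1])
    then show "(\<lambda>x. \<bar>det (matrix (\<lambda>v. (mat 1 + J x) *v v))\<bar>) integrable_on cball 0 R"
      by (intro set_lebesgue_integral_eq_integral(1)
          absolutely_integrable_continuous_subset_compact[of "cball 0 R"]) auto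
    show "inj_on \<Phi> (cball 0 R)" using inj by (rule inj_on_subset) auto
  qed (use der in auto)
  then show ?thesis
    using det_pos by (simp add: img less_imp_le)
qed

lemma det_row_diff:
  fixes a b :: "real ^ 'n" and c :: "'n \<Rightarrow> real ^ 'n"
  shows "det (\<chi> i. if i = k then a - b else c i) =
    det (\<chi> i. if i = k then a else c i) - det (\<chi> i. if i = k then b else c i)"
  using det_row_add[of k "\<lambda>_. a - b" "\<lambda>_. b" c]
  unfolding diff_add_cancel by linarith

text \<open>
  By multilinearity, the determinant of \<open>d J\<close> is an alternating sum, over the subsets of the rows,
  of determinants whose integrals all agree by the preceding lemma.
\<close>

lemma integral_det_compact_support:
  fixes K :: "real ^ 'n::{finite,wellorder} \<Rightarrow> real ^ 'n::_"
  assumes c1: "c1_map K J" and supp: "\<And>x. R \<le> norm x \<Longrightarrow> K x = 0"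
  shows "integral (cball 0 R) (\<lambda>x. det (J x)) = 0"
proof -
  have J0: "J x = 0" if "x \<notin> cball 0 R" for x
    using c1_fun_zero_grad[OF c1_fun_nth[OF c1], where S = "- cball 0 R" and x = x] supp that
    by (auto simp: vec_eq_iff)
  obtain b0 where b0: "\<And>x. x \<in> cball 0 R \<Longrightarrow> norm (J x) \<le> b0"
    using compact_imp_bounded[OF compact_continuous_image[OF c1_mapD(2)[OF c1] compact_cball[of 0 R]]]
    by (metis (no_types, opaque_lifting) bounded_iff imageI)
  define b where "b = max 1 b0"
  have b: "\<bar>J x $ i $ j\<bar> \<le> b" for x i j
  proof (cases "x \<in> cball 0 R")
    case True
    then show ?thesis
      using component_le_norm_cart[of "J x $ i" j] Finite_Cartesian_Product.norm_nth_le[of "J x" i] b0[OF True] by (simp add: b_def)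
  qed (simp add: J0 b_def)
  define n where "n = real CARD('n::_)"
  have n: "n \<ge> 1" by (simp add: n_def Suc_leI)
  \<comment> \<open>This scale gives \<open>n * n * (d * b) = 1 / 2\<close>, which brings the maps
    \<open>KS\<close> below under the preceding lemma.\<close>
  define d where "d = 1 / (2 * n * n * b)"
  have b1: "b \<ge> 1" by (simp add: b_def)
  have d: "d > 0" using n b1 by (simp add: d_def)
  have ndb: "n * n * (d * b) < 1" using n b1 by (simp add: d_def field_simps)
  define c where "c = measure lebesgue (cball (0 :: real ^ 'n::_) R)"
  \<comment> \<open>Rows in \<open>T\<close> are expanded as \<open>d J = (1 + d J) - 1\<close>; a
    row in \<open>S\<close> outside \<open>T\<close> is already of the first kind, any other of the
    second. For empty \<open>T\<close> the integral is the volume \<open>c\<close> whatever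
    \<open>S\<close> is, so each expansion gives \<open>c - c\<close> or
    \<open>0 - 0\<close>.\<close>
  define r where "r S T x i = (if i \<in> T then d *\<^sub>R J x $ i else if i \<in> S then axis i 1 + d *\<^sub>R J x $ i
     else axis i 1)" for S T x i
  have mat1: "mat 1 $ i = (axis i 1 :: real ^ 'n::_)" for i
    by (auto simp: mat_def axis_def vec_eq_iff)
  have cont: "continuous_on X (\<lambda>x. det (\<chi> i. r S T x i))" for S T X
  proof -
    have "continuous_on X (\<lambda>x. r S T x i)" for i
      using c1_mapD(2)[OF c1, of X] unfolding r_def
      by (cases "i \<in> T"; cases "i \<in> S") (simp_all add: continuous_intros)
    then show ?thesis by (intro continuous_on_det continuous_on_vec_lambda)
  qed
  have main: "integral (cball 0 R) (\<lambda>x. det (\<chi> i. r S T x i)) = (if T = {} then c else 0)" for S T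
    using finite[of T]
  proof (induction T arbitrary: S rule: finite_induct)
    case empty
    define KS where "KS x = (\<chi> i. if i \<in> S then d * K x $ i else 0)" for x
    define JS where "JS x = (\<chi> i. if i \<in> S then d *\<^sub>R J x $ i else 0)" for x
    have "c1_map KS JS"
      unfolding c1_map_iff KS_def JS_def
    proof
      fix i
      show "c1_fun (\<lambda>x. (\<chi> i. if i \<in> S then d * K x $ i else 0) $ i)
          (\<lambda>x. (\<chi> i. if i \<in> S then d *\<^sub>R J x $ i else 0) $ i)"
        using c1_fun_affine[OF c1_fun_nth[OF c1], of d i 0] c1_fun_const[of 0]
        by (cases "i \<in> S") auto
    qed
    moreover have "\<bar>JS x $ i $ j\<bar> \<le> d * b" for x i j
      using b[of x i j] d b1 by (auto simp: JS_def abs_mult)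
    ultimately have "integral (cball 0 R) (\<lambda>x. det (mat 1 + JS x)) = c"
      unfolding c_def using ndb supp
      by (intro integral_det_small_perturbation[where b = "d * b"]) (auto simp: n_def KS_def vec_eq_iff)
    moreover have "mat 1 + JS x = (\<chi> i. r S {} x i)" for x
      by (auto simp: vec_eq_iff r_def JS_def mat1)
    ultimately show ?case by simp
  next
    case (insert k T)
    have "det (\<chi> i. r S (insert k T) x i) = det (\<chi> i. r (insert k S) T x i) - det (\<chi> i. r (S - {k}) T x i)"
      for x
    proof -
      have "(\<chi> i. r S (insert k T) x i) =
          (\<chi> i. if i = k then (axis k 1 + d *\<^sub>R J x $ k) - axis k 1 else r S T x i)"
        by (auto simp: r_def vec_eq_iff)
      moreover have "(\<chi> i. r (insert k S) T x i) =
          (\<chi> i. if i = k then axis k 1 + d *\<^sub>R J x $ k else r S T x i)"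
        using insert.hyps by (auto simp: r_def vec_eq_iff)
      moreover have "(\<chi> i. r (S - {k}) T x i) = (\<chi> i. if i = k then axis k 1 else r S T x i)"
        using insert.hyps by (auto simp: r_def vec_eq_iff)
      ultimately show ?thesis by (simp only: det_row_diff)
    qed
    then have "integral (cball 0 R) (\<lambda>x. det (\<chi> i. r S (insert k T) x i)) =
        integral (cball 0 R) (\<lambda>x. det (\<chi> i. r (insert k S) T x i)) -
        integral (cball 0 R) (\<lambda>x. det (\<chi> i. r (S - {k}) T x i))"
      by (simp add: integral_diff set_lebesgue_integral_eq_integral(1)
          absolutely_integrable_continuous_subset_compact[of "cball 0 R"] cont)
    then show ?case by (simp add: insert.IH)
  qed
  have "det (\<chi> i. r {} UNIV x i) = d ^ CARD('n::_) * det (J x)" for x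
    using det_rows_mul[of "\<lambda>_. d" "\<lambda>i. J x $ i"] by (simp add: r_def scalar_mult_eq_scaleR)
  then have "d ^ CARD('n::_) * integral (cball 0 R) (\<lambda>x. det (J x)) = 0"
    using main[of "{}" UNIV] by simp
  then show ?thesis using d by simp
qed

text \<open>Cutting off the other components changes the determinant nowhere: the cut-off is 1 on
  the ball, and outside it row \<open>k\<close> vanishes.\<close>

lemma integral_det_component_compact_support:
  fixes H :: "real ^ 'n::{finite,wellorder} \<Rightarrow> real ^ 'n::_"
  assumes c1: "c1_map H J" and R: "R > 0" and supp: "\<And>x. R \<le> norm x \<Longrightarrow> H x $ k = 0"
  shows "integral (cball 0 R) (\<lambda>x. det (J x)) = 0"
proof -
  define a where "a = 1 / (3 * R\<^sup>2)"
  \<comment> \<open>Affine in the squared norm, with value 1 on the sphere of radius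
    \<open>R\<close> and 0 on that of radius \<open>2 * R\<close>.\<close>
  define q where "q x = - a * (x \<bullet> x) + 4 / 3" for x :: "real ^ 'n::_"
  have q: "c1_fun q (\<lambda>x. - a *\<^sub>R (2 *\<^sub>R x))"
    unfolding q_def using c1_fun_affine[OF c1_fun_norm_sq[OF c1_map_id], of "- a" "4/3"] by simp
  have q_in: "q x \<ge> 1" if "norm x \<le> R" for x
  proof -
    have "x \<bullet> x \<le> R\<^sup>2" using that by (metis norm_ge_zero power2_norm_eq_inner power_mono)
    then show ?thesis using R by (simp add: q_def a_def field_simps)
  qed
  have q_out: "q x \<le> 0" if "norm x \<ge> 2 * R" for x
  proof -
    have "(2 * R)\<^sup>2 \<le> x \<bullet> x" using that R
      by (metis power2_norm_eq_inner power_mono less_imp_le mult_nonneg_nonneg zero_le_numeral)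
    then show ?thesis using R by (simp add: q_def a_def field_simps power2_eq_square)
  qed
  define dq where "dq x = step_deriv (q x) *\<^sub>R (- a *\<^sub>R (2 *\<^sub>R x))" for x
  have cut: "c1_fun (\<lambda>x. step_fun (q x)) dq"
    unfolding dq_def by (rule c1_fun_step[OF q])
  define K where "K x = (\<chi> i. if i = k then H x $ k else step_fun (q x) * H x $ i)" for x
  define JK where "JK x = (\<chi> i. if i = k then J x $ k else step_fun (q x) *\<^sub>R J x $ i + H x $ i *\<^sub>R dq x)" for x
  have "c1_map K JK"
    unfolding c1_map_iff
  proof
    fix i
    show "c1_fun (\<lambda>x. K x $ i) (\<lambda>x. JK x $ i)"
      using c1_fun_mult[OF cut c1_fun_nth[OF c1, of i]] c1_fun_nth[OF c1, of i]
      by (cases "i = k") (auto simp: K_def JK_def)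
  qed
  moreover have "K x = 0" if "2 * R \<le> norm x" for x
    using that R supp[of x] q_out[of x] by (auto simp: K_def vec_eq_iff step_fun_le_0)
  ultimately have "integral (cball 0 (2 * R)) (\<lambda>x. det (JK x)) = 0"
    by (rule integral_det_compact_support)
  moreover have "det (JK x) = (if x \<in> cball 0 R then det (J x) else 0)" for x
  proof (cases "x \<in> cball 0 R")
    case True
    then have "JK x = J x"
      using q_in[of x] by (auto simp: JK_def vec_eq_iff step_fun_ge_1 dq_def step_deriv_eq_0)
    then show ?thesis using True by simp
  next
    case False
    then have "J x $ k = 0"
      using c1_fun_zero_grad[OF c1_fun_nth[OF c1, of k], where S = "- cball 0 R" and x = x] supp by auto
    then have "row k (JK x) = 0" by (simp add: row_def JK_def vec_eq_iff)
    then show ?thesis using False by (simp add: det_zero_row)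
  qed
  moreover have "cball 0 R \<inter> cball 0 (2 * R) = cball (0 :: real ^ 'n::_) R"
    using R by (auto simp: mem_cball)
  ultimately show ?thesis
    using integral_restrict_Int[of "cball 0 (2 * R)" "cball 0 R" "\<lambda>x. det (J x)"] by simp
qed

section \<open>The signed count of regular zeros\<close>

text \<open>An approximate delta function at 0, supported in the cube of half-width
  \<open>1 / (2 * a)\<close>. The product form lets each factor be absorbed into one row of a
  Jacobian determinant.\<close>

definition bump :: "real \<Rightarrow> real ^ 'n \<Rightarrow> real" where
  "bump a y = (\<Prod>i\<in>UNIV. a * step_deriv (a * y $ i + 1 / 2))"

lemma step_deriv_scaled_eq_0:
  assumes "1 / (2 * a) \<le> \<bar>t\<bar>" "a > 0"
  shows "step_deriv (a * t + 1 / 2) = 0"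
proof -
  have "1/2 \<le> a * \<bar>t\<bar>" using assms by (simp add: field_simps)
  then have "a * t + 1/2 \<le> 0 \<or> a * t + 1/2 \<ge> 1" by (cases "t \<ge> 0") auto
  then show ?thesis by (rule step_deriv_eq_0)
qed

lemma step_fun_scaled_eq:
  assumes "1 / (2 * a) \<le> \<bar>t\<bar>" "1 / (2 * a) \<le> \<bar>t'\<bar>" "a > 0" "t * t' > 0"
  shows "step_fun (a * t + 1 / 2) = step_fun (a * t' + 1 / 2)"
proof -
  have *: "1/2 \<le> a * \<bar>t\<bar>" "1/2 \<le> a * \<bar>t'\<bar>" using assms by (simp_all add: field_simps)
  consider "t > 0 \<and> t' > 0" | "t < 0 \<and> t' < 0"
    using assms(4) zero_less_mult_iff[of t t'] by blast
  then show ?thesis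
  proof cases
    case 1
    then have "a * t + 1/2 \<ge> 1" "a * t' + 1/2 \<ge> 1" using * by simp_all
    then show ?thesis by (simp only: step_fun_ge_1)
  next
    case 2
    then have "a * t + 1/2 \<le> 0" "a * t' + 1/2 \<le> 0" using * by simp_all
    then show ?thesis by (simp only: step_fun_le_0)
  qed
qed

lemma bump_det:
  "bump a (G x) * det (J :: real ^ 'n ^ 'n) =
    det (\<chi> i. (a * step_deriv (a * G x $ i + 1 / 2)) *\<^sub>R J $ i)"
  using det_rows_mul[of "\<lambda>i. a * step_deriv (a * G x $ i + 1 / 2)" "\<lambda>i. J $ i"]
  by (simp add: bump_def scalar_mult_eq_scaleR)

lemma norm_le_card_component:
  fixes y :: "real ^ 'n"
  obtains j where "norm y \<le> real CARD('n) * \<bar>y $ j\<bar>"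
proof -
  have "Max (range (\<lambda>i. \<bar>y $ i\<bar>)) \<in> range (\<lambda>i. \<bar>y $ i\<bar>)" by (rule Max_in) auto
  then obtain j where j: "Max (range (\<lambda>i. \<bar>y $ i\<bar>)) = \<bar>y $ j\<bar>" by (elim rangeE)
  have le: "\<bar>y $ i\<bar> \<le> \<bar>y $ j\<bar>" for i
    unfolding j[symmetric] by (rule Max_ge) auto
  have "norm y \<le> (\<Sum>i\<in>UNIV. \<bar>y $ i\<bar>)" by (rule norm_le_l1_cart)
  also have "\<dots> \<le> (\<Sum>i\<in>(UNIV::'n set). \<bar>y $ j\<bar>)" by (intro sum_mono le)
  finally show ?thesis by (intro that[of j]) simp
qed

lemma c1_scaled_step:
  assumes "c1_map G J"
  shows "c1_fun (\<lambda>x. step_fun (a * G x $ i + 1 / 2)) (\<lambda>x. (a * step_deriv (a * G x $ i + 1 / 2)) *\<^sub>R J x $ i)"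
  using c1_fun_step[OF c1_fun_affine[OF c1_fun_nth[OF assms, of i], of a "1/2"]]
  by (simp add: mult.commute)

text \<open>
  The map \<open>x \<mapsto> (step_fun (a * G x $ i + 1/2))\<^sub>i\<close> has Jacobian determinant \<open>bump a (G x) * det (J x)\<close>.
  Its components are changed from \<open>G0\<close> to \<open>G1\<close> one at a time; each time the difference is the
  determinant of a map with one compactly supported component.
\<close>

lemma integral_bump_eq:
  fixes G0 G1 :: "real ^ 'n::{finite,wellorder} \<Rightarrow> real ^ 'n::_"
  assumes V: "open V" "bounded V"
    and c0: "c1_map G0 J0" and c1: "c1_map G1 J1"
    and m: "m > 0" and fr: "\<And>x. x \<in> frontier V \<Longrightarrow> m \<le> norm (G0 x)"
    and close: "\<And>x. x \<in> closure V \<Longrightarrow> norm (G1 x - G0 x) < m / (4 * real CARD('n::_))"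
    and a: "a * m \<ge> 2 * real CARD('n::_)"
  shows "integral V (\<lambda>x. bump a (G0 x) * det (J0 x)) = integral V (\<lambda>x. bump a (G1 x) * det (J1 x))"
proof -
  define n where "n = real CARD('n::_)"
  have n: "n \<ge> 1" by (simp add: n_def Suc_leI)
  have apos: "a > 0"
  proof -
    have "a * m > 0" using a n unfolding n_def by linarith
    then show ?thesis using m by (simp add: zero_less_mult_iff)
  qed
  \<comment> \<open>The transition zone \<open>\<bar>t\<bar> < 1 / (2 * a)\<close> of
    \<open>s\<close> stays below \<open>m / (4 * n)\<close>, half of the size that some component of
    \<open>G0\<close> attains where \<open>norm (G0 x) \<ge> m / 2\<close>.\<close>
  have a2: "1 / (2 * a) \<le> m / (4 * n)"
    using a n m apos by (simp add: field_simps n_def)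
  define s where "s t = step_fun (a * t + 1/2)" for t
  define ds where "ds t = a * step_deriv (a * t + 1/2)" for t
  have cs0: "c1_fun (\<lambda>x. s (G0 x $ i)) (\<lambda>x. ds (G0 x $ i) *\<^sub>R J0 x $ i)" for i
    unfolding s_def ds_def by (rule c1_scaled_step[OF c0])
  have cs1: "c1_fun (\<lambda>x. s (G1 x $ i)) (\<lambda>x. ds (G1 x $ i) *\<^sub>R J1 x $ i)" for i
    unfolding s_def ds_def by (rule c1_scaled_step[OF c1])
  define r where "r T x i = (if i \<in> T then ds (G1 x $ i) *\<^sub>R J1 x $ i else ds (G0 x $ i) *\<^sub>R J0 x $ i)"
    for T x i
  define sT where "sT T x i = (if i \<in> T then s (G1 x $ i) else s (G0 x $ i))" for T x i
  have csT: "c1_fun (\<lambda>x. sT T x i) (\<lambda>x. r T x i)" for T i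
    using cs0[of i] cs1[of i] by (cases "i \<in> T") (simp_all add: r_def sT_def)
  \<comment> \<open>Where \<open>G0\<close> is not small, one component is so large that the steps
    of \<open>G0\<close> and \<open>G1\<close> are both flat and equal there; this row vanishes for
    both maps.\<close>
  have far: "\<exists>j. ds (G0 x $ j) = 0 \<and> ds (G1 x $ j) = 0 \<and> s (G0 x $ j) = s (G1 x $ j)"
    if x: "x \<in> V" "m / 2 \<le> norm (G0 x)" for x
  proof -
    obtain j where "norm (G0 x) \<le> n * \<bar>G0 x $ j\<bar>" unfolding n_def by (rule norm_le_card_component)
    then have g0: "m / (2 * n) \<le> \<bar>G0 x $ j\<bar>" using x n by (simp add: field_simps)
    have "\<bar>(G1 x - G0 x) $ j\<bar> < m / (4 * n)"
      using close[of x] x closure_subset component_le_norm_cart[of "G1 x - G0 x" j]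
      by (force simp: n_def)
    then have d: "\<bar>G1 x $ j - G0 x $ j\<bar> < m / (4 * n)" by simp
    have half: "m / (2 * n) = 2 * (m / (4 * n))" by simp
    have pos: "m / (4 * n) > 0" using m n by simp
    have g1: "m / (4 * n) \<le> \<bar>G1 x $ j\<bar>" using g0 d half by linarith
    have sg: "G0 x $ j * G1 x $ j > 0"
    proof (cases "G0 x $ j > 0")
      case True
      then have "G1 x $ j > 0" using g0 d half pos by linarith
      then show ?thesis using True by simp
    next
      case False
      then have "G0 x $ j < 0" "G1 x $ j < 0" using g0 d half pos by linarith+
      then show ?thesis by (simp add: mult_neg_neg)
    qed
    have "1 / (2 * a) \<le> \<bar>G0 x $ j\<bar>" "1 / (2 * a) \<le> \<bar>G1 x $ j\<bar>"
      using a2 g0 g1 half pos by linarith+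
    then show ?thesis
      using apos sg by (intro exI[of _ j]) (simp add: ds_def s_def step_deriv_scaled_eq_0 step_fun_scaled_eq)
  qed
  \<comment> \<open>Affine in the squared norm of \<open>G0 x\<close>, with value 1 at norm
    \<open>m / 2\<close> and 0 at norm \<open>3 * m / 4\<close>. As \<open>3 * m / 4 < m\<close>,
    the cut-off vanishes near the frontier of \<open>V\<close>.\<close>
  define q where "q x = - (16 / (5 * m\<^sup>2)) * (G0 x \<bullet> G0 x) + 9 / 5" for x
  have q: "c1_fun q (\<lambda>x. - (16 / (5 * m\<^sup>2)) *\<^sub>R (2 *\<^sub>R (transpose (J0 x) *v G0 x)))"
    unfolding q_def by (rule c1_fun_affine[OF c1_fun_norm_sq[OF c0]])
  have q_in: "q x \<ge> 1" if "norm (G0 x) \<le> m / 2" for x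
  proof -
    have "G0 x \<bullet> G0 x \<le> (m / 2)\<^sup>2" using that by (metis norm_ge_zero power2_norm_eq_inner power_mono)
    then show ?thesis using m by (simp add: q_def field_simps power2_eq_square)
  qed
  have q_out: "q x \<le> 0" if "norm (G0 x) \<ge> 3 * m / 4" for x
  proof -
    have "(3 * m / 4)\<^sup>2 \<le> G0 x \<bullet> G0 x" using that m
      by (simp only: power2_norm_eq_inner[symmetric]) (intro power_mono, auto)
    then show ?thesis using m by (simp add: q_def field_simps power2_eq_square)
  qed
  obtain dc where cut: "c1_fun (\<lambda>x. step_fun (q x)) dc"
    and dc: "\<And>x. step_deriv (q x) = 0 \<Longrightarrow> dc x = 0"
    using c1_fun_step[OF q] by fastforce
  obtain R where R: "R > 0" "V \<subseteq> ball 0 R"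
    using V(2) bounded_subset_ballD by blast
  have Vleb: "V \<in> sets lebesgue" using V(1) by (simp add: borel_open)
  have integrable: "(\<lambda>x. det (\<chi> i. r T x i)) integrable_on V" for T
  proof -
    have "continuous_on (cball 0 R) (\<lambda>x. det (\<chi> i. r T x i))"
      by (intro continuous_on_det continuous_on_vec_lambda c1_funD(2)[OF csT])
    then show ?thesis
      using R ball_subset_cball Vleb
      by (intro set_lebesgue_integral_eq_integral(1)
          absolutely_integrable_continuous_subset_compact[of "cball 0 R"]) auto
  qed
  have step: "integral V (\<lambda>x. det (\<chi> i. r (insert k T) x i)) = integral V (\<lambda>x. det (\<chi> i. r T x i))"
    if k: "k \<notin> T" for k T
  proof -
    define u where "u x = s (G1 x $ k) - s (G0 x $ k)" for x
    define du where "du x = ds (G1 x $ k) *\<^sub>R J1 x $ k - ds (G0 x $ k) *\<^sub>R J0 x $ k" for x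
    have cu: "c1_fun u du" unfolding u_def du_def by (rule c1_fun_diff[OF cs1 cs0])
    have diff: "det (\<chi> i. r (insert k T) x i) - det (\<chi> i. r T x i) =
        det (\<chi> i. if i = k then du x else r T x i)" for x
    proof -
      have "(\<chi> i. r (insert k T) x i) = (\<chi> i. if i = k then ds (G1 x $ k) *\<^sub>R J1 x $ k else r T x i)"
        by (auto simp: r_def vec_eq_iff)
      moreover have "(\<chi> i. r T x i) = (\<chi> i. if i = k then ds (G0 x $ k) *\<^sub>R J0 x $ k else r T x i)"
        using k by (auto simp: r_def vec_eq_iff)
      ultimately show ?thesis unfolding du_def det_row_diff by simp
    qed
    \<comment> \<open>The cut-off lets the difference of the two \<open>k\<close>-th components be
      extended by 0 across the frontier: \<open>O'\<close> is an open set that contains the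
      complement of \<open>V\<close> and on which the extension vanishes.\<close>
    define w where "w x = (if x \<in> V then step_fun (q x) * u x else 0)" for x
    define dw where "dw x = (if x \<in> V then step_fun (q x) *\<^sub>R du x + u x *\<^sub>R dc x else 0)" for x
    define O' where "O' = - closure V \<union> {x. norm (G0 x) > 3 * m / 4}"
    have openO: "open O'"
      unfolding O'_def using c1_mapD(3)[OF c0, of UNIV]
      by (intro open_Un open_Collect_less continuous_intros) (auto simp: open_Compl)
    have cover: "V \<union> O' = UNIV"
    proof -
      have "x \<in> O'" if "x \<in> closure V" "x \<notin> V" for x
        using fr[of x] that V(1) m by (auto simp: frontier_def O'_def interior_open)
      then show ?thesis by (auto simp: O'_def)
    qed
    have zeroO: "w x = 0 \<and> dw x = 0" if "x \<in> O'" for x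
    proof (cases "x \<in> V")
      case True
      then have "q x \<le> 0" using that closure_subset q_out[of x] by (auto simp: O'_def)
      then show ?thesis using True dc[of x] by (simp add: w_def dw_def step_fun_le_0 step_deriv_eq_0)
    qed (simp add: w_def dw_def)
    have cp: "c1_fun (\<lambda>x. step_fun (q x) * u x) (\<lambda>x. step_fun (q x) *\<^sub>R du x + u x *\<^sub>R dc x)"
      by (rule c1_fun_mult[OF cut cu])
    have cw: "c1_fun w dw"
      unfolding c1_fun_def
    proof (intro conjI allI)
      fix x
      show "(w has_derivative (\<lambda>v. dw x \<bullet> v)) (at x)"
      proof (cases "x \<in> V")
        case True
        show ?thesis
          by (rule has_derivative_transform_within_open[OF _ V(1) True, of "\<lambda>x. step_fun (q x) * u x"])
             (use c1_funD(1)[OF cp, of x] True in \<open>auto simp: w_def dw_def\<close>)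
      next
        case False
        then have x: "x \<in> O'" using cover by auto
        show ?thesis
          by (rule has_derivative_transform_within_open[OF _ openO x, of "\<lambda>x. 0"])
             (use zeroO x in auto)
      qed
      have "continuous_on V dw"
        by (rule continuous_on_eq[OF c1_funD(2)[OF cp]]) (simp add: dw_def)
      moreover have "continuous_on O' dw"
        by (rule continuous_on_eq[OF continuous_on_const[of _ 0]]) (simp add: zeroO)
      ultimately have "continuous_on (V \<union> O') dw" by (intro continuous_on_open_Un V openO)
      then show "continuous_on UNIV dw" by (simp add: cover)
    qed
    define H where "H x = (\<chi> i. if i = k then w x else sT T x i)" for x
    define JH where "JH x = (\<chi> i. if i = k then dw x else r T x i)" for x
    have "c1_map H JH"
      unfolding c1_map_iff
    proof
      fix i show "c1_fun (\<lambda>x. H x $ i) (\<lambda>x. JH x $ i)"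
        using cw csT by (cases "i = k") (simp_all add: H_def JH_def)
    qed
    moreover have "H x $ k = 0" if "R \<le> norm x" for x
      using that R(2) by (auto simp: H_def w_def)
    ultimately have "integral (cball 0 R) (\<lambda>x. det (JH x)) = 0"
      using R(1) by (intro integral_det_component_compact_support)
    \<comment> \<open>On \<open>V\<close> the cut-off leaves the determinant unchanged: where it may
      differ from 1, \<open>far\<close> provides a row that vanishes with and without it.\<close>
    moreover have "det (JH x) = (if x \<in> V then det (\<chi> i. if i = k then du x else r T x i) else 0)" for x
    proof (cases "x \<in> V")
      case False
      then have "row k (JH x) = 0" by (simp add: row_def JH_def dw_def vec_eq_iff)
      then show ?thesis using False by (simp add: det_zero_row)
    next
      case True
      show ?thesis
      proof (cases "norm (G0 x) \<le> m / 2")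
        case near: True
        then have "q x \<ge> 1" by (rule q_in)
        then have "dw x = du x" using True dc[of x] by (simp add: dw_def step_fun_ge_1 step_deriv_eq_0)
        then show ?thesis using True by (simp only: JH_def if_True)
      next
        case False
        then obtain j where j: "ds (G0 x $ j) = 0" "ds (G1 x $ j) = 0" "s (G0 x $ j) = s (G1 x $ j)"
          using far[of x] True by auto
        have r0: "r T x j = 0" using j by (simp add: r_def)
        have "j = k \<Longrightarrow> du x = 0 \<and> dw x = 0" using j by (simp add: du_def dw_def u_def)
        then have "row j (JH x) = 0" "row j (\<chi> i. if i = k then du x else r T x i) = 0"
          using r0 by (auto simp: row_def JH_def vec_eq_iff)
        then show ?thesis by (simp add: det_zero_row)
      qed
    qed
    moreover have "V \<inter> cball 0 R = V" using R ball_subset_cball by blast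
    ultimately have "integral V (\<lambda>x. det (\<chi> i. if i = k then du x else r T x i)) = 0"
      using integral_restrict_Int[of "cball 0 R" V "\<lambda>x. det (\<chi> i. if i = k then du x else r T x i)"]
      by simp
    then show ?thesis
      using integral_diff[OF integrable[of "insert k T"] integrable[of T]] by (simp add: diff)
  qed
  have "integral V (\<lambda>x. det (\<chi> i. r T x i)) = integral V (\<lambda>x. det (\<chi> i. r {} x i))" for T
    using finite[of T] by (induction T rule: finite_induct) (simp_all add: step)
  from this[of UNIV] show ?thesis
    by (simp add: bump_det r_def ds_def)
qed

lemma locally_injective_regular_zero:
  fixes G :: "real ^ 'n \<Rightarrow> real ^ 'n"
  assumes c: "c1_map G J" and V: "open V" "z \<in> V" and det: "det (J z) \<noteq> 0"
  shows "\<exists>e>0. ball z e \<subseteq> V \<and> inj_on G (ball z e) \<and> (\<forall>x\<in>ball z e. sgn (det (J x)) = sgn (det (J z)))"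
proof -
  define n where "n = real CARD('n)"
  have n: "n \<ge> 1" by (simp add: n_def Suc_leI)
  have cont: "continuous (at z) J"
    using c1_mapD(2)[OF c, of UNIV] by (metis continuous_on_eq_continuous_at open_UNIV UNIV_I)
  \<comment> \<open>Continuity of \<open>J\<close> in the operator norm, which is at most
    \<open>n * n\<close> times a bound for the entries.\<close>
  have ons: "\<exists>d>0. \<forall>x. dist z x < d \<longrightarrow> onorm (\<lambda>v. J x *v v - J z *v v) < e" if e: "e > 0" for e
  proof -
    have "e / (2 * n * n) > 0" using e n by simp
    then obtain d where d: "d > 0" "\<And>x. dist x z < d \<Longrightarrow> dist (J x) (J z) < e / (2 * n * n)"
      using cont unfolding continuous_at_eps_delta by metis
    have "onorm (\<lambda>v. J x *v v - J z *v v) < e" if "dist z x < d" for x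
    proof -
      have nb: "norm (J x - J z) < e / (2 * n * n)" using d(2)[of x] that by (simp add: dist_commute dist_norm)
      have "\<bar>(J x - J z) $ i $ j\<bar> \<le> e / (2 * n * n)" for i j
        using component_le_norm_cart[of "(J x - J z) $ i" j]
          Finite_Cartesian_Product.norm_nth_le[of "J x - J z" i] nb by linarith
      then have "onorm ((*v) (J x - J z)) \<le> n * n * (e / (2 * n * n))"
        unfolding n_def by (rule onorm_le_matrix_component)
      also have "\<dots> < e" using n e by (simp add: field_simps)
      finally show ?thesis by (simp add: matrix_vector_mult_diff_rdistrib[abs_def])
    qed
    then show ?thesis using d(1) by blast
  qed
  obtain Ji where inv: "Ji ** J z = mat 1"
    using det by (metis invertible_det_nz invertible_def)
  obtain r where r: "r > 0" "ball z r \<subseteq> V" "inj_on G (ball z r)"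
  proof (rule has_derivative_locally_injective[of z V "(*v) Ji" "\<lambda>x v. J x *v v" G])
    show "(*v) Ji \<circ> (*v) (J z) = id"
      using inv by (auto simp: fun_eq_iff matrix_vector_mul_assoc)
  qed (use V ons c1_mapD(1)[OF c] in auto)
  have "continuous (at z) (\<lambda>x. det (J x))"
    using continuous_on_det[OF c1_mapD(2)[OF c, of UNIV]] by (metis continuous_on_eq_continuous_at open_UNIV UNIV_I)
  then obtain d where d: "d > 0" "\<And>x. dist x z < d \<Longrightarrow> dist (det (J x)) (det (J z)) < \<bar>det (J z)\<bar>"
    using det unfolding continuous_at_eps_delta by (metis zero_less_abs_iff)
  have "sgn (det (J x)) = sgn (det (J z))" if "x \<in> ball z d" for x
    using d(2)[of x] that by (auto simp: dist_commute dist_real_def sgn_if)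
  note sg = this
  have sub: "ball z (min r d) \<subseteq> ball z r" "ball z (min r d) \<subseteq> ball z d"
    by (simp_all add: subset_ball)
  show ?thesis
  proof (intro exI[of _ "min r d"] conjI ballI)
    show "min r d > 0" using r(1) d(1) by simp
    show "ball z (min r d) \<subseteq> V" using sub(1) r(2) by (rule order_trans)
    show "inj_on G (ball z (min r d))" using r(3) sub(1) by (rule inj_on_subset)
    show "sgn (det (J x)) = sgn (det (J z))" if "x \<in> ball z (min r d)" for x
      using that sub(2) by (intro sg) blast
  qed
qed

text \<open>Zeros avoid the frontier, so they form a compact set. An accumulation point would be a
  regular zero without any neighbourhood on which \<open>G\<close> is injective.\<close>

lemma finite_regular_zeros:
  fixes G :: "real ^ 'n \<Rightarrow> real ^ 'n"
  assumes c: "c1_map G J" and V: "open V" "bounded V"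
    and fr: "\<And>x. x \<in> frontier V \<Longrightarrow> G x \<noteq> 0" and reg: "\<And>x. x \<in> V \<Longrightarrow> G x = 0 \<Longrightarrow> det (J x) \<noteq> 0"
  shows "finite {x \<in> V. G x = 0}"
proof (rule ccontr)
  let ?Z = "{x \<in> V. G x = 0}"
  assume inf: "infinite ?Z"
  have Z: "?Z = {x \<in> closure V. G x = 0}"
    using fr closure_subset V(1) by (auto simp: frontier_def interior_open)
  have "closed {x \<in> closure V. G x = 0}"
    by (intro continuous_closed_preimage_constant c1_mapD(3)[OF c]) auto
  moreover have "bounded ?Z" using V(2) by (rule bounded_subset) auto
  ultimately have "compact ?Z" using Z by (simp add: compact_eq_bounded_closed)
  then obtain z where z: "z \<in> ?Z" "z islimpt ?Z"
    using Heine_Borel_imp_Bolzano_Weierstrass[OF _ inf order_refl] by blast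
  then obtain e where e: "e > 0" "inj_on G (ball z e)"
    using locally_injective_regular_zero[OF c V(1)] reg by blast
  obtain x where "x \<in> ?Z" "x \<in> ball z e" "x \<noteq> z"
    by (rule islimptE[OF z(2), of "ball z e"]) (use e(1) in auto)
  then show False using inj_onD[OF e(2), of x z] e(1) z(1) by auto
qed

text \<open>The hypothesis speaks of all smaller radii so that the minimum of finitely many radii
  works for every point.\<close>

lemma finite_common_radius:
  assumes "finite Z" "\<And>z. z \<in> Z \<Longrightarrow> \<exists>e>0. \<forall>e'. 0 < e' \<and> e' \<le> e \<longrightarrow> P z (e' :: real)"
  shows "\<exists>e>0. \<forall>z\<in>Z. P z e"
proof -
  have "\<exists>e>0. \<forall>e'. 0 < e' \<and> e' \<le> e \<longrightarrow> (\<forall>z\<in>Z. P z e')"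
    using assms
  proof (induction Z rule: finite_induct)
    case (insert z Z)
    then obtain e1 e2 where "e1 > 0" "\<forall>e'. 0 < e' \<and> e' \<le> e1 \<longrightarrow> (\<forall>z\<in>Z. P z e')"
      "e2 > 0" "\<forall>e'. 0 < e' \<and> e' \<le> e2 \<longrightarrow> P z e'" by (metis insertCI)
    then show ?case by (intro exI[of _ "min e1 e2"]) auto
  qed (auto intro: exI[of _ 1])
  then show ?thesis by force
qed

lemma integral_change_of_variables_scalar:
  fixes f :: "real ^ 'n::{finite,wellorder} \<Rightarrow> real" and g :: "real ^ 'n::_ \<Rightarrow> real ^ 'n::_"
  assumes S: "S \<in> sets lebesgue"
    and der: "\<And>x. x \<in> S \<Longrightarrow> (g has_derivative g' x) (at x within S)"
    and inj: "inj_on g S" and f: "f absolutely_integrable_on (g ` S)"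
  shows "integral (g ` S) f = integral S (\<lambda>x. \<bar>det (matrix (g' x))\<bar> * f (g x))"
proof -
  define b where "b = integral (g ` S) f"
  have "(\<lambda>y. vec (f y) :: real ^ 1) absolutely_integrable_on (g ` S) \<and>
      integral (g ` S) (\<lambda>y. vec (f y) :: real ^ 1) = vec b"
    using f unfolding absolutely_integrable_on_1_iff integral_on_1_eq by (simp add: b_def)
  then have "(\<lambda>x. \<bar>det (matrix (g' x))\<bar> *\<^sub>R (vec (f (g x)) :: real ^ 1)) absolutely_integrable_on S \<and>
      integral S (\<lambda>x. \<bar>det (matrix (g' x))\<bar> *\<^sub>R (vec (f (g x)) :: real ^ 1)) = vec b"
    using has_absolute_integral_change_of_variables[OF S der inj, of "\<lambda>y. vec (f y) :: real ^ 1" "vec b"]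
    by simp
  then show ?thesis
    unfolding integral_on_1_eq by (simp add: b_def)
qed

lemma bump_nonneg: "a \<ge> 0 \<Longrightarrow> bump a y \<ge> 0"
  by (simp add: bump_def prod_nonneg step_deriv_nonneg)

lemma continuous_bump: "continuous_on S (bump a)"
  unfolding bump_def
  by (intro continuous_intros continuous_on_compose2[OF continuous_step_deriv[of UNIV]]) auto

lemma bump_eq_0:
  fixes y :: "real ^ 'n"
  assumes "a > 0" "real CARD('n) / (2 * a) \<le> norm y"
  shows "bump a y = 0"
proof -
  define n where "n = real CARD('n)"
  have n: "n \<ge> 1" by (simp add: n_def Suc_leI)
  obtain j where j: "norm y \<le> n * \<bar>y $ j\<bar>" unfolding n_def by (rule norm_le_card_component)
  have "n * (1 / (2 * a)) \<le> n * \<bar>y $ j\<bar>" using assms(2) j by (simp add: n_def)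
  then have "1 / (2 * a) \<le> \<bar>y $ j\<bar>" using n by (simp only: mult_le_cancel_left_pos)
  then have "step_deriv (a * y $ j + 1/2) = 0" using assms(1) by (rule step_deriv_scaled_eq_0)
  then show ?thesis unfolding bump_def by (intro prod_zero) auto
qed

lemma bump_absolutely_integrable:
  assumes "a > 0"
  shows "(bump a :: real ^ 'n \<Rightarrow> real) absolutely_integrable_on UNIV"
proof -
  define R where "R = real CARD('n) / (2 * a)"
  have "(bump a :: real ^ 'n \<Rightarrow> real) absolutely_integrable_on cball 0 R"
    by (rule absolutely_integrable_continuous_subset_compact[OF continuous_bump compact_cball]) auto
  moreover have "bump a y = (if y \<in> cball 0 R then bump a y else 0)" for y :: "real ^ 'n"
    using bump_eq_0[OF assms, of y] by (auto simp: R_def)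
  ultimately show ?thesis
    using absolutely_integrable_restrict_UNIV[of "cball 0 R" "bump a :: real ^ 'n \<Rightarrow> real"] by presburger
qed

text \<open>Allows this integral, the common factor of the two signed counts to be compared, to be
  cancelled.\<close>

lemma integral_bump_pos:
  assumes "a > 0"
  shows "integral UNIV (bump a :: real ^ 'n \<Rightarrow> real) > 0"
proof -
  let ?f = "bump a :: real ^ 'n \<Rightarrow> real"
  have "?f 0 > 0" using assms by (simp add: bump_def prod_pos step_deriv_def)
  moreover have "continuous (at 0) ?f"
    using continuous_bump[of UNIV a] by (metis continuous_on_eq_continuous_at open_UNIV UNIV_I)
  ultimately obtain d where d: "d > 0" "\<And>y. dist y 0 < d \<Longrightarrow> dist (?f y) (?f 0) < ?f 0 / 2"
    unfolding continuous_at_eps_delta by (metis half_gt_zero)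
  then have ge: "?f 0 / 2 \<le> ?f y" if "y \<in> ball 0 d" for y
  proof -
    have "\<bar>?f y - ?f 0\<bar> < ?f 0 / 2" using d(2)[of y] that by (simp add: dist_real_def)
    then show ?thesis by linarith
  qed
  have int: "?f integrable_on UNIV"
    by (rule set_lebesgue_integral_eq_integral(1)[OF bump_absolutely_integrable[OF assms]])
  have intb: "?f integrable_on ball 0 d"
    by (intro set_lebesgue_integral_eq_integral(1) set_integrable_subset[OF bump_absolutely_integrable[OF assms]])
       auto
  have "0 < ?f 0 / 2 * measure lebesgue (ball (0 :: real ^ 'n) d)"
    using \<open>?f 0 > 0\<close> content_ball_pos[OF d(1), of "0 :: real ^ 'n"] by simp
  also have "\<dots> = integral (ball 0 d) (\<lambda>y :: real ^ 'n. ?f 0 / 2)"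
    using lmeasure_integral[OF lmeasurable_ball[of "0 :: real ^ 'n" d]]
    by (simp add: integral_mult_right[of "ball 0 d" "?f 0 / 2" "\<lambda>y. 1", simplified])
  also have "\<dots> \<le> integral (ball 0 d) ?f"
    by (intro integral_le intb ge integrable_on_const lmeasurable_ball)
  also have "\<dots> \<le> integral UNIV ?f"
    by (rule integral_subset_le[OF subset_UNIV intb int]) (use assms in \<open>simp add: bump_nonneg\<close>)
  finally show ?thesis .
qed

text \<open>For a narrow density the integrand lives in disjoint balls around the zeros. On each of
  them \<open>G\<close> is injective and its Jacobian determinant has constant sign, so a change of
  variables yields this sign times the full integral of the density.\<close>

lemma integral_bump_count:
  fixes G :: "real ^ 'n::{finite,wellorder} \<Rightarrow> real ^ 'n::_"
  assumes c: "c1_map G J" and V: "open V" "bounded V"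
    and fr: "\<And>x. x \<in> frontier V \<Longrightarrow> G x \<noteq> 0" and reg: "\<And>x. x \<in> V \<Longrightarrow> G x = 0 \<Longrightarrow> det (J x) \<noteq> 0"
  obtains a0 where "a0 > 0"
    "\<And>a. a \<ge> a0 \<Longrightarrow> integral V (\<lambda>x. bump a (G x) * det (J x)) =
      (\<Sum>z | z \<in> V \<and> G z = 0. sgn (det (J z))) * integral UNIV (bump a :: real ^ 'n::_ \<Rightarrow> real)"
proof -
  define Z where "Z = {x \<in> V. G x = 0}"
  have fin: "finite Z" unfolding Z_def by (rule finite_regular_zeros[OF c V fr reg])
  define good where "good z e \<longleftrightarrow> ball z e \<subseteq> V \<and> inj_on G (ball z e) \<and>
      (\<forall>x\<in>ball z e. sgn (det (J x)) = sgn (det (J z))) \<and> (\<forall>z'\<in>Z. z' \<noteq> z \<longrightarrow> ball z e \<inter> ball z' e = {})"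
    for z e
  have "\<exists>e>0. \<forall>z\<in>Z. good z e"
  proof (rule finite_common_radius[OF fin])
    fix z assume z: "z \<in> Z"
    then obtain e where e: "e > 0" "ball z e \<subseteq> V" "inj_on G (ball z e)"
        "\<forall>x\<in>ball z e. sgn (det (J x)) = sgn (det (J z))"
      using locally_injective_regular_zero[OF c V(1), of z] reg[of z] by (auto simp: Z_def)
    obtain d where d: "d > 0" "\<And>z'. z' \<in> Z \<Longrightarrow> z' \<noteq> z \<Longrightarrow> d \<le> dist z z'"
      using finite_set_avoid[OF fin, of z] by auto
    show "\<exists>e>0. \<forall>e'. 0 < e' \<and> e' \<le> e \<longrightarrow> good z e'"
    proof (intro exI[of _ "min e (d / 2)"] conjI allI impI)
      fix e' assume e': "0 < e' \<and> e' \<le> min e (d / 2)"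
      then have sub: "ball z e' \<subseteq> ball z e" by (intro subset_ball) simp
      have "ball z e' \<inter> ball z' e' = {}" if "z' \<in> Z" "z' \<noteq> z" for z'
        using d(2)[OF that] e' by (intro disjoint_ballI) simp
      then show "good z e'"
        using e sub inj_on_subset[OF e(3) sub] unfolding good_def by blast
    qed (use e d in simp)
  qed
  then obtain e where e: "e > 0" and good: "\<And>z. z \<in> Z \<Longrightarrow> good z e" by auto
  define N where "N = (\<Union>z\<in>Z. ball z e)"
  have Nsub: "N \<subseteq> V" using good by (auto simp: N_def good_def)
  obtain \<mu> where \<mu>: "\<mu> > 0" "\<And>x. x \<in> closure V - N \<Longrightarrow> \<mu> \<le> norm (G x)"
  proof (cases "closure V - N = {}")
    case False
    have "compact (closure V - N)"
      using V(2) by (intro compact_diff) (auto simp: N_def compact_closure)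
    then obtain x where x: "x \<in> closure V - N" "\<And>y. y \<in> closure V - N \<Longrightarrow> norm (G x) \<le> norm (G y)"
      using continuous_attains_inf[OF _ False continuous_on_norm[OF c1_mapD(3)[OF c]]] by blast
    have "G x \<noteq> 0"
    proof (cases "x \<in> V")
      case True
      then have "G x = 0 \<Longrightarrow> x \<in> N" using e by (auto simp: N_def Z_def)
      then show ?thesis using x(1) by blast
    next
      case False
      then show ?thesis using x(1) fr V(1) by (auto simp: frontier_def interior_open)
    qed
    then show ?thesis using x by (intro that[of "norm (G x)"]) auto
  qed (auto intro: that[of 1])
  have "\<exists>\<nu>>0. \<forall>z\<in>Z. ball 0 \<nu> \<subseteq> G ` ball z e"
  proof (rule finite_common_radius[OF fin])
    fix z assume z: "z \<in> Z"
    have "open (G ` ball z e)"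
      using good[OF z] by (intro invariance_of_domain c1_mapD(3)[OF c]) (auto simp: good_def)
    moreover have "0 \<in> G ` ball z e"
      using z e by (intro image_eqI[of _ _ z]) (auto simp: Z_def)
    ultimately obtain \<nu> where "\<nu> > 0" "ball 0 \<nu> \<subseteq> G ` ball z e" by (meson openE)
    then show "\<exists>\<nu>>0. \<forall>\<nu>'. 0 < \<nu>' \<and> \<nu>' \<le> \<nu> \<longrightarrow> ball 0 \<nu>' \<subseteq> G ` ball z e"
      by (intro exI[of _ \<nu>]) (auto intro: order_trans[OF subset_ball])
  qed
  then obtain \<nu> where \<nu>: "\<nu> > 0" "\<And>z. z \<in> Z \<Longrightarrow> ball 0 \<nu> \<subseteq> G ` ball z e" by auto
  define n where "n = real CARD('n::_)"
  have n: "n \<ge> 1" by (simp add: n_def Suc_leI)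
  \<comment> \<open>\<open>bump a\<close> vanishes from norm \<open>n / (2 * a)\<close> on. From
    \<open>a0\<close> on this radius is at most \<open>\<mu>\<close>, so nothing is left outside the
    balls, and at most \<open>\<nu>\<close>, so the image of each ball contains all points where the
    density is nonzero.\<close>
  define a0 where "a0 = n / (2 * min \<mu> \<nu>)"
  have min: "min \<mu> \<nu> > 0" using \<mu> \<nu> by simp
  have a0: "a0 > 0" using n min by (simp add: a0_def)
  show ?thesis
  proof (rule that[OF a0])
    fix a assume a: "a \<ge> a0"
    then have apos: "a > 0" using a0 by simp
    have "n \<le> a * (2 * min \<mu> \<nu>)" using a min by (simp add: a0_def pos_divide_le_eq)
    then have "n \<le> min \<mu> \<nu> * (2 * a)" by (simp only: mult_ac)
    then have "n / (2 * a) \<le> min \<mu> \<nu>" using apos by (intro mult_imp_div_pos_le) auto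
    then have van: "bump a y = 0" if "min \<mu> \<nu> \<le> norm y" for y :: "real ^ 'n::_"
      using that apos by (intro bump_eq_0) (auto simp: n_def)
    define f where "f x = bump a (G x) * det (J x)" for x
    have f_int: "f absolutely_integrable_on ball z e" if "z \<in> Z" for z
    proof -
      have "continuous_on (cball z e) f" unfolding f_def
        by (intro continuous_intros c1_mapD[OF c] continuous_on_compose2[OF continuous_bump[of UNIV]]) auto
      then show ?thesis
        by (intro absolutely_integrable_continuous_subset_compact[of "cball z e"]) auto
    qed
    have f_ball: "integral (ball z e) f = sgn (det (J z)) * integral UNIV (bump a :: real ^ 'n::_ \<Rightarrow> real)"
      if z: "z \<in> Z" for z
    proof -
      have sg: "f x = sgn (det (J z)) * (\<bar>det (J x)\<bar> * bump a (G x))" if "x \<in> ball z e" for x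
      proof -
        have "det (J x) = sgn (det (J x)) * \<bar>det (J x)\<bar>" by (simp add: sgn_mult_abs)
        moreover have "sgn (det (J x)) = sgn (det (J z))" using good[OF z] that by (simp add: good_def)
        ultimately show ?thesis by (simp add: f_def)
      qed
      have ai: "bump a absolutely_integrable_on (G ` ball z e)"
      proof (rule set_integrable_subset[OF bump_absolutely_integrable[OF apos]])
        have "open (G ` ball z e)"
          using good[OF z] by (intro invariance_of_domain c1_mapD(3)[OF c]) (auto simp: good_def)
        then show "G ` ball z e \<in> sets lebesgue" by (simp add: borel_open)
      qed auto
      have "integral (ball z e) f = sgn (det (J z)) * integral (ball z e) (\<lambda>x. \<bar>det (J x)\<bar> * bump a (G x))"
        using integral_cong[of "ball z e" f, OF sg] by simp
      also have "integral (ball z e) (\<lambda>x. \<bar>det (J x)\<bar> * bump a (G x)) = integral (G ` ball z e) (bump a)"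
        using integral_change_of_variables_scalar[of "ball z e" G "\<lambda>x v. J x *v v" "bump a"]
          c1_mapD(1)[OF c] ai good[OF z] by (simp add: good_def has_derivative_at_withinI)
      also have "integral (G ` ball z e) (bump a) = integral UNIV (bump a :: real ^ 'n::_ \<Rightarrow> real)"
      proof -
        have "bump a y = (if y \<in> G ` ball z e then bump a y else 0)" for y :: "real ^ 'n::_"
          using van[of y] \<nu>(2)[OF z] by (force simp: subset_iff)
        then show ?thesis
          using integral_restrict_UNIV[of "G ` ball z e" "bump a :: real ^ 'n::_ \<Rightarrow> real"] by presburger
      qed
      finally show ?thesis .
    qed
    have split: "(if x \<in> V then f x else 0) = (\<Sum>z\<in>Z. if x \<in> ball z e then f x else 0)" for x
    proof (cases "x \<in> N")
      case True
      then obtain z where z: "z \<in> Z" "x \<in> ball z e" by (auto simp: N_def)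
      have "x \<notin> ball z' e" if "z' \<in> Z" "z' \<noteq> z" for z'
        using good[OF z(1)] z(2) that unfolding good_def by blast
      then have "(\<Sum>z'\<in>Z. if x \<in> ball z' e then f x else 0) = (\<Sum>z'\<in>Z. if z' = z then f x else 0)"
        using z by (intro sum.cong) auto
      then show ?thesis using True Nsub z fin by auto
    next
      case False
      then have 0: "(\<Sum>z\<in>Z. if x \<in> ball z e then f x else 0) = 0"
        by (intro sum.neutral) (auto simp: N_def)
      have "f x = 0" if "x \<in> V"
        using \<mu>(2)[of x] van[of "G x"] that closure_subset False by (force simp: f_def)
      then show ?thesis using 0 by simp
    qed
    have "integral V f = integral UNIV (\<lambda>x. if x \<in> V then f x else 0)"
      by (simp add: integral_restrict_UNIV)
    also have "\<dots> = (\<Sum>z\<in>Z. integral UNIV (\<lambda>x. if x \<in> ball z e then f x else 0))"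
      unfolding split
      by (rule integral_sum[OF fin])
         (simp only: integrable_restrict_UNIV, rule set_lebesgue_integral_eq_integral(1)[OF f_int])
    also have "\<dots> = (\<Sum>z\<in>Z. sgn (det (J z)) * integral UNIV (bump a :: real ^ 'n::_ \<Rightarrow> real))"
      by (simp only: integral_restrict_UNIV f_ball cong: sum.cong)
    also have "\<dots> = (\<Sum>z\<in>Z. sgn (det (J z))) * integral UNIV (bump a :: real ^ 'n::_ \<Rightarrow> real)"
      by (simp add: sum_distrib_right)
    finally show "integral V (\<lambda>x. bump a (G x) * det (J x)) =
      (\<Sum>z | z \<in> V \<and> G z = 0. sgn (det (J z))) * integral UNIV (bump a :: real ^ 'n::_ \<Rightarrow> real)"
      by (simp add: f_def[abs_def] Z_def)
  qed
qed

text \<open>For large \<open>a\<close> both counts, times the same positive integral, are the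
  integrals that \<open>integral_bump_eq\<close> identifies.\<close>

lemma regular_count_eq_wellorder:
  fixes G0 G1 :: "real ^ 'n::{finite,wellorder} \<Rightarrow> real ^ 'n::_"
  assumes V: "open V" "bounded V"
    and c0: "c1_map G0 J0" and c1: "c1_map G1 J1"
    and reg0: "\<And>x. x \<in> V \<Longrightarrow> G0 x = 0 \<Longrightarrow> det (J0 x) \<noteq> 0"
    and reg1: "\<And>x. x \<in> V \<Longrightarrow> G1 x = 0 \<Longrightarrow> det (J1 x) \<noteq> 0"
    and m: "m > 0" and fr: "\<And>x. x \<in> frontier V \<Longrightarrow> m \<le> norm (G0 x)"
    and close: "\<And>x. x \<in> closure V \<Longrightarrow> norm (G1 x - G0 x) < m / (4 * real CARD('n::_))"
  shows "(\<Sum>z | z \<in> V \<and> G0 z = 0. sgn (det (J0 z))) = (\<Sum>z | z \<in> V \<and> G1 z = 0. sgn (det (J1 z)))"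
proof -
  define n where "n = real CARD('n::_)"
  have n: "n \<ge> 1" by (simp add: n_def Suc_leI)
  have fr0: "G0 x \<noteq> 0" if "x \<in> frontier V" for x using fr[OF that] m by auto
  have fr1: "G1 x \<noteq> 0" if "x \<in> frontier V" for x
  proof
    assume "G1 x = 0"
    then have "norm (G0 x) < m / (4 * n)" using close[of x] that by (simp add: frontier_def n_def)
    also have "\<dots> \<le> m" using m n by (simp add: field_simps)
    finally show False using fr[OF that] by simp
  qed
  obtain a0 where a0: "a0 > 0" "\<And>a. a \<ge> a0 \<Longrightarrow> integral V (\<lambda>x. bump a (G0 x) * det (J0 x)) =
      (\<Sum>z | z \<in> V \<and> G0 z = 0. sgn (det (J0 z))) * integral UNIV (bump a :: real ^ 'n::_ \<Rightarrow> real)"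
    using integral_bump_count[OF c0 V fr0 reg0] by blast
  obtain a1 where a1: "a1 > 0" "\<And>a. a \<ge> a1 \<Longrightarrow> integral V (\<lambda>x. bump a (G1 x) * det (J1 x)) =
      (\<Sum>z | z \<in> V \<and> G1 z = 0. sgn (det (J1 z))) * integral UNIV (bump a :: real ^ 'n::_ \<Rightarrow> real)"
    using integral_bump_count[OF c1 V fr1 reg1] by blast
  define a where "a = max (max a0 a1) (2 * n / m)"
  have am: "a * m \<ge> 2 * n"
  proof -
    have "2 * n / m \<le> a" by (simp add: a_def)
    then show ?thesis using m by (simp add: pos_divide_le_eq)
  qed
  have "a > 0" "a \<ge> a0" "a \<ge> a1" using a0(1) by (auto simp: a_def)
  then show ?thesis
    using integral_bump_eq[OF V c0 c1 m fr close, of a] am a0(2)[of a] a1(2)[of a]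
      integral_bump_pos[of a, where 'n = 'n] by (simp add: n_def)
qed

section \<open>The degree of continuous maps\<close>

text \<open>
  The change of variables theorem and Sard's theorem of the library are stated for index types of
  class \<open>wellorder\<close>; every finite type has a well-ordered copy.
\<close>

typedef 'a wo_copy = "UNIV :: 'a set" morphisms from_wo to_wo by simp

lemma bij_from_wo: "bij from_wo"
  by (metis bijI' from_wo_inject to_wo_inverse UNIV_I)

instance wo_copy :: (finite) finite
  by standard (metis bij_from_wo bij_betw_finite finite_class.finite_UNIV)

instantiation wo_copy :: (finite) linorder
begin

definition less_eq_wo_copy :: "'a wo_copy \<Rightarrow> 'a wo_copy \<Rightarrow> bool" where
  "x \<le> y \<longleftrightarrow> (SOME f :: 'a \<Rightarrow> nat. inj f) (from_wo x) \<le> (SOME f :: 'a \<Rightarrow> nat. inj f) (from_wo y)"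

definition less_wo_copy :: "'a wo_copy \<Rightarrow> 'a wo_copy \<Rightarrow> bool" where
  "x < y \<longleftrightarrow> (SOME f :: 'a \<Rightarrow> nat. inj f) (from_wo x) < (SOME f :: 'a \<Rightarrow> nat. inj f) (from_wo y)"

instance
proof
  have "\<exists>f :: 'a \<Rightarrow> nat. inj f"
    using finite_imp_inj_to_nat_seg[of "UNIV :: 'a set"] by auto
  then have inj: "inj (SOME f :: 'a \<Rightarrow> nat. inj f)" by (rule someI_ex)
  fix x y :: "'a wo_copy"
  show "x \<le> y \<Longrightarrow> y \<le> x \<Longrightarrow> x = y"
    using inj by (auto simp: less_eq_wo_copy_def dest!: antisym injD simp: from_wo_inject)
qed (auto simp: less_eq_wo_copy_def less_wo_copy_def)

end

instance wo_copy :: (finite) wellorder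
proof
  fix P :: "'a wo_copy \<Rightarrow> bool" and a
  assume step: "\<And>x. (\<And>y. y < x \<Longrightarrow> P y) \<Longrightarrow> P x"
  show "P a"
  proof (induction "(SOME f :: 'a \<Rightarrow> nat. inj f) (from_wo a)" arbitrary: a rule: less_induct)
    case less
    show ?case by (rule step, rule less) (simp only: less_wo_copy_def)
  qed
qed

definition relabel :: "real ^ 'n \<Rightarrow> real ^ 'n wo_copy" where
  "relabel x = (\<chi> i. x $ from_wo i)"

definition unlabel :: "real ^ 'n wo_copy \<Rightarrow> real ^ 'n" where
  "unlabel y = (\<chi> i. y $ to_wo i)"

lemma unlabel_relabel [simp]: "unlabel (relabel x) = x" and relabel_unlabel [simp]: "relabel (unlabel y) = y"
  by (simp_all add: relabel_def unlabel_def vec_eq_iff to_wo_inverse from_wo_inverse)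

lemma norm_relabel [simp]: "norm (relabel x) = norm x"
  unfolding norm_vec_def L2_set_def relabel_def
  using sum.reindex_bij_betw[OF bij_from_wo, of "\<lambda>i. (norm (x $ i))\<^sup>2"] by simp

lemma bounded_linear_relabel: "bounded_linear relabel"
  by (intro linear_conv_bounded_linear[THEN iffD1] linearI) (simp_all add: relabel_def vec_eq_iff)

lemma bounded_linear_unlabel: "bounded_linear unlabel"
  by (intro linear_conv_bounded_linear[THEN iffD1] linearI) (simp_all add: unlabel_def vec_eq_iff)

lemma relabel_diff: "relabel x - relabel y = relabel (x - y)"
  by (simp add: relabel_def vec_eq_iff)

lemma relabel_eq_0_iff [simp]: "relabel x = 0 \<longleftrightarrow> x = 0"
  by (metis norm_eq_zero norm_relabel)

lemma CARD_wo_copy [simp]: "CARD('n wo_copy) = CARD('n)"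
  using bij_betw_same_card[OF bij_from_wo] .

definition relabel_matrix :: "real ^ 'n ^ 'n \<Rightarrow> real ^ 'n wo_copy ^ 'n wo_copy" where
  "relabel_matrix A = (\<chi> i j. A $ from_wo i $ from_wo j)"

lemma det_relabel_matrix [simp]: "det (relabel_matrix A) = det A"
  unfolding relabel_matrix_def by (rule det_reindex[OF bij_from_wo])

lemma c1_map_relabel:
  assumes "c1_map G J"
  shows "c1_map (\<lambda>y. relabel (G (unlabel y))) (\<lambda>y. relabel_matrix (J (unlabel y)))"
  unfolding c1_map_def
proof (intro conjI allI)
  fix y
  have "((\<lambda>y. relabel (G (unlabel y))) has_derivative (\<lambda>v. relabel (J (unlabel y) *v unlabel v))) (at y)"
    using has_derivative_compose[OF bounded_linear_imp_has_derivative[OF bounded_linear_unlabel]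
        c1_mapD(1)[OF assms, of "unlabel y"]]
    by (rule bounded_linear.has_derivative[OF bounded_linear_relabel])
  moreover have "relabel (A *v unlabel v) = relabel_matrix A *v v" for A :: "real ^ 'a ^ 'a" and v
  proof -
    have "(\<Sum>j\<in>UNIV. A $ from_wo i $ j * v $ to_wo j) = (\<Sum>j\<in>UNIV. A $ from_wo i $ from_wo j * v $ j)" for i
      using sum.reindex_bij_betw[OF bij_from_wo, of "\<lambda>j. A $ from_wo i $ j * v $ to_wo j"]
      by (simp add: from_wo_inverse)
    then show ?thesis
      by (simp add: relabel_def unlabel_def relabel_matrix_def matrix_vector_mult_def vec_eq_iff)
  qed
  ultimately show "((\<lambda>y. relabel (G (unlabel y))) has_derivative (\<lambda>v. relabel_matrix (J (unlabel y)) *v v)) (at y)"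
    by simp
next
  have "continuous_on UNIV (\<lambda>y. J (unlabel y))"
    by (intro continuous_on_compose2[OF c1_mapD(2)[OF assms, of UNIV]]
        linear_continuous_on bounded_linear_unlabel) auto
  then show "continuous_on UNIV (\<lambda>y. relabel_matrix (J (unlabel y)))"
    unfolding relabel_matrix_def by (intro continuous_intros continuous_on_vec_lambda)
qed

lemma regular_count_eq:
  fixes G0 G1 :: "real ^ 'n \<Rightarrow> real ^ 'n"
  assumes V: "open V" "bounded V"
    and c0: "c1_map G0 J0" and c1: "c1_map G1 J1"
    and reg0: "\<And>x. x \<in> V \<Longrightarrow> G0 x = 0 \<Longrightarrow> det (J0 x) \<noteq> 0"
    and reg1: "\<And>x. x \<in> V \<Longrightarrow> G1 x = 0 \<Longrightarrow> det (J1 x) \<noteq> 0"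
    and m: "m > 0" and fr: "\<And>x. x \<in> frontier V \<Longrightarrow> m \<le> norm (G0 x)"
    and close: "\<And>x. x \<in> closure V \<Longrightarrow> norm (G1 x - G0 x) < m / (4 * real CARD('n))"
  shows "(\<Sum>z | z \<in> V \<and> G0 z = 0. sgn (det (J0 z))) = (\<Sum>z | z \<in> V \<and> G1 z = 0. sgn (det (J1 z)))"
proof -
  define V' where "V' = unlabel -` V"
  have cont: "continuous_on UNIV (unlabel :: _ \<Rightarrow> real ^ 'n)"
    by (rule linear_continuous_on[OF bounded_linear_unlabel])
  have openV': "open V'" unfolding V'_def by (rule open_vimage[OF V(1) cont])
  have "V' = relabel ` V" unfolding V'_def by (force simp: image_iff)
  then have bV': "bounded V'" using bounded_linear_image[OF V(2) bounded_linear_relabel] by simp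
  have "closure V' \<subseteq> unlabel -` closure V"
    using closure_subset by (intro closure_minimal closed_vimage cont) (auto simp: V'_def)
  then have cl: "unlabel y \<in> closure V" if "y \<in> closure V'" for y using that by auto
  have fr': "unlabel y \<in> frontier V" if "y \<in> frontier V'" for y
    using that cl openV' V(1) by (auto simp: frontier_def interior_open V'_def)
  have sum: "(\<Sum>z | z \<in> V' \<and> relabel (G (unlabel z)) = 0. sgn (det (relabel_matrix (J (unlabel z))))) =
      (\<Sum>z | z \<in> V \<and> G z = 0. sgn (det (J z)))" for G J
    by (rule sum.reindex_bij_witness[of _ relabel unlabel]) (auto simp: V'_def)
  have "(\<Sum>z | z \<in> V' \<and> relabel (G0 (unlabel z)) = 0. sgn (det (relabel_matrix (J0 (unlabel z))))) =
      (\<Sum>z | z \<in> V' \<and> relabel (G1 (unlabel z)) = 0. sgn (det (relabel_matrix (J1 (unlabel z)))))"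
    by (rule regular_count_eq_wellorder[OF openV' bV' c1_map_relabel[OF c0] c1_map_relabel[OF c1] _ _ m])
       (use reg0 reg1 fr fr' cl close in \<open>auto simp: V'_def relabel_diff\<close>)
  then show ?thesis by (simp only: sum)
qed

section \<open>Regular values and regular polynomial approximations\<close>

lemma regular_value_wellorder:
  fixes G :: "real ^ 'n::{finite,wellorder} \<Rightarrow> real ^ 'n::_"
  assumes "c1_map G J" "e > 0"
  shows "\<exists>c. norm c < e \<and> (\<forall>x. G x = c \<longrightarrow> det (J x) \<noteq> 0)"
proof -
  have "negligible (G ` {x. det (J x) = 0})"
  proof (rule baby_Sard)
    fix x assume x: "x \<in> {x. det (J x) = 0}"
    show "(G has_derivative (\<lambda>v. J x *v v)) (at x within {x. det (J x) = 0})"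
      by (rule has_derivative_at_withinI[OF c1_mapD(1)[OF assms(1)]])
    show "rank (matrix (\<lambda>v. J x *v v)) < CARD('n::_)"
      using x by (simp add: det_eq_0_rank)
  qed simp
  \<comment> \<open>Negligible critical values cannot fill a ball around 0.\<close>
  moreover have "\<not> negligible (ball (0 :: real ^ 'n::_) e)"
    using assms(2) by (intro open_not_negligible) auto
  ultimately have "\<not> ball 0 e \<subseteq> G ` {x. det (J x) = 0}" using negligible_subset by blast
  then show ?thesis by (auto simp: subset_iff)
qed

lemma regular_value:
  fixes G :: "real ^ 'n \<Rightarrow> real ^ 'n"
  assumes "c1_map G J" "e > 0"
  obtains c where "norm c < e" "\<And>x. G x = c \<Longrightarrow> det (J x) \<noteq> 0"
proof -
  obtain c where c: "norm c < e" "\<And>y. relabel (G (unlabel y)) = c \<Longrightarrow> det (relabel_matrix (J (unlabel y))) \<noteq> 0"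
    using regular_value_wellorder[OF c1_map_relabel[OF assms(1)] assms(2)] by blast
  have "norm (unlabel c) < e" using c(1) by (metis norm_relabel relabel_unlabel)
  moreover have "det (J x) \<noteq> 0" if "G x = unlabel c" for x
    using c(2)[of "relabel x"] that by simp
  ultimately show ?thesis by (rule that)
qed

lemma real_polynomial_function_c1:
  fixes u :: "real ^ 'n \<Rightarrow> real"
  assumes "real_polynomial_function u"
  shows "\<exists>du. c1_fun u du"
  using assms
proof (induction u rule: real_polynomial_function.induct)
  case (linear f)
  then have "linear f" by (simp add: linear_conv_bounded_linear)
  \<comment> \<open>The gradient of a linear functional is its adjoint evaluated at 1.\<close>
  then have "f x = adjoint f 1 \<bullet> x" for x
    using adjoint_works[of f x 1] by (simp add: inner_commute)
  then have "f = (\<lambda>x. adjoint f 1 \<bullet> x)" by (rule ext)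
  then show ?case using c1_fun_inner by metis
qed (blast intro: c1_fun_const c1_fun_add c1_fun_mult)+

lemma polynomial_function_c1:
  fixes p :: "real ^ 'n \<Rightarrow> real ^ 'm"
  assumes "polynomial_function p"
  obtains J where "c1_map p J"
proof -
  have "\<exists>du. c1_fun (\<lambda>x. p x $ i) du" for i
    using assms bounded_linear_vec_nth[of i]
    by (intro real_polynomial_function_c1) (auto simp: polynomial_function_def comp_def)
  then obtain du where "c1_fun (\<lambda>x. p x $ i) (du i)" for i by metis
  then have "c1_map p (\<lambda>x. \<chi> i. du i x)" by (simp add: c1_map_iff)
  then show ?thesis by (rule that)
qed

lemma c1_map_diff_const:
  assumes "c1_map G J"
  shows "c1_map (\<lambda>x. G x - c) J"
  using assms by (auto simp: c1_map_def intro!: derivative_eq_intros)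

text \<open>A polynomial approximation shifted by a small regular value; each of the two uses half
  of \<open>e\<close>.\<close>

lemma regular_approximation:
  fixes F :: "real ^ 'n \<Rightarrow> real ^ 'n"
  assumes "compact S" "continuous_on S F" "e > 0"
  obtains G J where "c1_map G J" "\<And>x. x \<in> S \<Longrightarrow> norm (G x - F x) < e" "\<And>x. G x = 0 \<Longrightarrow> det (J x) \<noteq> 0"
proof -
  obtain p where p: "polynomial_function p" "\<And>x. x \<in> S \<Longrightarrow> norm (F x - p x) < e / 2"
    using Stone_Weierstrass_polynomial_function[OF assms(1,2), of "e / 2"] assms(3) by auto
  obtain J where J: "c1_map p J" using polynomial_function_c1[OF p(1)] .
  obtain c where c: "norm c < e / 2" "\<And>x. p x = c \<Longrightarrow> det (J x) \<noteq> 0"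
    using regular_value[OF J, of "e / 2"] assms(3) by auto
  show ?thesis
  proof (rule that[OF c1_map_diff_const[OF J, of c]])
    fix x assume "x \<in> S"
    then have "norm (p x - F x) < e / 2" using p(2) by (simp add: norm_minus_commute)
    moreover have *: "p x - c - F x = (p x - F x) - c" by simp
    ultimately show "norm (p x - c - F x) < e"
      using c(1) norm_triangle_ineq4[of "p x - F x" c] unfolding * by linarith
  qed (use c in auto)
qed

lemma compact_norm_bound_below:
  assumes "compact S" "continuous_on S F" "\<And>x. x \<in> S \<Longrightarrow> F x \<noteq> 0"
  obtains m where "m > 0" "\<And>x. x \<in> S \<Longrightarrow> m \<le> norm (F x)"
proof (cases "S = {}")
  case False
  then obtain x where "x \<in> S" "\<And>y. y \<in> S \<Longrightarrow> norm (F x) \<le> norm (F y)"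
    using continuous_attains_inf[OF assms(1) False continuous_on_norm[OF assms(2)]] by blast
  then show ?thesis using assms(3) by (intro that[of "norm (F x)"]) auto
qed (auto intro: that[of 1])

section \<open>The degree: characterization by approximations, and additivity\<close>

definition regular_approx ::
  "(real ^ 'n) set \<Rightarrow> (real ^ 'n \<Rightarrow> real ^ 'n) \<Rightarrow> real \<Rightarrow> (real ^ 'n \<Rightarrow> real ^ 'n) \<Rightarrow> (real ^ 'n \<Rightarrow> real ^ 'n ^ 'n) \<Rightarrow> bool"
  where
  "regular_approx V F e G J \<longleftrightarrow> c1_map G J \<and> (\<forall>x\<in>closure V. norm (G x - F x) < e) \<and>
     (\<forall>x\<in>V. G x = 0 \<longrightarrow> det (J x) \<noteq> 0)"

lemma brouwer_degree_altdef:
  "brouwer_degree V F = (THE d. \<exists>e>0. \<forall>G J. regular_approx V F e G J \<longrightarrow>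
     real_of_int d = (\<Sum>x | x \<in> V \<and> G x = 0. sgn (det (J x))))"
  unfolding brouwer_degree_def regular_approx_def c1_map_def by (simp add: conj_assoc)

text \<open>All sufficiently close regular approximations have the same count, and approximations of
  any quality exist; so the description in \<open>brouwer_degree\<close> has exactly one
  solution.\<close>

lemma brouwer_degree_count:
  fixes F :: "real ^ 'n \<Rightarrow> real ^ 'n"
  assumes V: "open V" "bounded V" and F: "continuous_on (closure V) F"
    and fr: "\<And>x. x \<in> frontier V \<Longrightarrow> F x \<noteq> 0"
  shows "\<exists>e>0. \<forall>G J. regular_approx V F e G J \<longrightarrow>
      real_of_int (brouwer_degree V F) = (\<Sum>x | x \<in> V \<and> G x = 0. sgn (det (J x)))"
proof -
  have comp: "compact (closure V)" "compact (frontier V)" "frontier V \<subseteq> closure V"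
    using V(2) by (simp_all add: compact_closure compact_frontier_bounded) (simp add: frontier_def)
  obtain m where m: "m > 0" "\<And>x. x \<in> frontier V \<Longrightarrow> m \<le> norm (F x)"
    using compact_norm_bound_below[OF comp(2) continuous_on_subset[OF F comp(3)] fr] by blast
  define n where "n = real CARD('n)"
  have n: "n \<ge> 1" by (simp add: n_def Suc_leI)
  \<comment> \<open>Two approximations of this quality differ by less than
    \<open>2 * e = (m / 2) / (4 * n)\<close>, the tolerance of \<open>regular_count_eq\<close> for
    the lower bound \<open>m / 2\<close> on the frontier.\<close>
  define e where "e = m / (16 * n)"
  have e: "e > 0" "e \<le> m / 2"
  proof -
    show "e > 0" using m n by (simp add: e_def)
    have "m * 1 \<le> m * (8 * n)" using m n by (intro mult_left_mono) auto
    then show "e \<le> m / 2" using n by (simp add: e_def field_simps)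
  qed
  have eq: "(\<Sum>x | x \<in> V \<and> G0 x = 0. sgn (det (J0 x))) = (\<Sum>x | x \<in> V \<and> G1 x = 0. sgn (det (J1 x)))"
    if G0: "regular_approx V F e G0 J0" and G1: "regular_approx V F e G1 J1" for G0 J0 G1 J1
  proof (rule regular_count_eq[OF V, where m = "m / 2"])
    show "m / 2 \<le> norm (G0 x)" if x: "x \<in> frontier V" for x
    proof -
      have "norm (G0 x - F x) < e" using G0 x comp(3) by (auto simp: regular_approx_def)
      then show ?thesis
        using m(2)[OF x] e(2) norm_triangle_ineq2[of "F x" "G0 x"] by (simp add: norm_minus_commute)
    qed
    show "norm (G1 x - G0 x) < m / 2 / (4 * real CARD('n))" if x: "x \<in> closure V" for x
    proof -
      have "norm (G0 x - F x) < e" "norm (G1 x - F x) < e" using G0 G1 x by (auto simp: regular_approx_def)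
      moreover have *: "G1 x - G0 x = (G1 x - F x) - (G0 x - F x)" by simp
      ultimately have "norm (G1 x - G0 x) < e + e"
        using norm_triangle_ineq4[of "G1 x - F x" "G0 x - F x"] unfolding * by linarith
      then show ?thesis by (simp add: e_def n_def)
    qed
  qed (use G0 G1 m in \<open>auto simp: regular_approx_def\<close>)
  have ex: "\<exists>G J. regular_approx V F e' G J" if "e' > 0" for e'
    using regular_approximation[OF comp(1) F that] unfolding regular_approx_def by metis
  obtain G J where G: "regular_approx V F e G J" using ex[OF e(1)] by blast
  \<comment> \<open>An integer copy of the sum of signs, which \<open>sgn\<close> produces as a real
    number.\<close>
  define d :: int where "d = (\<Sum>x | x \<in> V \<and> G x = 0. if det (J x) > 0 then 1 else if det (J x) < 0 then -1 else 0)"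
  have d: "real_of_int d = (\<Sum>x | x \<in> V \<and> G x = 0. sgn (det (J x)))"
    unfolding d_def of_int_sum by (intro sum.cong) (auto simp: sgn_if)
  have "brouwer_degree V F = d"
    unfolding brouwer_degree_altdef
  proof (rule the_equality)
    show "\<exists>e>0. \<forall>G J. regular_approx V F e G J \<longrightarrow> real_of_int d = (\<Sum>x | x \<in> V \<and> G x = 0. sgn (det (J x)))"
      using eq[OF G] e(1) d by auto
    fix d' assume "\<exists>e>0. \<forall>G J. regular_approx V F e G J \<longrightarrow> real_of_int d' = (\<Sum>x | x \<in> V \<and> G x = 0. sgn (det (J x)))"
    then obtain e' where e': "e' > 0"
      "\<And>G J. regular_approx V F e' G J \<Longrightarrow> real_of_int d' = (\<Sum>x | x \<in> V \<and> G x = 0. sgn (det (J x)))"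
      by blast
    \<comment> \<open>An approximation good enough for both radii forces \<open>d'\<close> to agree
      with \<open>d\<close>.\<close>
    obtain G' J' where "regular_approx V F (min e e') G' J'" using ex[of "min e e'"] e(1) e'(1) by auto
    then have "regular_approx V F e G' J'" "regular_approx V F e' G' J'"
      by (auto simp: regular_approx_def)
    then have "real_of_int d' = real_of_int d" using e'(2)[of G' J'] eq[OF G, of G' J'] d by simp
    then show "d' = d" by simp
  qed
  then show ?thesis
    using e(1) eq[OF G] d by auto
qed

lemma brouwer_degree_cong:
  assumes "\<And>x. x \<in> closure V \<Longrightarrow> F x = F' x"
  shows "brouwer_degree V F = brouwer_degree V F'"
  using assms unfolding brouwer_degree_altdef regular_approx_def by (simp cong: ball_cong)

lemma regular_approx_mono:
  assumes "regular_approx V F e G J" "e \<le> e'"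
  shows "regular_approx V F e' G J"
  using assms unfolding regular_approx_def by force

text \<open>A single approximation computes all these degrees; it is so close that it has no zero in
  \<open>closure V\<close> off the sets \<open>W i\<close>. A one-element family gives excision, the
  empty family degree 0.\<close>

lemma brouwer_degree_additive:
  fixes F :: "real ^ 'n \<Rightarrow> real ^ 'n"
  assumes I: "finite I" and V: "open V" "bounded V" and F: "continuous_on (closure V) F"
    and W: "\<And>i. i \<in> I \<Longrightarrow> open (W i)" "\<And>i. i \<in> I \<Longrightarrow> W i \<subseteq> V"
    and disj: "\<And>i j. i \<in> I \<Longrightarrow> j \<in> I \<Longrightarrow> i \<noteq> j \<Longrightarrow> W i \<inter> W j = {}"
    and nz: "\<And>x. x \<in> closure V \<Longrightarrow> x \<notin> (\<Union>i\<in>I. W i) \<Longrightarrow> F x \<noteq> 0"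
  shows "brouwer_degree V F = (\<Sum>i\<in>I. brouwer_degree (W i) F)"
proof -
  have clV: "compact (closure V)" using V(2) by (simp add: compact_closure)
  have clW: "closure (W i) \<subseteq> closure V" if "i \<in> I" for i using W(2)[OF that] by (rule closure_mono)
  have frV: "F x \<noteq> 0" if "x \<in> frontier V" for x
    using that nz[of x] W(2) V(1) by (auto simp: frontier_def interior_open)
  have frW: "F x \<noteq> 0" if i: "i \<in> I" and x: "x \<in> frontier (W i)" for i x
  proof (rule nz)
    have x': "x \<in> closure (W i)" "x \<notin> W i" using x W(1)[OF i] by (auto simp: frontier_def interior_open)
    show "x \<in> closure V" using x'(1) clW[OF i] by blast
    show "x \<notin> (\<Union>i\<in>I. W i)"
    proof
      assume "x \<in> (\<Union>i\<in>I. W i)"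
      then obtain j where j: "j \<in> I" "x \<in> W j" by auto
      then have "i \<noteq> j" using x'(2) by blast
      then have "W j \<inter> W i = {}" using disj[OF i j(1)] by blast
      then have "W j \<inter> closure (W i) = {}" using open_Int_closure_eq_empty[OF W(1)[OF j(1)]] by blast
      then show False using j(2) x'(1) by blast
    qed
  qed
  have "compact (closure V - (\<Union>i\<in>I. W i))" by (intro compact_diff clV open_UN ballI W(1))
  then obtain m where m: "m > 0" "\<And>x. x \<in> closure V - (\<Union>i\<in>I. W i) \<Longrightarrow> m \<le> norm (F x)"
    using compact_norm_bound_below[of "closure V - (\<Union>i\<in>I. W i)" F] continuous_on_subset[OF F] nz
    by (metis Diff_iff Diff_subset)
  have "\<exists>e>0. \<forall>i\<in>I. \<forall>G J. regular_approx (W i) F e G J \<longrightarrow>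
      real_of_int (brouwer_degree (W i) F) = (\<Sum>x | x \<in> W i \<and> G x = 0. sgn (det (J x)))"
  proof (rule finite_common_radius[OF I])
    fix i assume i: "i \<in> I"
    obtain e where e: "e > 0" "\<And>G J. regular_approx (W i) F e G J \<Longrightarrow>
      real_of_int (brouwer_degree (W i) F) = (\<Sum>x | x \<in> W i \<and> G x = 0. sgn (det (J x)))"
      using brouwer_degree_count[OF W(1)[OF i] bounded_subset[OF V(2) W(2)[OF i]]
        continuous_on_subset[OF F clW[OF i]] frW[OF i]] by blast
    show "\<exists>e>0. \<forall>e'. 0 < e' \<and> e' \<le> e \<longrightarrow> (\<forall>G J. regular_approx (W i) F e' G J \<longrightarrow>
      real_of_int (brouwer_degree (W i) F) = (\<Sum>x | x \<in> W i \<and> G x = 0. sgn (det (J x))))"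
      using e regular_approx_mono by blast
  qed
  then obtain e1 where e1: "e1 > 0" "\<And>i G J. i \<in> I \<Longrightarrow> regular_approx (W i) F e1 G J \<Longrightarrow>
      real_of_int (brouwer_degree (W i) F) = (\<Sum>x | x \<in> W i \<and> G x = 0. sgn (det (J x)))"
    by blast
  obtain e2 where e2: "e2 > 0" "\<And>G J. regular_approx V F e2 G J \<Longrightarrow>
      real_of_int (brouwer_degree V F) = (\<Sum>x | x \<in> V \<and> G x = 0. sgn (det (J x)))"
    using brouwer_degree_count[OF V F frV] by blast
  define e where "e = min m (min e1 e2)"
  have e: "e > 0" "e \<le> m" "e \<le> e1" "e \<le> e2" using m(1) e1(1) e2(1) by (auto simp: e_def)
  obtain G J where G: "c1_map G J" "\<And>x. x \<in> closure V \<Longrightarrow> norm (G x - F x) < e"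
      "\<And>x. G x = 0 \<Longrightarrow> det (J x) \<noteq> 0"
    using regular_approximation[OF clV F e(1)] by blast
  have GV: "regular_approx V F e2 G J"
    using G e(4) by (force simp: regular_approx_def)
  have GW: "regular_approx (W i) F e1 G J" if "i \<in> I" for i
    using G e(3) clW[OF that] by (force simp: regular_approx_def)
  have Gnz: "G x \<noteq> 0" if "x \<in> closure V" "x \<notin> (\<Union>i\<in>I. W i)" for x
    using m(2)[of x] G(2)[of x] that e(2) by force
  have "finite {x \<in> V. G x = 0}"
  proof (rule finite_regular_zeros[OF G(1) V])
    show "G x \<noteq> 0" if "x \<in> frontier V" for x
      using that W(2) V(1) by (intro Gnz) (auto simp: frontier_def interior_open)
  qed (rule G(3))
  then have fin: "finite {x. x \<in> W i \<and> G x = 0}" if "i \<in> I" for i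
    by (rule rev_finite_subset) (use W(2)[OF that] in auto)
  have "{x. x \<in> V \<and> G x = 0} = (\<Union>i\<in>I. {x. x \<in> W i \<and> G x = 0})"
  proof (intro equalityI subsetI)
    fix x assume "x \<in> {x. x \<in> V \<and> G x = 0}"
    then show "x \<in> (\<Union>i\<in>I. {x. x \<in> W i \<and> G x = 0})"
      using Gnz[of x] closure_subset[of V] by auto
  next
    fix x assume "x \<in> (\<Union>i\<in>I. {x. x \<in> W i \<and> G x = 0})"
    then show "x \<in> {x. x \<in> V \<and> G x = 0}" using W(2) by auto
  qed
  then have "(\<Sum>x | x \<in> V \<and> G x = 0. sgn (det (J x))) = (\<Sum>i\<in>I. \<Sum>x | x \<in> W i \<and> G x = 0. sgn (det (J x)))"
    using sum.UNION_disjoint[of I "\<lambda>i. {x. x \<in> W i \<and> G x = 0}" "\<lambda>x. sgn (det (J x))"] I fin disj by (simp add: disjoint_iff)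
  also have "\<dots> = real_of_int (\<Sum>i\<in>I. brouwer_degree (W i) F)"
    using e1(2)[OF _ GW] by simp
  finally show ?thesis using e2(2)[OF GV] by (simp only: of_int_eq_iff)
qed

section \<open>Product maps and the multiplicativity of the degree\<close>

definition join_vec :: "real ^ 'a::finite \<Rightarrow> real ^ 'b::finite \<Rightarrow> real ^ ('a::finite + 'b::finite)" where
  "join_vec x y = (\<chi> i. case i of Inl a \<Rightarrow> x $ a | Inr b \<Rightarrow> y $ b)"

definition fst_vec :: "real ^ ('a::finite + 'b::finite) \<Rightarrow> real ^ 'a::finite" where
  "fst_vec z = (\<chi> a. z $ Inl a)"

definition snd_vec :: "real ^ ('a::finite + 'b::finite) \<Rightarrow> real ^ 'b::finite" where
  "snd_vec z = (\<chi> b. z $ Inr b)"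

lemma vec_eq_sum_iff: "(z :: real ^ ('a::finite + 'b::finite)) = z' \<longleftrightarrow> fst_vec z = fst_vec z' \<and> snd_vec z = snd_vec z'"
  by (auto simp: vec_eq_iff fst_vec_def snd_vec_def) (metis sum.exhaust)

lemma fst_join_vec [simp]: "fst_vec (join_vec x y) = x" and snd_join_vec [simp]: "snd_vec (join_vec x y) = y"
  by (simp_all add: fst_vec_def snd_vec_def join_vec_def vec_eq_iff)

lemma join_fst_snd_vec [simp]: "join_vec (fst_vec z) (snd_vec z) = z"
  by (simp add: vec_eq_sum_iff)

lemma fst_vec_linear [simp]: "fst_vec (x - y) = fst_vec x - fst_vec y" "fst_vec 0 = 0"
  and snd_vec_linear [simp]: "snd_vec (x - y) = snd_vec x - snd_vec y" "snd_vec 0 = 0"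
  by (simp_all add: fst_vec_def snd_vec_def vec_eq_iff)

lemma bounded_linear_fst_vec: "bounded_linear fst_vec" and bounded_linear_snd_vec: "bounded_linear snd_vec"
  by (intro linear_conv_bounded_linear[THEN iffD1] linearI;
      simp add: fst_vec_def snd_vec_def vec_eq_iff)+

lemma bounded_linear_join_vec: "bounded_linear (\<lambda>p. join_vec (fst p) (snd p))"
  by (intro linear_conv_bounded_linear[THEN iffD1] linearI)
     (simp_all add: vec_eq_sum_iff, simp_all add: join_vec_def fst_vec_def snd_vec_def vec_eq_iff)

lemmas continuous_on_fst_vec [continuous_intros] = bounded_linear.continuous_on[OF bounded_linear_fst_vec]
lemmas continuous_on_snd_vec [continuous_intros] = bounded_linear.continuous_on[OF bounded_linear_snd_vec]

lemma continuous_on_join_vec [continuous_intros]: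
  assumes "continuous_on S f" "continuous_on S g"
  shows "continuous_on S (\<lambda>x. join_vec (f x) (g x))"
  using bounded_linear.continuous_on[OF bounded_linear_join_vec continuous_on_Pair[OF assms]] by simp

lemma norm_join_vec_le: "norm (join_vec x y) \<le> norm x + norm y"
proof -
  have "(norm (join_vec x y))\<^sup>2 = (norm x)\<^sup>2 + (norm y)\<^sup>2"
    by (simp add: power2_norm_eq_inner inner_vec_def sum_UNIV_sum join_vec_def)
  also have "\<dots> \<le> (norm x + norm y)\<^sup>2" by (simp add: power2_sum)
  finally show ?thesis by (rule power2_le_imp_le) simp
qed

lemma c1_map_join:
  fixes G1 :: "real ^ 'a \<Rightarrow> real ^ 'a" and G2 :: "real ^ 'b \<Rightarrow> real ^ 'b"
  assumes "c1_map G1 J1" "c1_map G2 J2"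
  shows "c1_map (\<lambda>z. join_vec (G1 (fst_vec z)) (G2 (snd_vec z)))
    (\<lambda>z. block_matrix (J1 (fst_vec z)) 0 0 (J2 (snd_vec z)))"
  unfolding c1_map_def
proof (intro conjI allI)
  fix z :: "real ^ ('a + 'b)"
  have "((\<lambda>z. G1 (fst_vec z)) has_derivative (\<lambda>v. J1 (fst_vec z) *v fst_vec v)) (at z)"
    by (rule has_derivative_compose[OF bounded_linear_imp_has_derivative[OF bounded_linear_fst_vec]
          c1_mapD(1)[OF assms(1)]])
  moreover have "((\<lambda>z. G2 (snd_vec z)) has_derivative (\<lambda>v. J2 (snd_vec z) *v snd_vec v)) (at z)"
    by (rule has_derivative_compose[OF bounded_linear_imp_has_derivative[OF bounded_linear_snd_vec]
          c1_mapD(1)[OF assms(2)]])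
  ultimately have "((\<lambda>z. join_vec (G1 (fst_vec z)) (G2 (snd_vec z))) has_derivative
      (\<lambda>v. join_vec (J1 (fst_vec z) *v fst_vec v) (J2 (snd_vec z) *v snd_vec v))) (at z)"
    using bounded_linear.has_derivative[OF bounded_linear_join_vec has_derivative_Pair] by fastforce
  moreover have "join_vec (A *v fst_vec v) (B *v snd_vec v) = block_matrix A 0 0 B *v v"
    for A :: "real ^ 'a ^ 'a" and B :: "real ^ 'b ^ 'b" and v
    by (simp add: vec_eq_sum_iff)
       (simp add: vec_eq_iff fst_vec_def snd_vec_def matrix_vector_mult_def sum_UNIV_sum)
  ultimately show "((\<lambda>z. join_vec (G1 (fst_vec z)) (G2 (snd_vec z))) has_derivative
      (\<lambda>v. block_matrix (J1 (fst_vec z)) 0 0 (J2 (snd_vec z)) *v v)) (at z)"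
    by simp
next
  have J: "continuous_on UNIV (\<lambda>z. J1 (fst_vec z))" "continuous_on UNIV (\<lambda>z. J2 (snd_vec z))"
    by (intro continuous_on_compose2[OF c1_mapD(2)[OF assms(1), of UNIV]]
        continuous_on_compose2[OF c1_mapD(2)[OF assms(2), of UNIV]] continuous_intros; simp)+
  have "continuous_on UNIV (\<lambda>z. block_matrix (J1 (fst_vec z)) 0 0 (J2 (snd_vec z)) $ i $ j)" for i j
    by (cases i; cases j) (use J in \<open>auto intro!: continuous_intros\<close>)
  then have "continuous_on UNIV (\<lambda>z. \<chi> i j. block_matrix (J1 (fst_vec z)) 0 0 (J2 (snd_vec z)) $ i $ j)"
    by (intro continuous_on_vec_lambda)
  then show "continuous_on UNIV (\<lambda>z. block_matrix (J1 (fst_vec z)) 0 0 (J2 (snd_vec z)))"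
    by simp
qed

text \<open>The product lives in a space indexed by \<open>'a + 'b\<close>, not in a pair type,
  because the degree and the index are defined for spaces \<open>real ^ 'n\<close>.\<close>

definition prod_set :: "(real ^ 'a::finite) set \<Rightarrow> (real ^ 'b::finite) set \<Rightarrow> (real ^ ('a::finite + 'b::finite)) set" where
  "prod_set S T = {z. fst_vec z \<in> S \<and> snd_vec z \<in> T}"

lemma open_prod_set: "open S \<Longrightarrow> open T \<Longrightarrow> open (prod_set S T)"
  unfolding prod_set_def Collect_conj_eq vimage_def[symmetric]
  by (intro open_Int open_vimage continuous_intros)

lemma closed_prod_set: "closed S \<Longrightarrow> closed T \<Longrightarrow> closed (prod_set S T)"
  unfolding prod_set_def Collect_conj_eq vimage_def[symmetric]
  by (intro closed_Int closed_vimage continuous_intros)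

lemma bounded_prod_set:
  assumes "bounded S" "bounded T"
  shows "bounded (prod_set S T)"
proof -
  obtain a b where ab: "\<And>x. x \<in> S \<Longrightarrow> norm x \<le> a" "\<And>x. x \<in> T \<Longrightarrow> norm x \<le> b"
    using assms by (auto simp: bounded_iff)
  have "norm z \<le> a + b" if "z \<in> prod_set S T" for z
    using that ab norm_join_vec_le[of "fst_vec z" "snd_vec z"] by (force simp: prod_set_def)
  then show ?thesis by (auto simp: bounded_iff)
qed

lemma closure_prod_set_subset: "closure (prod_set S T) \<subseteq> prod_set (closure S) (closure T)"
  using closure_subset[of S] closure_subset[of T]
  by (intro closure_minimal closed_prod_set) (auto simp: prod_set_def)

text \<open>Regular approximations of the factors, each within \<open>e / 2\<close>, join to one of
  the product. Its zeros are pairs of zeros, and its block diagonal Jacobian multiplies the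
  signs.\<close>

lemma brouwer_degree_product:
  fixes F1 :: "real ^ 'a \<Rightarrow> real ^ 'a" and F2 :: "real ^ 'b \<Rightarrow> real ^ 'b"
  assumes V1: "open V1" "bounded V1" and F1: "continuous_on (closure V1) F1"
    and fr1: "\<And>x. x \<in> frontier V1 \<Longrightarrow> F1 x \<noteq> 0"
    and V2: "open V2" "bounded V2" and F2: "continuous_on (closure V2) F2"
    and fr2: "\<And>x. x \<in> frontier V2 \<Longrightarrow> F2 x \<noteq> 0"
  shows "brouwer_degree (prod_set V1 V2) (\<lambda>z. join_vec (F1 (fst_vec z)) (F2 (snd_vec z))) =
    brouwer_degree V1 F1 * brouwer_degree V2 F2"
proof -
  let ?F = "\<lambda>z. join_vec (F1 (fst_vec z)) (F2 (snd_vec z))"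
  have cl: "fst_vec z \<in> closure V1" "snd_vec z \<in> closure V2" if "z \<in> closure (prod_set V1 V2)" for z
    using that closure_prod_set_subset by (auto simp: prod_set_def)
  have join_0: "join_vec x y = 0 \<longleftrightarrow> x = 0 \<and> y = 0" for x :: "real ^ 'a" and y :: "real ^ 'b"
    by (simp add: vec_eq_sum_iff)
  have contF: "continuous_on (closure (prod_set V1 V2)) ?F"
    by (intro continuous_intros continuous_on_compose2[OF F1] continuous_on_compose2[OF F2]) (auto dest: cl)
  have fr: "?F z \<noteq> 0" if "z \<in> frontier (prod_set V1 V2)" for z
  proof -
    have "z \<in> closure (prod_set V1 V2)" "z \<notin> prod_set V1 V2"
      using that open_prod_set[OF V1(1) V2(1)] by (auto simp: frontier_def interior_open)
    then have "fst_vec z \<in> frontier V1 \<or> snd_vec z \<in> frontier V2"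
      using cl V1(1) V2(1) by (auto simp: frontier_def interior_open prod_set_def)
    then show ?thesis using fr1 fr2 by (auto simp: join_0)
  qed
  obtain e where e: "e > 0" "\<And>G J. regular_approx (prod_set V1 V2) ?F e G J \<Longrightarrow>
      real_of_int (brouwer_degree (prod_set V1 V2) ?F) = (\<Sum>x | x \<in> prod_set V1 V2 \<and> G x = 0. sgn (det (J x)))"
    using brouwer_degree_count[OF open_prod_set[OF V1(1) V2(1)] bounded_prod_set[OF V1(2) V2(2)] contF fr]
    by blast
  obtain e1 where e1: "e1 > 0" "\<And>G J. regular_approx V1 F1 e1 G J \<Longrightarrow>
      real_of_int (brouwer_degree V1 F1) = (\<Sum>x | x \<in> V1 \<and> G x = 0. sgn (det (J x)))"
    using brouwer_degree_count[OF V1 F1 fr1] by blast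
  obtain e2 where e2: "e2 > 0" "\<And>G J. regular_approx V2 F2 e2 G J \<Longrightarrow>
      real_of_int (brouwer_degree V2 F2) = (\<Sum>x | x \<in> V2 \<and> G x = 0. sgn (det (J x)))"
    using brouwer_degree_count[OF V2 F2 fr2] by blast
  obtain G1 J1 where G1: "c1_map G1 J1" "\<And>x. x \<in> closure V1 \<Longrightarrow> norm (G1 x - F1 x) < min e1 (e / 2)"
      "\<And>x. G1 x = 0 \<Longrightarrow> det (J1 x) \<noteq> 0"
    using regular_approximation[of "closure V1" F1 "min e1 (e / 2)"] F1 V1(2) e(1) e1(1)
    by (auto simp: compact_closure)
  obtain G2 J2 where G2: "c1_map G2 J2" "\<And>x. x \<in> closure V2 \<Longrightarrow> norm (G2 x - F2 x) < min e2 (e / 2)"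
      "\<And>x. G2 x = 0 \<Longrightarrow> det (J2 x) \<noteq> 0"
    using regular_approximation[of "closure V2" F2 "min e2 (e / 2)"] F2 V2(2) e(1) e2(1)
    by (auto simp: compact_closure)
  let ?G = "\<lambda>z. join_vec (G1 (fst_vec z)) (G2 (snd_vec z))"
  let ?J = "\<lambda>z. block_matrix (J1 (fst_vec z)) 0 0 (J2 (snd_vec z))"
  have app: "regular_approx (prod_set V1 V2) ?F e ?G ?J"
    unfolding regular_approx_def
  proof (intro conjI ballI impI)
    show "c1_map ?G ?J" by (rule c1_map_join[OF G1(1) G2(1)])
    fix z
    show "norm (?G z - ?F z) < e" if "z \<in> closure (prod_set V1 V2)"
    proof -
      have *: "?G z - ?F z = join_vec (G1 (fst_vec z) - F1 (fst_vec z)) (G2 (snd_vec z) - F2 (snd_vec z))"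
        by (simp add: vec_eq_sum_iff)
      show ?thesis
        using G1(2)[OF cl(1)[OF that]] G2(2)[OF cl(2)[OF that]]
          norm_join_vec_le[of "G1 (fst_vec z) - F1 (fst_vec z)" "G2 (snd_vec z) - F2 (snd_vec z)"]
        unfolding * by linarith
    qed
    show "det (?J z) \<noteq> 0" if "?G z = 0"
      using that G1(3) G2(3) by (simp add: join_0 det_block_upper)
  qed
  have app1: "regular_approx V1 F1 e1 G1 J1" and app2: "regular_approx V2 F2 e2 G2 J2"
    using G1 G2 by (auto simp: regular_approx_def)
  have "(\<Sum>z | z \<in> prod_set V1 V2 \<and> ?G z = 0. sgn (det (?J z))) =
      (\<Sum>(x, y) \<in> {x. x \<in> V1 \<and> G1 x = 0} \<times> {y. y \<in> V2 \<and> G2 y = 0}. sgn (det (J1 x)) * sgn (det (J2 y)))"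
    by (rule sum.reindex_bij_witness[of _ "\<lambda>(x, y). join_vec x y" "\<lambda>z. (fst_vec z, snd_vec z)"])
       (auto simp: prod_set_def join_0 det_block_upper sgn_mult)
  also have "\<dots> = (\<Sum>x | x \<in> V1 \<and> G1 x = 0. sgn (det (J1 x))) * (\<Sum>y | y \<in> V2 \<and> G2 y = 0. sgn (det (J2 y)))"
    by (simp add: sum_product sum.cartesian_product)
  finally have "real_of_int (brouwer_degree (prod_set V1 V2) ?F) =
      real_of_int (brouwer_degree V1 F1) * real_of_int (brouwer_degree V2 F2)"
    using e(2)[OF app] e1(2)[OF app1] e2(2)[OF app2] by simp
  then show ?thesis by (simp flip: of_int_mult)
qed

section \<open>Commutation: the degrees of id - b o a and id - a o b\<close>

lemma c1_map_compose:
  assumes G: "c1_map G J" and H: "c1_map H K"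
  shows "c1_map (\<lambda>x. G (H x)) (\<lambda>x. J (H x) ** K x)"
  unfolding c1_map_def
proof (intro conjI allI)
  fix x
  show "((\<lambda>x. G (H x)) has_derivative (\<lambda>v. (J (H x) ** K x) *v v)) (at x)"
    using has_derivative_compose[OF c1_mapD(1)[OF H, of x] c1_mapD(1)[OF G]]
    by (simp add: matrix_vector_mul_assoc)
  have "continuous_on UNIV (\<lambda>x. J (H x))"
    by (intro continuous_on_compose2[OF c1_mapD(2)[OF G, of UNIV] c1_mapD(3)[OF H]]) simp
  then show "continuous_on UNIV (\<lambda>x. J (H x) ** K x)"
    unfolding matrix_matrix_mult_def
    by (intro continuous_on_vec_lambda continuous_intros c1_mapD(2)[OF H])
qed

lemma c1_map_id_minus:
  assumes "c1_map G J"
  shows "c1_map (\<lambda>x. x - G x) (\<lambda>x. mat 1 - J x)"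
  using c1_mapD[OF assms]
  by (auto simp: c1_map_def matrix_vector_mult_diff_rdistrib intro!: derivative_intros continuous_intros)

text \<open>Stability of fixed points when both factors are perturbed. By compactness, an almost
  fixed point of \<open>b \<circ> a\<close> is near the fixed point set, around which
  \<open>V\<close> and the preimage of \<open>V'\<close> leave room.\<close>

lemma fixed_point_perturbation:
  fixes a :: "real ^ 'n \<Rightarrow> real ^ 'm" and b :: "real ^ 'm \<Rightarrow> real ^ 'n"
  assumes ca: "continuous_on UNIV a" and cb: "continuous_on UNIV b"
    and V: "open V" "bounded V" and V': "open V'"
    and fp: "\<And>x. x \<in> closure V \<Longrightarrow> b (a x) = x \<Longrightarrow> x \<in> V \<and> a x \<in> V'"
    and R: "\<And>x. x \<in> closure V \<Longrightarrow> norm (a x) + 1 \<le> R" and e: "e > 0"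
  obtains d where "d > 0"
    "\<And>a' b' x. (\<And>x. x \<in> closure V \<Longrightarrow> norm (a' x - a x) < d) \<Longrightarrow>
      (\<And>y. y \<in> cball 0 R \<Longrightarrow> norm (b' y - b y) < d) \<Longrightarrow> x \<in> closure V \<Longrightarrow>
      norm (b' (a' x) - b (a x)) < e \<and> (b' (a' x) = x \<longrightarrow> x \<in> V \<and> a' x \<in> V')"
proof -
  define K where "K = {x \<in> closure V. x - b (a x) = 0}"
  have cab: "continuous_on S (\<lambda>x. x - b (a x))" for S
    by (intro continuous_intros continuous_on_compose2[OF cb] continuous_on_subset[OF ca]) auto
  have clV: "compact (closure V)" using V(2) by (simp add: compact_closure)
  have "closed K" unfolding K_def by (intro continuous_closed_preimage_constant cab) auto
  then have "compact (closure V \<inter> K)" using clV by (rule compact_Int_closed[OF _ , rotated])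
  moreover have "closure V \<inter> K = K" by (auto simp: K_def)
  ultimately have K: "compact K" by simp
  have "compact (a ` K)" by (intro compact_continuous_image continuous_on_subset[OF ca] K) auto
  moreover have "closed (- V')" using V' by (simp add: closed_Compl)
  moreover have "a ` K \<inter> - V' = {}" using fp by (auto simp: K_def)
  ultimately obtain d1 where d1: "d1 > 0" "\<And>y z. y \<in> a ` K \<Longrightarrow> z \<in> - V' \<Longrightarrow> d1 \<le> dist y z"
    using separate_compact_closed[of "a ` K" "- V'"] by blast
  \<comment> \<open>A neighbourhood of the fixed points on which \<open>a\<close> stays within
    \<open>d1 / 2\<close> of the image of \<open>K\<close>; off it the displacement is bounded below
    by some \<open>m\<close>.\<close>
  define O' where "O' = V \<inter> (\<Union>z\<in>K. a -` ball (a z) (d1 / 2))"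
  have "open O'" unfolding O'_def by (intro open_Int V(1) open_UN ballI open_vimage ca open_ball)
  then have "compact (closure V - O')" by (rule compact_diff[OF clV])
  moreover have "K \<subseteq> O'" using fp d1(1) by (auto simp: O'_def K_def)
  then have "x - b (a x) \<noteq> 0" if "x \<in> closure V - O'" for x using that by (auto simp: K_def)
  ultimately obtain m where m: "m > 0" "\<And>x. x \<in> closure V - O' \<Longrightarrow> m \<le> norm (x - b (a x))"
    using compact_norm_bound_below[OF _ cab, of "closure V - O'"] by metis
  define e' where "e' = min e m / 2"
  have e': "e' > 0" using e m by (simp add: e'_def)
  have "uniformly_continuous_on (cball 0 R) b"
    by (intro compact_uniformly_continuous continuous_on_subset[OF cb]) auto
  then obtain \<eta> where \<eta>: "\<eta> > 0" "\<And>y y'. y \<in> cball 0 R \<Longrightarrow> y' \<in> cball 0 R \<Longrightarrow> dist y' y < \<eta> \<Longrightarrow> dist (b y') (b y) < e'"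
    using e' unfolding uniformly_continuous_on_def by meson
  \<comment> \<open>The bound 1 keeps \<open>a' x\<close> in \<open>cball 0 R\<close>, where
    \<open>b\<close> is uniformly continuous; \<open>\<eta>\<close> and \<open>e'\<close> each
    answer for half of the error \<open>min e m\<close> of the composite; \<open>d1 / 2\<close>
    keeps \<open>a' x\<close> in \<open>V'\<close>.\<close>
  define d where "d = Min {1, \<eta>, e', d1 / 2}"
  have d: "d > 0" "d \<le> 1" "d \<le> \<eta>" "d \<le> e'" "d \<le> d1 / 2"
    using \<eta>(1) e' d1(1) by (auto simp: d_def)
  show ?thesis
  proof (rule that[OF d(1)])
    fix a' b' x
    assume a': "\<And>x. x \<in> closure V \<Longrightarrow> norm (a' x - a x) < d"
      and b': "\<And>y. y \<in> cball 0 R \<Longrightarrow> norm (b' y - b y) < d" and x: "x \<in> closure V"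
    have in_cball: "a x \<in> cball 0 R" "a' x \<in> cball 0 R"
      using R[OF x] a'[OF x] d(2) norm_triangle_ineq[of "a' x - a x" "a x"] by auto
    have "dist (b (a' x)) (b (a x)) < e'"
      using \<eta>(2)[OF in_cball] a'[OF x] d(3) by (simp add: dist_norm)
    moreover have "norm (b' (a' x) - b (a' x)) < e'" using b'[OF in_cball(2)] d(4) by simp
    moreover have "norm (b' (a' x) - b (a x)) \<le> norm (b' (a' x) - b (a' x)) + norm (b (a' x) - b (a x))"
      using norm_triangle_ineq[of "b' (a' x) - b (a' x)" "b (a' x) - b (a x)"] by simp
    ultimately have less: "norm (b' (a' x) - b (a x)) < min e m" by (simp add: dist_norm e'_def)
    moreover have "x \<in> V \<and> a' x \<in> V'" if "b' (a' x) = x"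
    proof -
      have "x \<in> O'" using m(2)[of x] x less that by force
      then obtain z where z: "x \<in> V" "z \<in> K" "dist (a z) (a x) < d1 / 2" by (auto simp: O'_def)
      have "dist (a z) (a' x) \<le> dist (a z) (a x) + dist (a x) (a' x)" by (rule dist_triangle)
      also have "\<dots> < d1 / 2 + d1 / 2"
        using z(3) a'[OF x] d(5) by (simp add: dist_norm norm_minus_commute)
      finally have "dist (a z) (a' x) < d1" by simp
      then show ?thesis using d1(2)[of "a z" "a' x"] z(1,2) by force
    qed
    ultimately show "norm (b' (a' x) - b (a x)) < e \<and> (b' (a' x) = x \<longrightarrow> x \<in> V \<and> a' x \<in> V')" by simp
  qed
qed

text \<open>\<open>a\<close> and \<open>b\<close> restrict to mutually inverse bijections between
  the fixed points of \<open>b \<circ> a\<close> and those of \<open>a \<circ> b\<close>. After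
  passage to polynomials these match the zeros that are counted, and \<open>Sylvester_det\<close>
  matches their signs.\<close>

lemma degree_commute_global:
  fixes a :: "real ^ 'n \<Rightarrow> real ^ 'm" and b :: "real ^ 'm \<Rightarrow> real ^ 'n"
  assumes ca: "continuous_on UNIV a" and cb: "continuous_on UNIV b"
    and V: "open V" "bounded V" and V': "open V'" "bounded V'"
    and fp: "\<And>x. x \<in> closure V \<Longrightarrow> b (a x) = x \<Longrightarrow> x \<in> V \<and> a x \<in> V'"
    and fp': "\<And>y. y \<in> closure V' \<Longrightarrow> a (b y) = y \<Longrightarrow> y \<in> V' \<and> b y \<in> V"
  shows "brouwer_degree V (\<lambda>x. x - b (a x)) = brouwer_degree V' (\<lambda>y. y - a (b y))"
proof -
  have cab: "continuous_on S (\<lambda>x. x - b (a x))" for S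
    by (intro continuous_intros continuous_on_compose2[OF cb] continuous_on_subset[OF ca]) auto
  have cba: "continuous_on S (\<lambda>x. x - a (b x))" for S
    by (intro continuous_intros continuous_on_compose2[OF ca] continuous_on_subset[OF cb]) auto
  have fr: "x - b (a x) \<noteq> 0" if "x \<in> frontier V" for x
    using fp[of x] that V(1) by (auto simp: frontier_def interior_open)
  have fr': "y - a (b y) \<noteq> 0" if "y \<in> frontier V'" for y
    using fp'[of y] that V'(1) by (auto simp: frontier_def interior_open)
  obtain e1 where e1: "e1 > 0" "\<And>G J. regular_approx V (\<lambda>x. x - b (a x)) e1 G J \<Longrightarrow>
      real_of_int (brouwer_degree V (\<lambda>x. x - b (a x))) = (\<Sum>x | x \<in> V \<and> G x = 0. sgn (det (J x)))"
    using brouwer_degree_count[OF V cab fr] by blast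
  obtain e2 where e2: "e2 > 0" "\<And>G J. regular_approx V' (\<lambda>y. y - a (b y)) e2 G J \<Longrightarrow>
      real_of_int (brouwer_degree V' (\<lambda>y. y - a (b y))) = (\<Sum>x | x \<in> V' \<and> G x = 0. sgn (det (J x)))"
    using brouwer_degree_count[OF V' cba fr'] by blast
  have comp: "compact (closure V)" "compact (closure V')" using V V' by (simp_all add: compact_closure)
  have "bounded (a ` closure V \<union> closure V')" "bounded (b ` closure V' \<union> closure V)"
    using comp by (auto intro!: compact_imp_bounded compact_continuous_image
        continuous_on_subset[OF ca] continuous_on_subset[OF cb] simp: bounded_Un)
  then obtain R2' R1' where R': "\<And>y. y \<in> a ` closure V \<union> closure V' \<Longrightarrow> norm y \<le> R2'"
      "\<And>x. x \<in> b ` closure V' \<union> closure V \<Longrightarrow> norm x \<le> R1'"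
    unfolding bounded_iff by blast
  define R1 where "R1 = R1' + 1"
  define R2 where "R2 = R2' + 1"
  have R: "\<And>x. x \<in> closure V \<Longrightarrow> norm (a x) + 1 \<le> R2" "\<And>y. y \<in> closure V' \<Longrightarrow> norm (b y) + 1 \<le> R1"
      "closure V \<subseteq> cball 0 R1" "closure V' \<subseteq> cball 0 R2"
    using R' by (force simp: R1_def R2_def)+
  obtain d1 where d1: "d1 > 0"
    "\<And>a' b' x. (\<And>x. x \<in> closure V \<Longrightarrow> norm (a' x - a x) < d1) \<Longrightarrow>
      (\<And>y. y \<in> cball 0 R2 \<Longrightarrow> norm (b' y - b y) < d1) \<Longrightarrow> x \<in> closure V \<Longrightarrow>
      norm (b' (a' x) - b (a x)) < e1 \<and> (b' (a' x) = x \<longrightarrow> x \<in> V \<and> a' x \<in> V')"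
    using fixed_point_perturbation[OF ca cb V V'(1) fp R(1) e1(1)] by blast
  obtain d2 where d2: "d2 > 0"
    "\<And>b' a' y. (\<And>y. y \<in> closure V' \<Longrightarrow> norm (b' y - b y) < d2) \<Longrightarrow>
      (\<And>x. x \<in> cball 0 R1 \<Longrightarrow> norm (a' x - a x) < d2) \<Longrightarrow> y \<in> closure V' \<Longrightarrow>
      norm (a' (b' y) - a (b y)) < e2 \<and> (a' (b' y) = y \<longrightarrow> y \<in> V' \<and> b' y \<in> V)"
    using fixed_point_perturbation[OF cb ca V' V(1) fp' R(2) e2(1)] by blast
  define d where "d = min d1 d2"
  have d: "d > 0" using d1(1) d2(1) by (simp add: d_def)
  obtain p where p: "polynomial_function p" "\<And>x. x \<in> cball 0 R1 \<Longrightarrow> norm (a x - p x) < d"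
    using Stone_Weierstrass_polynomial_function[OF compact_cball continuous_on_subset[OF ca] d]
    by (metis subset_UNIV)
  \<comment> \<open>Within \<open>d / 2\<close> only, to leave room for the shift by a regular
    value.\<close>
  obtain q where q: "polynomial_function q" "\<And>y. y \<in> cball 0 R2 \<Longrightarrow> norm (b y - q y) < d / 2"
    using Stone_Weierstrass_polynomial_function[OF compact_cball continuous_on_subset[OF cb], where e = "d / 2"] d
    by (metis subset_UNIV half_gt_zero)
  obtain Jp where Jp: "c1_map p Jp" using polynomial_function_c1[OF p(1)] .
  obtain Jq where Jq: "c1_map q Jq" using polynomial_function_c1[OF q(1)] .
  define J where "J x = mat 1 - Jq (p x) ** Jp x" for x
  obtain c where c: "norm c < d / 2" "\<And>x. x - q (p x) = c \<Longrightarrow> det (J x) \<noteq> 0"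
    using regular_value[OF c1_map_id_minus[OF c1_map_compose[OF Jq Jp]], where e = "d / 2"] d
    by (auto simp: J_def)
  \<comment> \<open>The regular value is absorbed into \<open>q\<close>: the equation
    \<open>q' (p x) = x\<close> says \<open>x - q (p x) = c\<close>. Regularity of the other
    composite then follows from \<open>Sylvester_det\<close>, so both counts use the same pair
    \<open>p\<close>, \<open>q'\<close>.\<close>
  define q' where "q' y = q y - (- c)" for y
  have Jq': "c1_map q' Jq" unfolding q'_def by (rule c1_map_diff_const[OF Jq])
  define J' where "J' y = mat 1 - Jp (q' y) ** Jq y" for y
  have pa: "norm (p x - a x) < d" if "x \<in> cball 0 R1" for x
    using p(2)[OF that] by (simp add: norm_minus_commute)
  have qb: "norm (q' y - b y) < d" if "y \<in> cball 0 R2" for y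
  proof -
    have *: "q' y - b y = c - (b y - q y)" by (simp add: q'_def)
    show ?thesis using q(2)[OF that] c(1) norm_triangle_ineq4[of c "b y - q y"] unfolding * by linarith
  qed
  have near: "norm (q' (p x) - b (a x)) < e1 \<and> (q' (p x) = x \<longrightarrow> x \<in> V \<and> p x \<in> V')" if "x \<in> closure V" for x
  proof (rule d1(2)[OF _ _ that])
    show "norm (p x - a x) < d1" if "x \<in> closure V" for x using pa[of x] that R(3) by (force simp: d_def)
    show "norm (q' y - b y) < d1" if "y \<in> cball 0 R2" for y using qb[OF that] by (simp add: d_def)
  qed
  have near': "norm (p (q' y) - a (b y)) < e2 \<and> (p (q' y) = y \<longrightarrow> y \<in> V' \<and> q' y \<in> V)" if "y \<in> closure V'" for y
  proof (rule d2(2)[OF _ _ that])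
    show "norm (q' y - b y) < d2" if "y \<in> closure V'" for y using qb[of y] that R(4) by (force simp: d_def)
    show "norm (p x - a x) < d2" if "x \<in> cball 0 R1" for x using pa[OF that] by (simp add: d_def)
  qed
  have reg: "det (J x) \<noteq> 0" if "q' (p x) = x" for x
    using c(2)[of x] that by (simp add: q'_def algebra_simps)
  have JJ': "det (J' (p x)) = det (J x)" if "q' (p x) = x" for x
    unfolding J_def J'_def that by (rule Sylvester_det[symmetric])
  have "regular_approx V (\<lambda>x. x - b (a x)) e1 (\<lambda>x. x - q' (p x)) J"
    unfolding regular_approx_def
  proof (intro conjI ballI impI)
    show "c1_map (\<lambda>x. x - q' (p x)) J"
      unfolding J_def by (rule c1_map_id_minus[OF c1_map_compose[OF Jq' Jp]])
    fix x
    show "norm (x - q' (p x) - (x - b (a x))) < e1" if "x \<in> closure V"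
      using near[OF that] by (simp add: norm_minus_commute)
    show "det (J x) \<noteq> 0" if "x - q' (p x) = 0" using reg[of x] that by simp
  qed
  then have deg: "real_of_int (brouwer_degree V (\<lambda>x. x - b (a x))) =
      (\<Sum>x | x \<in> V \<and> x - q' (p x) = 0. sgn (det (J x)))"
    by (rule e1(2))
  have "regular_approx V' (\<lambda>y. y - a (b y)) e2 (\<lambda>y. y - p (q' y)) J'"
    unfolding regular_approx_def
  proof (intro conjI ballI impI)
    show "c1_map (\<lambda>y. y - p (q' y)) J'"
      unfolding J'_def by (rule c1_map_id_minus[OF c1_map_compose[OF Jp Jq']])
    fix y
    show "norm (y - p (q' y) - (y - a (b y))) < e2" if "y \<in> closure V'"
      using near'[OF that] by (simp add: norm_minus_commute)
    show "det (J' y) \<noteq> 0" if "y - p (q' y) = 0"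
    proof -
      have y: "p (q' y) = y" using that by simp
      then have "q' (p (q' y)) = q' y" by simp
      then show ?thesis using reg JJ' y by metis
    qed
  qed
  then have deg': "real_of_int (brouwer_degree V' (\<lambda>y. y - a (b y))) =
      (\<Sum>y | y \<in> V' \<and> y - p (q' y) = 0. sgn (det (J' y)))"
    by (rule e2(2))
  have "(\<Sum>x | x \<in> V \<and> x - q' (p x) = 0. sgn (det (J x))) =
      (\<Sum>y | y \<in> V' \<and> y - p (q' y) = 0. sgn (det (J' y)))"
  proof (rule sum.reindex_bij_witness[of _ q' p])
    fix x assume "x \<in> {x \<in> V. x - q' (p x) = 0}"
    then have x: "x \<in> V" "q' (p x) = x" by auto
    then show "q' (p x) = x" by simp
    show "p x \<in> {y \<in> V'. y - p (q' y) = 0}" using near[of x] closure_subset[of V] x by auto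
    show "sgn (det (J' (p x))) = sgn (det (J x))" by (simp add: JJ'[OF x(2)])
  next
    fix y assume "y \<in> {y \<in> V'. y - p (q' y) = 0}"
    then have y: "y \<in> V'" "p (q' y) = y" by auto
    then show "p (q' y) = y" by simp
    show "q' y \<in> {x \<in> V. x - q' (p x) = 0}" using near'[of y] closure_subset[of V'] y by auto
  qed
  then show ?thesis using deg deg' by simp
qed

text \<open>Tietze extension reduces this to maps on the whole space: \<open>P\<close> and
  \<open>Q\<close> contain all points at which the composites on the two closures evaluate
  \<open>a\<close> and \<open>b\<close>.\<close>

lemma degree_commute:
  fixes a :: "real ^ 'n \<Rightarrow> real ^ 'm" and b :: "real ^ 'm \<Rightarrow> real ^ 'n"
  assumes P: "compact P" "continuous_on P a" and Q: "compact Q" "continuous_on Q b"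
    and V: "open V" "closure V \<subseteq> P" "a ` closure V \<subseteq> Q"
    and V': "open V'" "closure V' \<subseteq> Q" "b ` closure V' \<subseteq> P"
    and fp: "\<And>x. x \<in> closure V \<Longrightarrow> b (a x) = x \<Longrightarrow> x \<in> V \<and> a x \<in> V'"
    and fp': "\<And>y. y \<in> closure V' \<Longrightarrow> a (b y) = y \<Longrightarrow> y \<in> V' \<and> b y \<in> V"
  shows "brouwer_degree V (\<lambda>x. x - b (a x)) = brouwer_degree V' (\<lambda>y. y - a (b y))"
proof -
  obtain a' where a': "continuous_on UNIV a'" "\<And>x. x \<in> P \<Longrightarrow> a' x = a x"
    using Tietze_unbounded[OF P(2), of UNIV] compact_imp_closed[OF P(1)] by auto
  obtain b' where b': "continuous_on UNIV b'" "\<And>y. y \<in> Q \<Longrightarrow> b' y = b y"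
    using Tietze_unbounded[OF Q(2), of UNIV] compact_imp_closed[OF Q(1)] by auto
  have eq: "b' (a x) = b (a x)" "a' x = a x" if "x \<in> closure V" for x
  proof -
    have "x \<in> P" "a x \<in> Q" using that V(2,3) by auto
    then show "b' (a x) = b (a x)" "a' x = a x" by (simp_all add: a'(2) b'(2))
  qed
  have eq': "a' (b y) = a (b y)" "b' y = b y" if "y \<in> closure V'" for y
  proof -
    have "y \<in> Q" "b y \<in> P" using that V'(2,3) by auto
    then show "a' (b y) = a (b y)" "b' y = b y" by (simp_all add: a'(2) b'(2))
  qed
  have "bounded (closure V)" "bounded (closure V')"
    using V(2) V'(2) P(1) Q(1) by (meson bounded_subset compact_imp_bounded)+
  then have bdd: "bounded V" "bounded V'" using closure_subset bounded_subset by blast+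
  have "brouwer_degree V (\<lambda>x. x - b (a x)) = brouwer_degree V (\<lambda>x. x - b' (a' x))"
    by (rule brouwer_degree_cong) (simp add: eq)
  also have "\<dots> = brouwer_degree V' (\<lambda>y. y - a' (b' y))"
    by (rule degree_commute_global[OF a'(1) b'(1) V(1) bdd(1) V'(1) bdd(2)])
       (use fp fp' in \<open>simp_all add: eq eq'\<close>)
  also have "\<dots> = brouwer_degree V' (\<lambda>y. y - a (b y))"
    by (rule brouwer_degree_cong) (simp add: eq')
  finally show ?thesis .
qed

section \<open>The fixed point index\<close>

definition index_data ::
  "'a::euclidean_space set \<Rightarrow> ('a \<Rightarrow> 'a) \<Rightarrow> 'a set \<Rightarrow> 'a set \<Rightarrow> ('a \<Rightarrow> 'a) \<Rightarrow> 'a set \<Rightarrow> bool" where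
  "index_data X f U W r V \<longleftrightarrow> open W \<and> retraction W X r \<and> open V \<and> bounded V \<and>
     {x \<in> U. f x = x} \<subseteq> V \<and> closure V \<subseteq> W \<inter> r -` U"

text \<open>
  Both displacement maps have the form \<open>id - b \<circ> a\<close> and \<open>id - a \<circ> b\<close> for \<open>a = \<gamma> \<circ> r\<close> and
  \<open>b = f \<circ> \<gamma>' \<circ> r'\<close>.
\<close>

lemma degree_conjugate:
  fixes X :: "(real ^ 'n) set" and Y :: "(real ^ 'm) set"
  assumes X: "index_data X f U W r V" and Y: "index_data Y f' U' W' r' V'"
    and sub: "U \<subseteq> C" "C \<subseteq> X" "U' \<subseteq> Y"
    and f: "continuous_on U f" "f ` U \<subseteq> C"
    and \<gamma>: "continuous_on C \<gamma>" "inj_on \<gamma> C" "\<gamma> ` C \<subseteq> Y" "\<gamma> ` U \<subseteq> U'"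
    and \<gamma>': "continuous_on U' \<gamma>'" "\<gamma>' ` U' \<subseteq> U"
    and inv: "\<And>x. x \<in> U \<Longrightarrow> \<gamma>' (\<gamma> x) = x" "\<And>y. y \<in> U' \<Longrightarrow> \<gamma> (\<gamma>' y) = y"
    and conj: "\<And>y. y \<in> U' \<Longrightarrow> f' y = \<gamma> (f (\<gamma>' y))"
  shows "brouwer_degree V (\<lambda>x. x - f (r x)) = brouwer_degree V' (\<lambda>y. y - f' (r' y))"
proof -
  have r: "X \<subseteq> W" "continuous_on W r" "\<And>x. x \<in> W \<Longrightarrow> r x \<in> X" "\<And>x. x \<in> X \<Longrightarrow> r x = x"
    and V: "open V" "bounded V" "{x \<in> U. f x = x} \<subseteq> V" "\<And>x. x \<in> closure V \<Longrightarrow> x \<in> W \<and> r x \<in> U"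
    using X by (auto simp: index_data_def retraction_def)
  have r': "Y \<subseteq> W'" "continuous_on W' r'" "\<And>x. x \<in> W' \<Longrightarrow> r' x \<in> Y" "\<And>x. x \<in> Y \<Longrightarrow> r' x = x"
    and V': "open V'" "bounded V'" "{x \<in> U'. f' x = x} \<subseteq> V'" "\<And>x. x \<in> closure V' \<Longrightarrow> x \<in> W' \<and> r' x \<in> U'"
    using Y by (auto simp: index_data_def retraction_def)
  define a where "a x = \<gamma> (r x)" for x
  define b where "b y = f (\<gamma>' (r' y))" for y
  have b_dom: "\<gamma>' (r' y) \<in> U" if "r' y \<in> U'" for y using that \<gamma>'(2) by auto
  have contb: "continuous_on S b" if "\<And>y. y \<in> S \<Longrightarrow> y \<in> W' \<and> r' y \<in> U'" for S
    unfolding b_def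
    by (intro continuous_on_compose2[OF f(1)] continuous_on_compose2[OF \<gamma>'(1)]
        continuous_on_subset[OF r'(2)]) (use that b_dom in auto)
  \<comment> \<open>\<open>a\<close> must be defined at the values of \<open>f\<close>, which lie in
    \<open>C\<close> but may leave \<open>U\<close>.\<close>
  have conta: "continuous_on S a" if "\<And>x. x \<in> S \<Longrightarrow> x \<in> W \<and> r x \<in> C" for S
    unfolding a_def
    by (intro continuous_on_compose2[OF \<gamma>(1)] continuous_on_subset[OF r(2)]) (use that in auto)
  \<comment> \<open>Compact domains for \<open>a\<close> and \<open>b\<close>: each closure together
    with the image of the other.\<close>
  define P where "P = closure V \<union> b ` closure V'"
  define Q where "Q = closure V' \<union> a ` closure V"
  have comp: "compact (closure V)" "compact (closure V')" using V(2) V'(2) by (simp_all add: compact_closure)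
  have P_dom: "x \<in> W \<and> r x \<in> C" if xP: "x \<in> P" for x
  proof (cases "x \<in> closure V")
    case True
    then show ?thesis using V(4) sub(1) by blast
  next
    case False
    then obtain y where y: "y \<in> closure V'" "x = b y" using xP by (auto simp: P_def)
    have "x \<in> C" using y b_dom[of y] V'(4)[of y] f(2) by (auto simp: b_def)
    then show ?thesis using r sub(2) by auto
  qed
  have Q_dom: "y \<in> W' \<and> r' y \<in> U'" if yQ: "y \<in> Q" for y
  proof (cases "y \<in> closure V'")
    case True
    then show ?thesis using V'(4) by blast
  next
    case False
    then obtain x where x: "x \<in> closure V" "y = a x" using yQ by (auto simp: Q_def)
    have "y \<in> U'" using x V(4)[of x] \<gamma>(4) by (auto simp: a_def)
    then show ?thesis using r' sub(3) by auto
  qed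
  have ba: "b (a x) = f (r x)" if "r x \<in> U" for x
  proof -
    have "a x \<in> U'" using that \<gamma>(4) by (auto simp: a_def)
    then have "r' (a x) = a x" using r'(4) sub(3) by blast
    then show ?thesis using inv(1)[OF that] by (simp add: b_def a_def)
  qed
  have ab: "a (b y) = f' (r' y)" if "r' y \<in> U'" for y
  proof -
    have "b y \<in> C" using b_dom[OF that] f(2) by (auto simp: b_def)
    then have "r (b y) = b y" using r(4) sub(2) by blast
    then show ?thesis using conj[OF that] by (simp add: b_def a_def)
  qed
  have "brouwer_degree V (\<lambda>x. x - f (r x)) = brouwer_degree V (\<lambda>x. x - b (a x))"
    by (rule brouwer_degree_cong) (use V(4) ba in auto)
  also have "\<dots> = brouwer_degree V' (\<lambda>y. y - a (b y))"
  proof (rule degree_commute)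
    have "continuous_on (closure V') b" "continuous_on (closure V) a"
      using V'(4) V(4) sub(1) by (intro contb conta; blast)+
    then show "compact P" "compact Q"
      unfolding P_def Q_def by (intro compact_Un compact_continuous_image comp; simp)+
    show "continuous_on P a" by (rule conta[OF P_dom])
    show "continuous_on Q b" by (rule contb[OF Q_dom])
  next
    fix x assume x: "x \<in> closure V" "b (a x) = x"
    then have rx: "r x \<in> U" and fx: "f (r x) = x" using V(4) ba by auto
    have "f (r x) \<in> C" using f(2) rx by blast
    then have "x \<in> X" using fx sub(2) by auto
    then have "r x = x" by (rule r(4))
    then have xU: "x \<in> U" "f x = x" using rx fx by auto
    have ax: "a x = \<gamma> x" using \<open>r x = x\<close> by (simp add: a_def)
    have "\<gamma> x \<in> U'" using xU(1) \<gamma>(4) by blast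
    moreover have "f' (\<gamma> x) = \<gamma> x" using conj[OF \<open>\<gamma> x \<in> U'\<close>] inv(1)[OF xU(1)] xU(2) by simp
    ultimately show "x \<in> V \<and> a x \<in> V'" using xU V(3) V'(3) ax by auto
  next
    fix y assume y: "y \<in> closure V'" "a (b y) = y"
    then have ry: "r' y \<in> U'" and fy: "f' (r' y) = y" using V'(4) ab by auto
    have gU: "\<gamma>' (r' y) \<in> U" by (rule b_dom[OF ry])
    then have fC: "f (\<gamma>' (r' y)) \<in> C" using f(2) by blast
    have "\<gamma> (f (\<gamma>' (r' y))) \<in> Y" using fC \<gamma>(3) by blast
    then have "y \<in> Y" using fy conj[OF ry] by simp
    then have "r' y = y" by (rule r'(4))
    then have yU: "y \<in> U'" "f' y = y" using ry fy by auto
    have "\<gamma> (f (\<gamma>' y)) = \<gamma> (\<gamma>' y)" using conj[OF yU(1)] yU inv(2) by simp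
    \<comment> \<open>\<open>\<gamma>'\<close> inverts \<open>\<gamma>\<close> on \<open>U\<close>
      only, while \<open>f (\<gamma>' y)\<close> is known just to lie in \<open>C\<close>; so
      injectivity of \<open>\<gamma>\<close> on \<open>C\<close> is what cancels it.\<close>
    then have fx: "f (\<gamma>' y) = \<gamma>' y"
      using inj_onD[OF \<gamma>(2)] fC gU sub(1) \<open>r' y = y\<close> by (metis subsetD)
    have "b y = \<gamma>' y" using fx \<open>r' y = y\<close> by (simp add: b_def)
    then show "y \<in> V' \<and> b y \<in> V" using yU fx gU V(3) V'(3) \<open>r' y = y\<close> by auto
  qed (use V V' in \<open>auto simp: P_def Q_def\<close>)
  also have "\<dots> = brouwer_degree V' (\<lambda>y. y - f' (r' y))"
    by (rule brouwer_degree_cong) (use V'(4) ab in auto)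
  finally show ?thesis .
qed

text \<open>Independence of the choices: \<open>degree_conjugate\<close> with the identity as
  \<open>\<gamma>\<close> compares any two of them.\<close>

lemma fixed_point_index_eq:
  assumes data: "index_data X f U W r V"
    and U: "U \<subseteq> X" and f: "continuous_on U f" "f ` U \<subseteq> X"
  shows "fixed_point_index X f U = brouwer_degree V (\<lambda>x. x - f (r x))"
proof -
  have *: "fixed_point_index X f U =
      (THE d. \<forall>W r V. index_data X f U W r V \<longrightarrow> d = brouwer_degree V (\<lambda>x. x - f (r x)))"
    by (simp add: fixed_point_index_def index_data_def)
  show ?thesis
    unfolding *
  proof (rule the_equality)
    show "\<forall>W' r' V'. index_data X f U W' r' V' \<longrightarrow>
        brouwer_degree V (\<lambda>x. x - f (r x)) = brouwer_degree V' (\<lambda>x. x - f (r' x))"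
    proof (intro allI impI)
      fix W' r' V' assume "index_data X f U W' r' V'"
      then show "brouwer_degree V (\<lambda>x. x - f (r x)) = brouwer_degree V' (\<lambda>x. x - f (r' x))"
        by (rule degree_conjugate[OF data _ U order_refl U f, where \<gamma> = "\<lambda>x. x" and \<gamma>' = "\<lambda>x. x"]) (use U in auto)
    qed
  qed (use data in blast)
qed

lemma compact_open_neighbourhood:
  fixes K :: "'a::euclidean_space set"
  assumes "compact K" "open S" "K \<subseteq> S"
  obtains V where "open V" "bounded V" "K \<subseteq> V" "closure V \<subseteq> S"
proof (cases "K = {}")
  case True
  then show ?thesis by (intro that[of "{}"]) auto
next
  case False
  obtain e where e: "e > 0" "{x. infdist x K \<le> e} \<subseteq> S"
    using compact_in_open_separated[OF False assms] by blast
  let ?V = "{x. infdist x K < e}"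
  have cl: "closed {x. infdist x K \<le> e}" by (intro closed_Collect_le continuous_intros)
  have sub: "closure ?V \<subseteq> {x. infdist x K \<le> e}" by (intro closure_minimal cl) auto
  have "bounded {x. infdist x K \<le> e}"
    using compact_infdist_le[OF False assms(1) e(1)] by (rule compact_imp_bounded)
  then have "bounded ?V" by (rule bounded_subset) auto
  moreover have "open ?V" by (intro open_Collect_less continuous_intros)
  moreover have "K \<subseteq> ?V" using e(1) by auto
  ultimately show ?thesis using sub e(2) by (intro that[of ?V]) auto
qed

text \<open>\<open>r\<close> pulls the relatively open set back to an open set of the ambient space,
  which still contains \<open>K\<close> because \<open>r\<close> fixes \<open>X\<close>.\<close>

lemma index_data_exists:
  fixes X :: "'a::euclidean_space set"
  assumes W: "open W" "retraction W X r" and O: "openin (top_of_set X) O'" and K: "compact K" "K \<subseteq> O'"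
  obtains V where "open V" "bounded V" "K \<subseteq> V" "closure V \<subseteq> W \<inter> r -` O'"
proof -
  obtain S where S: "open S" "O' = X \<inter> S" using O by (auto simp: openin_open)
  have r: "X \<subseteq> W" "continuous_on W r" "\<And>x. x \<in> W \<Longrightarrow> r x \<in> X" "\<And>x. x \<in> X \<Longrightarrow> r x = x"
    using W(2) by (auto simp: retraction_def)
  have "open (W \<inter> r -` S)" by (rule continuous_open_preimage[OF r(2) W(1) S(1)])
  moreover have "W \<inter> r -` S = W \<inter> r -` O'" using r(3) S(2) by auto
  moreover have "K \<subseteq> W \<inter> r -` O'"
  proof
    fix x assume "x \<in> K"
    then have "x \<in> O'" "x \<in> X" using K(2) S(2) by auto
    then show "x \<in> W \<inter> r -` O'" using r(1,4) by auto
  qed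
  ultimately show ?thesis using compact_open_neighbourhood[OF K(1), of "W \<inter> r -` O'"] that by metis
qed

section \<open>The integral with respect to the fixed point index\<close>

lemma compact_fixed_points:
  fixes f :: "'a::real_normed_vector \<Rightarrow> 'a"
  assumes "compact C" "continuous_on C f"
  shows "compact {x \<in> C. f x = x}"
proof -
  have "closed {x \<in> C. x - f x = 0}"
    using assms by (intro continuous_closed_preimage_constant continuous_intros compact_imp_closed)
  then have "compact (C \<inter> {x \<in> C. x - f x = 0})" by (rule compact_Int_closed[OF assms(1)])
  moreover have "C \<inter> {x \<in> C. x - f x = 0} = {x \<in> C. f x = x}" by auto
  ultimately show ?thesis by simp
qed

text \<open>
  An atom of the Boolean algebra generated by the sets \<open>U j\<close> meets the fixed points in a compact
  set, because fixed points avoid the frontiers. Additivity of the degree therefore reduces both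
  sides to the values of the integrand on atoms.
\<close>

lemma index_sum_eq_0:
  fixes X :: "(real ^ 'n) set" and d :: "'i \<Rightarrow> int"
  assumes cX: "compact X" and ENR: "ENR X" and I: "finite I"
    and adm: "\<And>j. j \<in> I \<Longrightarrow> index_admissible X f (U j)"
    and zero: "\<And>x. x \<in> X \<Longrightarrow> (\<Sum>j\<in>I. d j * indicator (U j) x) = 0"
  shows "(\<Sum>j\<in>I. d j * combinatorial_index X f (U j)) = 0"
proof -
  obtain W r where W: "open W" "retraction W X r"
    using ENR by (auto simp: ENR_def retract_of_def)
  have r: "X \<subseteq> W" "continuous_on W r" "\<And>x. x \<in> W \<Longrightarrow> r x \<in> X" "\<And>x. x \<in> X \<Longrightarrow> r x = x"
    using W(2) by (auto simp: retraction_def)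
  define cl where "cl j = top_of_set X closure_of U j" for j
  define int where "int j = top_of_set X interior_of U j" for j
  have UX: "U j \<subseteq> X" and contf: "continuous_on (cl j) f" and fcl: "f ` cl j \<subseteq> X"
    and nofix: "\<And>x. x \<in> cl j \<Longrightarrow> f x = x \<Longrightarrow> x \<in> int j" if "j \<in> I" for j
    using adm[OF that] by (auto simp: index_admissible_def cl_def int_def)
  have intU: "int j \<subseteq> U j" for j unfolding int_def by (rule interior_of_subset)
  have Ucl: "U j \<subseteq> cl j" if "j \<in> I" for j
    unfolding cl_def using closure_of_subset[of "U j" "top_of_set X"] UX[OF that] by simp
  have clX: "cl j \<subseteq> X" for j unfolding cl_def using closure_of_subset_topspace[of "top_of_set X"] by simp
  have intopen: "openin (top_of_set X) (int j)" for j unfolding int_def by simp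
  have clclosed: "closedin (top_of_set X) (cl j)" for j unfolding cl_def by simp
  have clcompact: "compact (cl j)" for j using closedin_compact[OF cX clclosed] .
  define K where "K j = {x \<in> int j. f x = x}" for j
  have Kcl: "K j = {x \<in> cl j. f x = x}" if "j \<in> I" for j
    using nofix[OF that] intU[of j] Ucl[OF that] by (auto simp: K_def)
  have Kcomp: "compact (K j)" if j: "j \<in> I" for j
    unfolding Kcl[OF j] by (rule compact_fixed_points[OF clcompact contf[OF j]])
  define T where "T = (\<Union>j\<in>I. K j)"
  have Tcomp: "compact T" unfolding T_def by (intro compact_UN I Kcomp)
  define type where "type x = {j \<in> I. x \<in> U j}" for x
  \<comment> \<open>The empty type is left out: every fixed point under consideration lies in some
    \<open>U j\<close>.\<close>
  define JJ where "JJ = Pow I - {{}}"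
  have finJJ: "finite JJ" using I by (simp add: JJ_def)
  \<comment> \<open>An open version of the atom, with interiors of the sets in \<open>J\<close> and
    closures of those removed. Only frontier points are lost, and no point of \<open>T\<close> is
    one.\<close>
  define atom where "atom J = (\<Inter>j\<in>J. int j) - (\<Union>j\<in>I - J. cl j)" for J
  have atom_type: "type x = J" if x: "x \<in> atom J" and J: "J \<in> JJ" for x J
  proof (intro equalityI subsetI)
    fix j assume "j \<in> type x"
    then have "j \<in> I" "x \<in> cl j" using Ucl by (auto simp: type_def)
    then show "j \<in> J" using x by (auto simp: atom_def)
  next
    fix j assume j: "j \<in> J"
    then have "x \<in> int j" using x by (auto simp: atom_def)
    then show "j \<in> type x" using intU[of j] j J by (auto simp: type_def JJ_def)
  qed
  have atom_int: "atom J \<subseteq> int j" if "j \<in> J" for J j using that by (auto simp: atom_def)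
  have intX: "int j \<subseteq> X" if "j \<in> I" for j using intU[of j] UX[OF that] by blast
  have atom_X: "atom J \<subseteq> X" if J: "J \<in> JJ" for J
  proof -
    obtain j where "j \<in> J" "j \<in> I" using J by (auto simp: JJ_def)
    then show ?thesis using atom_int[of j J] intX[of j] by blast
  qed
  have atom_open: "openin (top_of_set X) (atom J)" if "J \<in> JJ" for J
  proof -
    have J: "finite J" "J \<noteq> {}" "finite (I - J)" using that I by (auto simp: JJ_def intro: finite_subset)
    have "closedin (top_of_set X) (\<Union>j\<in>I - J. cl j)"
      using J(3) clclosed by (intro closedin_Union) auto
    moreover have "openin (top_of_set X) (\<Inter>j\<in>J. int j)"
      using J intopen by (intro openin_INT2) auto
    ultimately show ?thesis unfolding atom_def by (intro openin_diff)
  qed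
  have T_atom: "x \<in> atom (type x) \<and> type x \<in> JJ \<and> f x = x" if xT: "x \<in> T" for x
  proof -
    obtain j where j: "j \<in> I" "x \<in> K j" using xT by (auto simp: T_def)
    then have fx: "f x = x" and "j \<in> type x" using intU by (auto simp: K_def type_def)
    then have "type x \<in> JJ" by (auto simp: JJ_def type_def)
    moreover have "x \<in> int i" if "i \<in> type x" for i
      using that nofix[of i x] Ucl[of i] fx by (auto simp: type_def)
    moreover have "x \<notin> cl i" if "i \<in> I - type x" for i
      using that nofix[of i x] intU[of i] fx by (auto simp: type_def)
    ultimately show ?thesis using fx by (auto simp: atom_def)
  qed
  have K_atom_comp: "compact (T \<inter> atom J)" if J: "J \<in> JJ" for J
  proof -
    have "\<exists>S. open S \<and> atom L = X \<inter> S" if "L \<in> JJ" for L using atom_open[OF that] by (simp add: openin_open)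
    then obtain S where S: "\<And>L. L \<in> JJ \<Longrightarrow> open (S L) \<and> atom L = X \<inter> S L" by metis
    have TX: "T \<subseteq> X" using intX by (auto simp: T_def K_def)
    \<comment> \<open>The atoms are disjoint and cover \<open>T\<close>, so each of them is also
      closed relative to \<open>T\<close>.\<close>
    have "T \<inter> atom J = T - (\<Union>L\<in>JJ - {J}. S L)"
    proof (intro equalityI subsetI)
      fix x assume x: "x \<in> T \<inter> atom J"
      have "x \<notin> S L" if "L \<in> JJ - {J}" for L
      proof
        assume "x \<in> S L"
        then have "x \<in> atom L" using S[of L] that x TX by auto
        then show False using atom_type[of x L] atom_type[of x J] x J that by auto
      qed
      then show "x \<in> T - (\<Union>L\<in>JJ - {J}. S L)" using x by auto
    next
      fix x assume x: "x \<in> T - (\<Union>L\<in>JJ - {J}. S L)"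
      then have a: "x \<in> atom (type x)" "type x \<in> JJ" using T_atom[of x] by auto
      then have "x \<in> S (type x)" using S[of "type x"] by auto
      then have "type x = J" using x a(2) by auto
      then show "x \<in> T \<inter> atom J" using x a by auto
    qed
    moreover have "compact (T - (\<Union>L\<in>JJ - {J}. S L))"
      using S by (intro compact_diff Tcomp open_UN) auto
    ultimately show ?thesis by simp
  qed
  have "\<exists>V. open V \<and> bounded V \<and> T \<inter> atom J \<subseteq> V \<and> closure V \<subseteq> W \<inter> r -` atom J" if J: "J \<in> JJ" for J
    by (rule index_data_exists[OF W atom_open[OF J] K_atom_comp[OF J]]) auto
  then obtain V where V: "\<And>J. J \<in> JJ \<Longrightarrow> open (V J) \<and> bounded (V J) \<and> T \<inter> atom J \<subseteq> V J \<and>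
      closure (V J) \<subseteq> W \<inter> r -` atom J" by metis
  have V_in: "x \<in> W \<and> r x \<in> atom J" if "J \<in> JJ" "x \<in> closure (V J)" for x J using V[OF that(1)] that(2) by auto
  define e where "e J = brouwer_degree (V J) (\<lambda>x. x - f (r x))" for J
  have index: "combinatorial_index X f (U j) = (\<Sum>J | J \<in> JJ \<and> j \<in> J. e J)" if j: "j \<in> I" for j
  proof -
    define II where "II = {J. J \<in> JJ \<and> j \<in> J}"
    have fII: "finite II" using finJJ by (simp add: II_def)
    \<comment> \<open>The open sets chosen for the atoms with \<open>j \<in> J\<close> together form
      data for \<open>int j\<close>, with the common retraction \<open>r\<close>.\<close>
    define VV where "VV = (\<Union>J\<in>II. V J)"
    have openVV: "open VV" using V by (auto simp: VV_def II_def)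
    have bVV: "bounded VV" using V fII by (auto simp: VV_def II_def)
    have clVV: "closure VV = (\<Union>J\<in>II. closure (V J))"
      unfolding VV_def using fII by (induction II rule: finite_induct) auto
    have VV_in: "x \<in> W \<and> r x \<in> int j" if x: "x \<in> closure VV" for x
    proof -
      obtain J where J: "J \<in> JJ" "j \<in> J" "x \<in> closure (V J)" using x by (auto simp: clVV II_def)
      then show ?thesis using V_in[OF J(1,3)] atom_int[OF J(2)] by auto
    qed
    have KVV: "K j \<subseteq> VV"
    proof
      fix x assume x: "x \<in> K j"
      then have xT: "x \<in> T" using j by (auto simp: T_def)
      have "j \<in> type x" using x j intU by (auto simp: K_def type_def)
      then have "type x \<in> II" using T_atom[OF xT] by (auto simp: II_def)
      moreover have "x \<in> V (type x)" using T_atom[OF xT] V[of "type x"] xT by auto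
      ultimately show "x \<in> VV" by (auto simp: VV_def)
    qed
    have icl: "int j \<subseteq> cl j" using intU[of j] Ucl[OF j] by blast
    have cont_int: "continuous_on (int j) f" by (rule continuous_on_subset[OF contf[OF j] icl])
    have data: "index_data X f (int j) W r VV"
      unfolding index_data_def using W openVV bVV KVV VV_in by (auto simp: K_def)
    have "combinatorial_index X f (U j) = brouwer_degree VV (\<lambda>x. x - f (r x))"
      unfolding combinatorial_index_def int_def[symmetric]
    proof (rule fixed_point_index_eq[OF data _ cont_int])
      show "int j \<subseteq> X" using icl clX by blast
      show "f ` int j \<subseteq> X" using icl fcl[OF j] by blast
    qed
    also have "\<dots> = (\<Sum>J\<in>II. brouwer_degree (V J) (\<lambda>x. x - f (r x)))"
    proof (rule brouwer_degree_additive[OF fII openVV bVV])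
      show "continuous_on (closure VV) (\<lambda>x. x - f (r x))"
        using VV_in by (intro continuous_intros continuous_on_compose2[OF cont_int] continuous_on_subset[OF r(2)]) auto
      show "open (V J)" "V J \<subseteq> VV" if "J \<in> II" for J using V[of J] that by (auto simp: II_def VV_def)
      show "V J \<inter> V L = {}" if JL: "J \<in> II" "L \<in> II" "J \<noteq> L" for J L
      proof -
        have False if x: "x \<in> V J" "x \<in> V L" for x
        proof -
          have "x \<in> closure (V J)" "x \<in> closure (V L)" using x closure_subset by auto
          then have "r x \<in> atom J" "r x \<in> atom L" using V_in JL(1,2) by (auto simp: II_def)
          then show False using atom_type[of "r x" J] atom_type[of "r x" L] JL by (auto simp: II_def)
        qed
        then show ?thesis by auto
      qed
      show "x - f (r x) \<noteq> 0" if x: "x \<in> closure VV" "x \<notin> (\<Union>J\<in>II. V J)" for x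
      proof
        assume "x - f (r x) = 0"
        then have fx: "f (r x) = x" by simp
        have rx: "r x \<in> int j" using VV_in[OF x(1)] by simp
        then have "f (r x) \<in> X" using icl fcl[OF j] by blast
        then have "r x = x" using fx r(4) by simp
        then have "x \<in> K j" using rx fx by (simp add: K_def)
        then show False using KVV x(2) by (auto simp: VV_def)
      qed
    qed
    finally show ?thesis by (simp add: II_def e_def)
  qed
  \<comment> \<open>A point of a nonempty atom shows that the coefficients over \<open>J\<close> sum
    to 0; an empty atom has degree 0.\<close>
  have atom_sum: "e J * (\<Sum>j\<in>J. d j) = 0" if J: "J \<in> JJ" for J
  proof (cases "atom J = {}")
    case True
    then have "closure (V J) = {}" using V[OF J] by auto
    then have "V J = {}" using closure_subset[of "V J"] by auto
    then have "e J = 0"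
      using brouwer_degree_additive[of "{} :: 'i set" "{}" "\<lambda>x. x - f (r x)"] by (simp add: e_def)
    then show ?thesis by simp
  next
    case False
    then obtain x where x: "x \<in> atom J" by auto
    have "J \<subseteq> I" using J by (auto simp: JJ_def)
    have mem: "x \<in> U j \<longleftrightarrow> j \<in> J" if "j \<in> I" for j using atom_type[OF x J] that by (auto simp: type_def)
    have "0 = (\<Sum>j\<in>I. d j * indicator (U j) x)" using zero[of x] atom_X[OF J] x by auto
    also have "\<dots> = (\<Sum>j\<in>I. if j \<in> J then d j else 0)"
      by (intro sum.cong refl) (simp add: mem indicator_def)
    also have "\<dots> = (\<Sum>j\<in>J. d j)"
      using I \<open>J \<subseteq> I\<close> by (simp add: sum.If_cases Int_absorb1)
    finally show ?thesis by simp
  qed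
  have "(\<Sum>j\<in>I. d j * combinatorial_index X f (U j)) = (\<Sum>j\<in>I. \<Sum>J\<in>JJ. if j \<in> J then e J * d j else 0)"
  proof (rule sum.cong[OF refl])
    fix j assume j: "j \<in> I"
    have "d j * (\<Sum>J | J \<in> JJ \<and> j \<in> J. e J) = (\<Sum>J | J \<in> JJ \<and> j \<in> J. e J * d j)"
      by (simp add: sum_distrib_left mult.commute)
    also have "\<dots> = (\<Sum>J\<in>JJ. if j \<in> J then e J * d j else 0)"
      using sum.inter_filter[OF finJJ, of "\<lambda>J. e J * d j" "\<lambda>J. j \<in> J"] by simp
    finally show "d j * combinatorial_index X f (U j) = (\<Sum>J\<in>JJ. if j \<in> J then e J * d j else 0)"
      using index[OF j] by simp
  qed
  also have "\<dots> = (\<Sum>J\<in>JJ. \<Sum>j\<in>I. if j \<in> J then e J * d j else 0)" by (rule sum.swap)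
  also have "\<dots> = (\<Sum>J\<in>JJ. e J * (\<Sum>j\<in>J. d j))"
  proof (rule sum.cong[OF refl])
    fix J assume "J \<in> JJ"
    then have "I \<inter> J = J" by (auto simp: JJ_def)
    then show "(\<Sum>j\<in>I. if j \<in> J then e J * d j else 0) = e J * (\<Sum>j\<in>J. d j)"
      using I by (simp add: sum.If_cases sum_distrib_left)
  qed
  also have "\<dots> = 0" by (intro sum.neutral ballI atom_sum)
  finally show ?thesis .
qed

text \<open>Any other expression of \<open>h\<close>, with \<open>A\<close> appended with
  coefficient \<open>- c\<close>, represents 0, so \<open>index_sum_eq_0\<close> identifies the two
  values.\<close>

lemma index_integral_scaled_indicator:
  fixes X :: "(real ^ 'n) set"
  assumes "compact X" "ENR X" and adm: "index_admissible X f A"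
    and h: "\<And>x. x \<in> X \<Longrightarrow> h x = c * indicator A x"
  shows "index_integral X f h = c * combinatorial_index X f A"
  unfolding index_integral_def
proof (rule the_equality)
  show "\<exists>n (d :: nat \<Rightarrow> int) U. (\<forall>j<n. index_admissible X f (U j)) \<and>
      (\<forall>x\<in>X. h x = (\<Sum>j<n. d j * indicator (U j) x)) \<and>
      c * combinatorial_index X f A = (\<Sum>j<n. d j * combinatorial_index X f (U j))"
    using adm h by (intro exI[of _ 1] exI[of _ "\<lambda>_. c"] exI[of _ "\<lambda>_. A"]) auto
next
  fix v
  assume "\<exists>n (d :: nat \<Rightarrow> int) U. (\<forall>j<n. index_admissible X f (U j)) \<and>
      (\<forall>x\<in>X. h x = (\<Sum>j<n. d j * indicator (U j) x)) \<and>
      v = (\<Sum>j<n. d j * combinatorial_index X f (U j))"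
  then obtain n and d :: "nat \<Rightarrow> int" and U where *: "\<And>j. j < n \<Longrightarrow> index_admissible X f (U j)"
      "\<And>x. x \<in> X \<Longrightarrow> h x = (\<Sum>j<n. d j * indicator (U j) x)"
      "v = (\<Sum>j<n. d j * combinatorial_index X f (U j))"
    by blast
  have "(\<Sum>j<Suc n. (if j < n then d j else - c) * combinatorial_index X f (if j < n then U j else A)) = 0"
  proof (rule index_sum_eq_0[OF assms(1,2)])
    show "index_admissible X f (if j < n then U j else A)" if "j \<in> {..<Suc n}" for j
      using *(1) adm by auto
    show "(\<Sum>j<Suc n. (if j < n then d j else - c) * indicator (if j < n then U j else A) x) = 0"
      if "x \<in> X" for x
      using *(2)[OF that] h[OF that] by simp
  qed simp
  then show "v = c * combinatorial_index X f A" using *(3) by simp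
qed

section \<open>Indices on compact neighbourhood retracts: homeomorphisms and products\<close>

lemma simplicial_complex_compact_ENR:
  fixes K :: "'a::euclidean_space set set"
  assumes "simplicial_complex K"
  shows "compact (\<Union>K)" "ENR (\<Union>K)"
proof -
  have pol: "polytope S" if SK: "S \<in> K" for S
  proof -
    obtain n where "n simplex S" using assms SK by (auto simp: simplicial_complex_def)
    then show ?thesis by (rule simplex_imp_polytope)
  qed
  have fin: "finite K" using assms by (simp add: simplicial_complex_def)
  show "compact (\<Union>K)" using pol polytope_imp_compact by (intro compact_Union fin) auto
  show "ENR (\<Union>K)"
    using pol polytope_imp_compact compact_imp_closed polytope_imp_convex
    by (intro ENR_finite_Union_convex_closed fin) auto
qed

lemma index_data_obtain:
  fixes X :: "'a::euclidean_space set"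
  assumes "ENR X" "openin (top_of_set X) U" "compact {x \<in> U. f x = x}"
  obtains W r V where "index_data X f U W r V"
proof -
  obtain W r where W: "open W" "retraction W X r"
    using assms(1) by (auto simp: ENR_def retract_of_def)
  obtain V where "open V" "bounded V" "{x \<in> U. f x = x} \<subseteq> V" "closure V \<subseteq> W \<inter> r -` U"
    by (rule index_data_exists[OF W assms(2,3)]) auto
  then show ?thesis using W by (intro that[of W r V]) (simp add: index_data_def)
qed

lemma closure_of_self: "top_of_set X closure_of X = X" and interior_of_self: "top_of_set X interior_of X = X"
  using closure_of_topspace[of "top_of_set X"] interior_of_topspace[of "top_of_set X"] by simp_all

lemma index_admissible_self:
  assumes "continuous_on X f" "f ` X \<subseteq> X"
  shows "index_admissible X f X"
  using assms by (simp add: index_admissible_def closure_of_self interior_of_self)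

text \<open>The case \<open>U = C = X\<close> of \<open>degree_conjugate\<close>. It is applied with
  a fiber as \<open>X\<close> and the typical fiber as \<open>Y\<close>.\<close>

lemma fixed_point_index_homeomorphic:
  fixes X :: "(real ^ 'n) set" and Y :: "(real ^ 'm) set"
  assumes X: "compact X" and Y: "compact Y" "ENR Y" and hom: "homeomorphism X Y \<gamma> \<gamma>'"
    and f: "continuous_on Y f" "f ` Y \<subseteq> Y" and f': "\<And>x. x \<in> X \<Longrightarrow> f' x = \<gamma>' (f (\<gamma> x))"
  shows "index_admissible X f' X" "fixed_point_index X f' X = fixed_point_index Y f Y"
proof -
  have \<gamma>: "continuous_on X \<gamma>" "\<gamma> ` X = Y" "continuous_on Y \<gamma>'" "\<gamma>' ` Y = X"
    "\<And>x. x \<in> X \<Longrightarrow> \<gamma>' (\<gamma> x) = x" "\<And>y. y \<in> Y \<Longrightarrow> \<gamma> (\<gamma>' y) = y"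
    using hom by (auto simp: homeomorphism_def)
  have ENRX: "ENR X" using ENR_homeomorphic_ENR[OF Y(2)] hom unfolding homeomorphic_def by blast
  have fX: "continuous_on X f'" "f' ` X \<subseteq> X"
  proof -
    have "continuous_on X (\<lambda>x. \<gamma>' (f (\<gamma> x)))"
      by (intro continuous_on_compose2[OF \<gamma>(3)] continuous_on_compose2[OF f(1)] \<gamma>(1)) (use \<gamma>(2) f(2) in auto)
    then show "continuous_on X f'" by (rule continuous_on_eq) (simp add: f')
    have "(\<lambda>x. \<gamma>' (f (\<gamma> x))) ` X \<subseteq> X" using \<gamma>(2,4) f(2) by blast
    then show "f' ` X \<subseteq> X" by (simp add: f' image_subset_iff)
  qed
  then show "index_admissible X f' X" by (rule index_admissible_self)
  obtain W r V where dX: "index_data X f' X W r V"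
    using index_data_obtain[OF ENRX _ compact_fixed_points[OF X fX(1)]] by auto
  obtain W' r' V' where dY: "index_data Y f Y W' r' V'"
    using index_data_obtain[OF Y(2) _ compact_fixed_points[OF Y(1) f(1)]] by auto
  have "brouwer_degree V (\<lambda>x. x - f' (r x)) = brouwer_degree V' (\<lambda>y. y - f (r' y))"
  proof (rule degree_conjugate[OF dX dY order_refl order_refl order_refl fX])
    show "inj_on \<gamma> X" using \<gamma>(5) by (rule inj_on_inverseI)
    show "f y = \<gamma> (f' (\<gamma>' y))" if "y \<in> Y" for y
    proof -
      have "f y \<in> Y" "\<gamma>' y \<in> X" using f(2) \<gamma>(4) that by blast+
      then show ?thesis using that \<gamma>(6) by (simp add: f')
    qed
  qed (use \<gamma> in auto)
  then show "fixed_point_index X f' X = fixed_point_index Y f Y"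
    using fixed_point_index_eq[OF dX order_refl fX] fixed_point_index_eq[OF dY order_refl f] by simp
qed

lemma index_data_product:
  fixes X :: "(real ^ 'a) set" and Y :: "(real ^ 'b) set"
  assumes X: "index_data X f U W r V" and Y: "index_data Y f' U' W' r' V'"
  shows "index_data (prod_set X Y) (\<lambda>z. join_vec (f (fst_vec z)) (f' (snd_vec z))) (prod_set U U')
    (prod_set W W') (\<lambda>z. join_vec (r (fst_vec z)) (r' (snd_vec z))) (prod_set V V')"
proof -
  have r: "X \<subseteq> W" "continuous_on W r" "\<And>x. x \<in> W \<Longrightarrow> r x \<in> X" "\<And>x. x \<in> X \<Longrightarrow> r x = x"
    and V: "open W" "open V" "bounded V" "{x \<in> U. f x = x} \<subseteq> V" "\<And>x. x \<in> closure V \<Longrightarrow> x \<in> W \<and> r x \<in> U"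
    using X by (auto simp: index_data_def retraction_def)
  have r': "Y \<subseteq> W'" "continuous_on W' r'" "\<And>x. x \<in> W' \<Longrightarrow> r' x \<in> Y" "\<And>x. x \<in> Y \<Longrightarrow> r' x = x"
    and V': "open W'" "open V'" "bounded V'" "{x \<in> U'. f' x = x} \<subseteq> V'" "\<And>x. x \<in> closure V' \<Longrightarrow> x \<in> W' \<and> r' x \<in> U'"
    using Y by (auto simp: index_data_def retraction_def)
  show ?thesis
    unfolding index_data_def
  proof (intro conjI)
    show "retraction (prod_set W W') (prod_set X Y) (\<lambda>z. join_vec (r (fst_vec z)) (r' (snd_vec z)))"
      unfolding retraction_def
    proof (intro conjI)
      show "continuous_on (prod_set W W') (\<lambda>z. join_vec (r (fst_vec z)) (r' (snd_vec z)))"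
        by (intro continuous_intros continuous_on_compose2[OF r(2)] continuous_on_compose2[OF r'(2)])
           (auto simp: prod_set_def)
    qed (use r r' in \<open>auto simp: prod_set_def\<close>)
    show "{z \<in> prod_set U U'. join_vec (f (fst_vec z)) (f' (snd_vec z)) = z} \<subseteq> prod_set V V'"
      using V(4) V'(4) by (auto simp: prod_set_def vec_eq_sum_iff)
    show "closure (prod_set V V') \<subseteq> prod_set W W' \<inter> (\<lambda>z. join_vec (r (fst_vec z)) (r' (snd_vec z))) -` prod_set U U'"
    proof
      fix z assume "z \<in> closure (prod_set V V')"
      then have "fst_vec z \<in> closure V" "snd_vec z \<in> closure V'"
        using closure_prod_set_subset[of V V'] by (auto simp: prod_set_def)
      then show "z \<in> prod_set W W' \<inter> (\<lambda>z. join_vec (r (fst_vec z)) (r' (snd_vec z))) -` prod_set U U'"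
        using V(5) V'(5) by (auto simp: prod_set_def)
    qed
  qed (use V V' in \<open>auto intro: open_prod_set bounded_prod_set\<close>)
qed

text \<open>A zero of the displacement is a value of \<open>f\<close>, hence lies in
  \<open>X\<close> and is fixed by \<open>r\<close>. So it is a fixed point of \<open>f\<close> in
  \<open>U\<close>, and these lie inside the open set \<open>V\<close>.\<close>

lemma index_data_displacement:
  fixes X :: "'a::euclidean_space set"
  assumes data: "index_data X f U W r V" and f: "continuous_on U f" "f ` U \<subseteq> X"
  shows "continuous_on (closure V) (\<lambda>x. x - f (r x))" "\<And>x. x \<in> frontier V \<Longrightarrow> x - f (r x) \<noteq> 0"
proof -
  have r: "continuous_on W r" "\<And>x. x \<in> X \<Longrightarrow> r x = x"
    and V: "open V" "{x \<in> U. f x = x} \<subseteq> V" "\<And>x. x \<in> closure V \<Longrightarrow> x \<in> W \<and> r x \<in> U"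
    using data by (auto simp: index_data_def retraction_def)
  show "continuous_on (closure V) (\<lambda>x. x - f (r x))"
    by (intro continuous_intros continuous_on_compose2[OF f(1)] continuous_on_subset[OF r(1)])
       (use V(3) in auto)
  show "x - f (r x) \<noteq> 0" if "x \<in> frontier V" for x
  proof
    assume "x - f (r x) = 0"
    then have fx: "f (r x) = x" by simp
    have x: "r x \<in> U" "x \<notin> V" using that V(1,3) by (auto simp: frontier_def interior_open)
    have "f (r x) \<in> X" using x(1) f(2) by blast
    then have "r x = x" using fx r(2) by simp
    then show False using x fx V(2) by auto
  qed
qed

theorem theorem3p6:
  fixes \<A> :: "nat \<Rightarrow> real list set set"
    and KX :: "(real ^ 'n) set set" and KB :: "(real ^ 'm) set set" and KF :: "(real ^ 'k) set set"
    and X A clA :: "(real ^ 'n) set" and B B' clB' :: "(real ^ 'm) set" and F :: "(real ^ 'k) set"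
    and p :: "real ^ 'n \<Rightarrow> real ^ 'm"
    and g :: "real ^ 'n \<Rightarrow> (real ^ 'm) \<times> (real ^ 'k)"
    and g' :: "(real ^ 'm) \<times> (real ^ 'k) \<Rightarrow> real ^ 'n"
    and \<phi> :: "real ^ 'm \<Rightarrow> real ^ 'n \<Rightarrow> (real ^ 'm) \<times> (real ^ 'k)"
    and \<psi> :: "real ^ 'm \<Rightarrow> (real ^ 'm) \<times> (real ^ 'k) \<Rightarrow> real ^ 'n"
    and h :: "real ^ 'n \<Rightarrow> int"
    and l :: "real ^ 'n \<Rightarrow> real ^ 'n" and l1 :: "real ^ 'm \<Rightarrow> real ^ 'm" and l2 :: "real ^ 'k \<Rightarrow> real ^ 'k"
  assumes "o_minimal \<A>"
    and "simplicial_complex KX" "X = \<Union>KX"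
    and "simplicial_complex KB" "B = \<Union>KB"
    and "simplicial_complex KF" "F = \<Union>KF"
    and "fiber_bundle X p B F"
    and "definable_map \<A> X p"
    and "B' \<subseteq> B" "definable \<A> B'"
    and "A = X \<inter> p -` B'"
    and "clA = top_of_set X closure_of A"
    and "clB' = top_of_set B closure_of B'"
    \<comment> \<open>\<open>g\<close> is a trivialization over \<open>clB'\<close>, with inverse \<open>g'\<close>\<close>
    and "homeomorphism clA (clB' \<times> F) g g'"
    and "homeomorphism A (B' \<times> F) g g'"
    and "\<forall>x\<in>clA. fst (g x) = p x"
    and "h = indicator A"
    and "continuous_on X l" "l ` X \<subseteq> X"
    and "continuous_on clB' l1" "l1 ` clB' \<subseteq> clB'"
    and "continuous_on F l2" "l2 ` F \<subseteq> F"
    and "\<forall>x\<in>clA. l x = g' (map_prod l1 l2 (g x))"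
    and "\<forall>b \<in> clB' - top_of_set B interior_of B'. l1 b \<noteq> b"
    \<comment> \<open>\<open>\<phi> b\<close> is the identification of the fiber over \<open>b\<close> with \<open>{b} \<times> F\<close>: the one given by \<open>g\<close>
      over \<open>clB'\<close>, and an arbitrary one elsewhere\<close>
    and "\<forall>b\<in>B. homeomorphism (X \<inter> p -` {b}) ({b} \<times> F) (\<phi> b) (\<psi> b)"
    and "\<forall>b\<in>clB'. \<forall>x \<in> X \<inter> p -` {b}. \<phi> b x = g x"
  shows "index_integral X l h =
    index_integral B l1
      (\<lambda>b. index_integral (X \<inter> p -` {b}) (\<lambda>x. \<psi> b (map_prod id l2 (\<phi> b x))) h)"
proof -
  note simplicial = assms(2,4,6) and XBF = assms(3,5,7) and XpB = assms(8)
    and B'B = assms(10) and A = assms(12) and clA = assms(13) and clB' = assms(14)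
    and g_hom = assms(15) and gp = assms(17) and h = assms(18) and l = assms(19,20)
    and l1 = assms(21,22) and l2 = assms(23,24) and l_prod = assms(25) and l1_nofix = assms(26)
    and \<phi> = assms(27)
  have X: "compact X" "ENR X" and B: "compact B" "ENR B" and F: "compact F" "ENR F"
    using simplicial XBF simplicial_complex_compact_ENR by blast+
  have p: "continuous_on X p" "p ` X \<subseteq> B" using XpB by (auto simp: fiber_bundle_def)
  have g: "continuous_on clA g" "g ` clA = clB' \<times> F" "continuous_on (clB' \<times> F) g'" "g' ` (clB' \<times> F) = clA"
    "\<And>x. x \<in> clA \<Longrightarrow> g' (g x) = x" "\<And>y. y \<in> clB' \<times> F \<Longrightarrow> g (g' y) = y"
    using g_hom by (auto simp: homeomorphism_def)
  define U' where "U' = top_of_set B interior_of B'"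
  \<comment> \<open>The index of \<open>A\<close> refers to \<open>intA\<close>, whereas
    \<open>g\<close> identifies this preimage with \<open>U' \<times> F\<close>. Both contain the
    same fixed points of \<open>l\<close>, so data for \<open>U\<close> also serve for
    \<open>intA\<close>.\<close>
  define U where "U = X \<inter> p -` U'"
  define intA where "intA = top_of_set X interior_of A"
  have AX: "A \<subseteq> X" using A by auto
  have A_clA: "A \<subseteq> clA" unfolding clA using closure_of_subset[of A "top_of_set X"] AX by simp
  have clAX: "clA \<subseteq> X" unfolding clA using closure_of_subset_topspace[of "top_of_set X"] by simp
  have B'_clB': "B' \<subseteq> clB'" unfolding clB' using closure_of_subset[of B' "top_of_set B"] B'B by simp
  have clB'B: "clB' \<subseteq> B" unfolding clB' using closure_of_subset_topspace[of "top_of_set B"] by simp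
  have U'B': "U' \<subseteq> B'" unfolding U'_def by (rule interior_of_subset)
  have openU': "openin (top_of_set B) U'" unfolding U'_def by simp
  have openU: "openin (top_of_set X) U"
    unfolding U_def by (rule continuous_openin_preimage[OF p(1) _ openU']) (use p(2) in auto)
  have UA: "U \<subseteq> A" using U'B' A by (auto simp: U_def)
  have U_intA: "U \<subseteq> intA" unfolding intA_def by (rule interior_of_maximal[OF UA openU])
  have intA_A: "intA \<subseteq> A" unfolding intA_def by (rule interior_of_subset)
  have comp_clA: "compact clA" unfolding clA by (rule closedin_compact[OF X(1) closedin_closure_of])
  have comp_clB': "compact clB'" unfolding clB' by (rule closedin_compact[OF B(1) closedin_closure_of])
  have l_clA: "l x \<in> clA \<and> g (l x) = (l1 (fst (g x)), l2 (snd (g x)))" if "x \<in> clA" for x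
  proof -
    have "g x \<in> clB' \<times> F" using g(2) that by blast
    then have "map_prod l1 l2 (g x) \<in> clB' \<times> F" using l1(2) l2(2) by (auto simp: map_prod_def split: prod.splits)
    then show ?thesis using l_prod that g(4,6) by (auto simp: map_prod_def split: prod.splits)
  qed
  \<comment> \<open>The base coordinate of a fixed point is fixed by \<open>l1\<close>, hence
    interior to \<open>B'\<close>.\<close>
  have l_fix: "x \<in> U" if x: "x \<in> clA" "l x = x" for x
  proof -
    have "g x \<in> clB' \<times> F" using g(2) x(1) by blast
    then have b: "fst (g x) \<in> clB'" by auto
    have "l1 (fst (g x)) = fst (g x)" using l_clA[OF x(1)] x(2) by (metis fst_conv)
    then have "fst (g x) \<in> U'" using l1_nofix b by (auto simp: U'_def)
    then show ?thesis using gp x(1) clAX by (auto simp: U_def)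
  qed
  have admA: "index_admissible X l A"
    unfolding index_admissible_def clA[symmetric] intA_def[symmetric]
    using AX continuous_on_subset[OF l(1) clAX] l(2) clAX l_fix U_intA by blast
  have admB': "index_admissible B l1 B'"
    unfolding index_admissible_def clB'[symmetric]
    using B'B l1 clB'B l1_nofix by blast
  have "{x \<in> U. l x = x} = {x \<in> clA. l x = x}" using l_fix UA A_clA by blast
  then have "compact {x \<in> U. l x = x}"
    using compact_fixed_points[OF comp_clA continuous_on_subset[OF l(1) clAX]] by simp
  then obtain W r V where dX: "index_data X l U W r V" by (rule index_data_obtain[OF X(2) openU])
  have dX': "index_data X l intA W r V"
  proof -
    have "{x \<in> intA. l x = x} \<subseteq> {x \<in> U. l x = x}" using l_fix intA_A A_clA by blast
    moreover have "W \<inter> r -` U \<subseteq> W \<inter> r -` intA" using U_intA by blast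
    ultimately show ?thesis using dX unfolding index_data_def by blast
  qed
  have "{b \<in> U'. l1 b = b} = {b \<in> clB'. l1 b = b}" using l1_nofix U'B' B'_clB' by (auto simp: U'_def)
  then have "compact {b \<in> U'. l1 b = b}" using compact_fixed_points[OF comp_clB' l1(1)] by simp
  then obtain W1 r1 V1 where dB: "index_data B l1 U' W1 r1 V1" by (rule index_data_obtain[OF B(2) openU'])
  obtain W2 r2 V2 where dF: "index_data F l2 F W2 r2 V2"
    using index_data_obtain[OF F(2) _ compact_fixed_points[OF F(1) l2(1)]] by auto
  have U'_clB': "U' \<subseteq> clB'" using U'B' B'_clB' by blast
  have l1': "continuous_on U' l1" "l1 ` U' \<subseteq> B"
    using continuous_on_subset[OF l1(1) U'_clB'] l1(2) U'_clB' clB'B by blast+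
  have indexB: "combinatorial_index B l1 B' = brouwer_degree V1 (\<lambda>x. x - l1 (r1 x))"
    unfolding combinatorial_index_def U'_def[symmetric]
    using U'B' B'B by (intro fixed_point_index_eq[OF dB _ l1']) blast
  have indexF: "fixed_point_index F l2 F = brouwer_degree V2 (\<lambda>y. y - l2 (r2 y))"
    by (rule fixed_point_index_eq[OF dF order_refl l2])
  have indexA: "combinatorial_index X l A = brouwer_degree V (\<lambda>x. x - l (r x))"
    unfolding combinatorial_index_def intA_def[symmetric]
  proof (rule fixed_point_index_eq[OF dX'])
    show "intA \<subseteq> X" using intA_A AX by blast
    then show "continuous_on intA l" "l ` intA \<subseteq> X" using continuous_on_subset[OF l(1)] l(2) by blast+
  qed
  let ?\<gamma> = "\<lambda>x. join_vec (fst (g x)) (snd (g x))"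
  let ?\<gamma>' = "\<lambda>z. g' (fst_vec z, snd_vec z)"
  have "brouwer_degree V (\<lambda>x. x - l (r x)) = brouwer_degree (prod_set V1 V2)
      (\<lambda>z. z - join_vec (l1 (fst_vec (join_vec (r1 (fst_vec z)) (r2 (snd_vec z)))))
        (l2 (snd_vec (join_vec (r1 (fst_vec z)) (r2 (snd_vec z))))))"
  \<comment> \<open>Here \<open>C = clA\<close>, because \<open>l\<close> maps \<open>U\<close> into
    \<open>clA\<close> but not necessarily into \<open>U\<close>.\<close>
  proof (rule degree_conjugate[OF dX index_data_product[OF dB dF], where \<gamma> = ?\<gamma> and \<gamma>' = ?\<gamma>' and C = clA])
    show "U \<subseteq> clA" using UA A_clA by blast
    then show "continuous_on U l" "l ` U \<subseteq> clA"
      using continuous_on_subset[OF l(1)] clAX l_clA by blast+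
    show "prod_set U' F \<subseteq> prod_set B F" using U'B' B'B by (auto simp: prod_set_def)
    show "continuous_on clA ?\<gamma>" by (intro continuous_intros g(1))
    have "inj_on g clA" using g(5) by (rule inj_on_inverseI)
    then show "inj_on ?\<gamma> clA" by (auto simp: inj_on_def vec_eq_sum_iff prod_eq_iff)
    show "?\<gamma> ` clA \<subseteq> prod_set B F"
    proof
      fix z assume "z \<in> ?\<gamma> ` clA"
      then obtain x where "x \<in> clA" "z = ?\<gamma> x" by auto
      moreover from this have "g x \<in> clB' \<times> F" using g(2) by blast
      ultimately show "z \<in> prod_set B F" using clB'B by (auto simp: prod_set_def)
    qed
    show "?\<gamma> ` U \<subseteq> prod_set U' F"
    proof
      fix z assume "z \<in> ?\<gamma> ` U"
      then obtain x where x: "x \<in> U" "z = ?\<gamma> x" by auto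
      then have "x \<in> clA" using UA A_clA by blast
      moreover from this have "g x \<in> clB' \<times> F" using g(2) by blast
      moreover have "p x \<in> U'" using x by (simp add: U_def)
      ultimately show "z \<in> prod_set U' F" using gp x(2) by (auto simp: prod_set_def)
    qed
    show "continuous_on (prod_set U' F) ?\<gamma>'"
      using U'_clB' by (intro continuous_on_compose2[OF g(3)] continuous_intros) (auto simp: prod_set_def)
    have dom: "(fst_vec z, snd_vec z) \<in> clB' \<times> F" if "z \<in> prod_set U' F" for z
      using that U'_clB' by (auto simp: prod_set_def)
    show "?\<gamma>' ` prod_set U' F \<subseteq> U"
    proof
      fix x assume "x \<in> ?\<gamma>' ` prod_set U' F"
      then obtain z where z: "z \<in> prod_set U' F" "x = ?\<gamma>' z" by auto
      have "x \<in> clA" using g(4) dom[OF z(1)] z(2) by blast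
      moreover have "g x = (fst_vec z, snd_vec z)" using g(6)[OF dom[OF z(1)]] z(2) by simp
      ultimately have "p x = fst_vec z" using gp by (metis fst_conv)
      then show "x \<in> U" using z(1) \<open>x \<in> clA\<close> clAX by (auto simp: U_def prod_set_def)
    qed
    show "?\<gamma>' (?\<gamma> x) = x" if "x \<in> U" for x using that UA A_clA g(5)[of x] by auto
    show "?\<gamma> (?\<gamma>' z) = z" if "z \<in> prod_set U' F" for z using g(6)[OF dom[OF that]] by simp
    show "join_vec (l1 (fst_vec z)) (l2 (snd_vec z)) = ?\<gamma> (l (?\<gamma>' z))" if z: "z \<in> prod_set U' F" for z
    proof -
      have "?\<gamma>' z \<in> clA" using g(4) dom[OF z] by blast
      then show ?thesis using l_clA[of "?\<gamma>' z"] g(6)[OF dom[OF z]] by simp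
    qed
  qed (use clAX in auto)
  also have "\<dots> = brouwer_degree (prod_set V1 V2)
      (\<lambda>z. join_vec (fst_vec z - l1 (r1 (fst_vec z))) (snd_vec z - l2 (r2 (snd_vec z))))"
    by (rule brouwer_degree_cong) (simp add: vec_eq_sum_iff)
  also have "\<dots> = brouwer_degree V1 (\<lambda>x. x - l1 (r1 x)) * brouwer_degree V2 (\<lambda>y. y - l2 (r2 y))"
  proof (rule brouwer_degree_product)
    show "open V1" "bounded V1" "open V2" "bounded V2" using dB dF by (auto simp: index_data_def)
  qed (use index_data_displacement[OF dB l1'] index_data_displacement[OF dF l2] in auto)
  finally have main: "combinatorial_index X l A = combinatorial_index B l1 B' * fixed_point_index F l2 F"
    by (simp add: indexA indexB indexF)
  \<comment> \<open>On a fiber \<open>h\<close> is the constant \<open>indicator B' b\<close>, so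
    the inner integral is this multiple of the index of the whole fiber, which the identification
    with \<open>F\<close> turns into the index of \<open>l2\<close>.\<close>
  have inner: "index_integral (X \<inter> p -` {b}) (\<lambda>x. \<psi> b (map_prod id l2 (\<phi> b x))) h =
      fixed_point_index F l2 F * indicator B' b" if b: "b \<in> B" for b
  proof -
    let ?X = "X \<inter> p -` {b}" and ?f = "\<lambda>x. \<psi> b (map_prod id l2 (\<phi> b x))"
    let ?\<gamma> = "\<lambda>x. snd (\<phi> b x)" and ?\<gamma>' = "\<lambda>y. \<psi> b (b, y)"
    have hb: "continuous_on ?X (\<phi> b)" "\<phi> b ` ?X = {b} \<times> F" "continuous_on ({b} \<times> F) (\<psi> b)"
      "\<psi> b ` ({b} \<times> F) = ?X" "\<And>x. x \<in> ?X \<Longrightarrow> \<psi> b (\<phi> b x) = x" "\<And>y. y \<in> {b} \<times> F \<Longrightarrow> \<phi> b (\<psi> b y) = y"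
      using \<phi> b by (auto simp: homeomorphism_def)
    have fst\<phi>: "\<phi> b x = (b, snd (\<phi> b x)) \<and> snd (\<phi> b x) \<in> F" if "x \<in> ?X" for x
      using hb(2) that by (metis (no_types, lifting) imageI mem_Sigma_iff prod.collapse singletonD)
    have hom: "homeomorphism ?X F ?\<gamma> ?\<gamma>'"
      unfolding homeomorphism_def
    proof (intro conjI ballI)
      show "continuous_on ?X ?\<gamma>" by (intro continuous_on_snd hb(1))
      show "continuous_on F ?\<gamma>'" by (intro continuous_on_compose2[OF hb(3)] continuous_intros) auto
      show "?\<gamma> ` ?X = F" using hb(2) by (metis image_image snd_image_times insert_not_empty)
      show "?\<gamma>' ` F = ?X" using hb(4) by (auto simp: image_iff)
      show "?\<gamma>' (?\<gamma> x) = x" if "x \<in> ?X" for x using hb(5)[OF that] fst\<phi>[OF that] by metis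
      show "?\<gamma> (?\<gamma>' y) = y" if "y \<in> F" for y using hb(6)[of "(b, y)"] that by simp
    qed
    have cX: "compact ?X" and ENRX: "ENR ?X"
      using homeomorphic_compactness[of ?X F] F hom ENR_homeomorphic_ENR[of F ?X]
      unfolding homeomorphic_def by blast+
    have feq: "?f x = ?\<gamma>' (l2 (?\<gamma> x))" if "x \<in> ?X" for x
      using fst\<phi>[OF that] by (metis id_apply map_prod_simp)
    have adm: "index_admissible ?X ?f ?X"
      and ind: "fixed_point_index ?X ?f ?X = fixed_point_index F l2 F"
      by (rule fixed_point_index_homeomorphic[OF cX F hom l2 feq], assumption)+
    have "index_integral ?X ?f h = indicator B' b * combinatorial_index ?X ?f ?X"
      by (rule index_integral_scaled_indicator[OF cX ENRX adm]) (auto simp: h A indicator_def)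
    then show ?thesis
      by (simp add: combinatorial_index_def interior_of_self ind)
  qed
  have "index_integral X l h = combinatorial_index X l A"
    using index_integral_scaled_indicator[OF X admA, of h 1] h by simp
  moreover have "index_integral B l1
      (\<lambda>b. index_integral (X \<inter> p -` {b}) (\<lambda>x. \<psi> b (map_prod id l2 (\<phi> b x))) h) =
      fixed_point_index F l2 F * combinatorial_index B l1 B'"
    using inner by (intro index_integral_scaled_indicator[OF B admB']) auto
  ultimately show ?thesis using main by simp
qed

end
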